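(* Let $m\ge1$ be an integer, $\omega_j=(\cos(\pi j/m),\sin(\pi j/m))$, let $f\in\mathcal{S}(\mathbb{R}^2)$, and let $\psi\in C^\infty(S^1)$ be even. Define $$f_{\psi,\delta}(x)=\frac{2\pi}{m}\sum_{j=1}^m\psi(\omega_j)\,(\mathcal{H}\mathcal{R}f)(\omega_j,x\cdot\omega_j),$$ and let $f_\psi=\psi(D/|D|)f$, i.e. $\hat f_\psi(\xi)=\psi(\xi/|\xi|)\hat f(\xi)$. Then: (a) $f\mapsto f_{\psi,\delta}$ is the Fourier multiplier $$\hat f_{\psi,\delta}(\xi)=\frac{\pi}{m}\sum_{j=1}^m\psi(\omega_j)\,\delta(\xi\cdot\omega_j^\perp)\,|\xi|\,\hat f(\xi).$$ Also, $$\hat f_{\psi,\delta}(\xi)=\frac{\pi}{m}\sum_{j=1}^m\delta(\xi\cdot\omega_j^\perp)\,|\xi|\,\big[\psi(\xi/|\xi|)\hat f(\xi)\big];$$ thus $f_{\psi,\delta}$ is a linear operator applied to $f_\psi$, which is a Fourier multiplier as well. (b) We also have $$f_{\psi,\delta}=f_\psi+\sum_{k=1}^\infty G_kf_\psi,$$ where $G_k$ is the Fourier multiplier $G_k:\ \hat f(\xi)\longmapsto 2\cos\big(2mk\arg(\xi)\big)\,\hat f(\xi)$.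
   Context: The Radon transform in the plane is $\mathcal{R}f(\omega,p)=\int_{x\cdot\omega=p}f\,d\ell$, $\omega\in S^1$, $p\in\mathbb{R}$. The operator $\mathcal{H}=\frac1{4\pi}H\partial_p$ acts in the $p$ variable, where $Hg(p)=\frac1\pi\,\mathrm{pv}\!\int\frac{g(s)}{p-s}\,ds$ is the Hilbert transform; equivalently $\mathcal{H}=\frac1{4\pi}|D_p|$. Fourier transform convention: $\hat f(\xi)=\int e^{-ix\cdot\xi}f(x)\,dx$. For $\omega=(\omega_1,\omega_2)$, $\omega^\perp=(-\omega_2,\omega_1)$. $\delta(\xi\cdot\omega_j^\perp)$ is the distribution $\rho\mapsto\int_{\mathbb{R}}\rho(t\omega_j)\,dt$ on $\mathbb{R}^2$ (arc-length measure on the line $\mathbb{R}\omega_j$); the products are understood as this measure multiplied by the indicated functions, the factor $|\xi|$ making the value at $\xi=0$ irrelevant. $\arg(\xi)$ is the polar angle of $\xi\neq0$. The infinite sum is understood in the sense of tempered distributions. *)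

theory Defs
  imports "HOL-Analysis.Analysis"
begin

text \<open>Multi-indices are lists of basis vectors; \<open>iter_partial []\<close> is the identity.\<close>

primrec iter_partial ::
  "'a::euclidean_space list \<Rightarrow> ('a \<Rightarrow> 'b::real_normed_vector) \<Rightarrow> 'a \<Rightarrow> 'b" where
  "iter_partial [] f = f"
| "iter_partial (b # bs) f = (\<lambda>x. frechet_derivative (iter_partial bs f) (at x) b)"

definition smooth :: "('a::euclidean_space \<Rightarrow> 'b::real_normed_vector) \<Rightarrow> bool" where
  "smooth f \<longleftrightarrow> (\<forall>bs x. set bs \<subseteq> Basis \<longrightarrow> iter_partial bs f differentiable (at x))"

definition schwartz :: "('a::euclidean_space \<Rightarrow> complex) set" where
  "schwartz = {f. smooth f \<and>
     (\<forall>N bs. set bs \<subseteq> Basis \<longrightarrow>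
        bounded (range (\<lambda>x. (1 + norm x) ^ N *\<^sub>R iter_partial bs f x)))}"

definition schwartz_norm :: "nat \<Rightarrow> ('a::euclidean_space \<Rightarrow> complex) \<Rightarrow> real" where
  "schwartz_norm N \<phi> =
     (\<Sum>bs \<in> {bs. set bs \<subseteq> Basis \<and> length bs \<le> N}.
        SUP x. (1 + norm x) ^ N * norm (iter_partial bs \<phi> x))"

text \<open>
  A distribution is a functional on functions of which only the values on \<open>schwartz\<close> matter;
  accordingly, equality of distributions is \<open>tempered_eq\<close>, not HOL equality.
\<close>

type_synonym 'a dist = "('a \<Rightarrow> complex) \<Rightarrow> complex"

definition tempered :: "'a::euclidean_space dist \<Rightarrow> bool" where
  "tempered T \<longleftrightarrow>
     (\<forall>\<phi>\<in>schwartz. \<forall>\<theta>\<in>schwartz. \<forall>a b.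
        T (\<lambda>x. a * \<phi> x + b * \<theta> x) = a * T \<phi> + b * T \<theta>) \<and>
     (\<exists>C N. \<forall>\<phi>\<in>schwartz. norm (T \<phi>) \<le> C * schwartz_norm N \<phi>)"

definition tempered_eq :: "'a::euclidean_space dist \<Rightarrow> 'a dist \<Rightarrow> bool" (infix \<open>=\<^sub>S\<close> 50) where
  "S =\<^sub>S T \<longleftrightarrow> tempered S \<and> tempered T \<and> (\<forall>\<phi>\<in>schwartz. S \<phi> = T \<phi>)"

definition tempered_summable :: "(nat \<Rightarrow> 'a::euclidean_space dist) \<Rightarrow> bool" where
  "tempered_summable T \<longleftrightarrow>
     (\<forall>k. tempered (T k)) \<and> (\<forall>\<phi>\<in>schwartz. summable (\<lambda>k. T k \<phi>))"

definition tempered_suminf :: "(nat \<Rightarrow> 'a dist) \<Rightarrow> 'a dist" where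
  "tempered_suminf T = (\<lambda>\<phi>. \<Sum>k. T k \<phi>)"

definition dist_add :: "'a dist \<Rightarrow> 'a dist \<Rightarrow> 'a dist" where
  "dist_add S T = (\<lambda>\<phi>. S \<phi> + T \<phi>)"

definition dist_scale :: "complex \<Rightarrow> 'a dist \<Rightarrow> 'a dist" where
  "dist_scale c T = (\<lambda>\<phi>. c * T \<phi>)"

definition dist_sum :: "('i \<Rightarrow> 'a dist) \<Rightarrow> 'i set \<Rightarrow> 'a dist" where
  "dist_sum T I = (\<lambda>\<phi>. \<Sum>i\<in>I. T i \<phi>)"

text \<open>
  The product of a function and a distribution. It is applied to distributions \<open>T\<close> given by
  integration against a measure, so \<open>g\<close> need not be smooth.
\<close>

definition dist_mult :: "('a \<Rightarrow> complex) \<Rightarrow> 'a dist \<Rightarrow> 'a dist" where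
  "dist_mult g T = (\<lambda>\<phi>. T (\<lambda>x. g x * \<phi> x))"

definition fun_dist :: "('a::euclidean_space \<Rightarrow> complex) \<Rightarrow> 'a dist" where
  "fun_dist u = (\<lambda>\<phi>. LINT x|lborel. u x * \<phi> x)"

definition poly_bounded :: "('a::real_normed_vector \<Rightarrow> complex) \<Rightarrow> bool" where
  "poly_bounded g \<longleftrightarrow> (\<exists>C N. \<forall>x. norm (g x) \<le> C * (1 + norm x) ^ N)"

definition fourier :: "('a::euclidean_space \<Rightarrow> complex) \<Rightarrow> 'a \<Rightarrow> complex" where
  "fourier f \<xi> = (LINT x|lborel. exp (- \<i> * complex_of_real (x \<bullet> \<xi>)) * f x)"

definition inv_fourier :: "('a::euclidean_space \<Rightarrow> complex) \<Rightarrow> 'a \<Rightarrow> complex" where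
  "inv_fourier g x = complex_of_real (1 / (2 * pi) ^ DIM('a)) *
     (LINT \<xi>|lborel. exp (\<i> * complex_of_real (x \<bullet> \<xi>)) * g \<xi>)"

definition fourier_dist :: "'a::euclidean_space dist \<Rightarrow> 'a dist" where
  "fourier_dist T = (\<lambda>\<phi>. T (fourier \<phi>))"

definition inv_fourier_dist :: "'a::euclidean_space dist \<Rightarrow> 'a dist" where
  "inv_fourier_dist T = (\<lambda>\<phi>. T (inv_fourier \<phi>))"

text \<open>
  Multipliers are applied to tempered distributions whose Fourier transform is a polynomially
  bounded function that is continuous away from the origin. Continuity makes the restriction of
  the Fourier transform to lines through the origin meaningful; the normalisation \<open>g 0 = 0\<close>
  only serves to make the function unique.
\<close>

definition is_fourier_fun :: "'a::euclidean_space dist \<Rightarrow> ('a \<Rightarrow> complex) \<Rightarrow> bool" where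
  "is_fourier_fun u g \<longleftrightarrow>
     continuous_on (- {0}) g \<and> g 0 = 0 \<and> poly_bounded g \<and> fourier_dist u =\<^sub>S fun_dist g"

definition multiplier_domain :: "'a::euclidean_space dist set" where
  "multiplier_domain = {u. tempered u \<and> (\<exists>g. is_fourier_fun u g)}"

definition fourier_fun :: "'a::euclidean_space dist \<Rightarrow> 'a \<Rightarrow> complex" where
  "fourier_fun u = (THE g. is_fourier_fun u g)"

text \<open>The Fourier multiplier whose symbol is the measure, given as a functional, \<open>M\<close>.\<close>

definition fourier_multiplier :: "'a::euclidean_space dist \<Rightarrow> 'a dist \<Rightarrow> 'a dist" where
  "fourier_multiplier M u = inv_fourier_dist (dist_mult (fourier_fun u) M)"

definition linear_operator :: "('a::euclidean_space dist \<Rightarrow> 'a dist) \<Rightarrow> bool" where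
  "linear_operator A \<longleftrightarrow>
     (\<forall>u\<in>multiplier_domain. \<forall>v\<in>multiplier_domain. \<forall>a b.
        dist_add (dist_scale a u) (dist_scale b v) \<in> multiplier_domain \<and>
        A (dist_add (dist_scale a u) (dist_scale b v))
          =\<^sub>S dist_add (dist_scale a (A u)) (dist_scale b (A v)))"

definition has_symbol :: "('a::euclidean_space dist \<Rightarrow> 'a dist) \<Rightarrow> 'a dist \<Rightarrow> bool" where
  "has_symbol A M \<longleftrightarrow>
     (\<forall>u\<in>multiplier_domain. \<forall>g. is_fourier_fun u g \<longrightarrow>
        fourier_dist (A u) =\<^sub>S dist_mult g M)"

definition circle_point :: "real \<Rightarrow> real ^ 2" where
  "circle_point \<theta> = vector [cos \<theta>, sin \<theta>]"

definition smooth_on_circle :: "(real ^ 2 \<Rightarrow> complex) \<Rightarrow> bool" where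
  "smooth_on_circle \<psi> \<longleftrightarrow> smooth (\<lambda>\<theta>. \<psi> (circle_point \<theta>))"

definition even_on_circle :: "(real ^ 2 \<Rightarrow> complex) \<Rightarrow> bool" where
  "even_on_circle \<psi> \<longleftrightarrow> (\<forall>\<omega>\<in>sphere 0 1. \<psi> (- \<omega>) = \<psi> \<omega>)"

definition polar_angle :: "real ^ 2 \<Rightarrow> real" where
  "polar_angle \<xi> = Arg (Complex (\<xi> $ 1) (\<xi> $ 2))"

definition perp :: "real ^ 2 \<Rightarrow> real ^ 2" where
  "perp \<omega> = vector [- (\<omega> $ 2), \<omega> $ 1]"

text \<open>
  For \<open>norm \<omega> = 1\<close>, \<open>t \<mapsto> p \<omega> + t \<omega>\<^sup>\<bottom>\<close> is the arc-length parametrisation of the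
  line \<open>x \<bullet> \<omega> = p\<close>.
\<close>

definition radon :: "(real ^ 2 \<Rightarrow> complex) \<Rightarrow> real ^ 2 \<Rightarrow> real \<Rightarrow> complex" where
  "radon f \<omega> p = (LINT t|lborel. f (p *\<^sub>R \<omega> + t *\<^sub>R perp \<omega>))"

definition hilbert :: "(real \<Rightarrow> complex) \<Rightarrow> real \<Rightarrow> complex" where
  "hilbert g p = complex_of_real (1 / pi) *
     Lim (at_right 0) (\<lambda>\<epsilon>. LINT s:{s. \<epsilon> < \<bar>p - s\<bar>}|lborel. g s / complex_of_real (p - s))"

definition ramp_filter :: "(real \<Rightarrow> complex) \<Rightarrow> real \<Rightarrow> complex" where
  "ramp_filter g p =
     complex_of_real (1 / (4 * pi)) * hilbert (\<lambda>s. vector_derivative g (at s)) p"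

definition dir :: "nat \<Rightarrow> nat \<Rightarrow> real ^ 2" where
  "dir m j = circle_point (pi * real j / real m)"

definition f_psi_delta ::
  "nat \<Rightarrow> (real ^ 2 \<Rightarrow> complex) \<Rightarrow> (real ^ 2 \<Rightarrow> complex) \<Rightarrow> real ^ 2 \<Rightarrow> complex" where
  "f_psi_delta m \<psi> f x = complex_of_real (2 * pi / real m) *
     (\<Sum>j=1..m. \<psi> (dir m j) * ramp_filter (radon f (dir m j)) (x \<bullet> dir m j))"

text \<open>Here \<open>sgn \<xi>\<close> is the vector \<open>\<xi> / norm \<xi>\<close>.\<close>

definition f_psi :: "(real ^ 2 \<Rightarrow> complex) \<Rightarrow> (real ^ 2 \<Rightarrow> complex) \<Rightarrow> (real ^ 2) dist" where
  "f_psi \<psi> f = inv_fourier_dist (fun_dist (\<lambda>\<xi>. \<psi> (sgn \<xi>) * fourier f \<xi>))"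

text \<open>For a unit vector \<open>\<omega>\<close> this is \<open>\<delta>(\<xi> \<bullet> \<omega>\<^sup>\<bottom>)\<close>, arc length on the line spanned by \<open>\<omega>\<close>.\<close>

definition line_delta :: "real ^ 2 \<Rightarrow> (real ^ 2) dist" where
  "line_delta \<omega> = (\<lambda>\<rho>. LINT t|lborel. \<rho> (t *\<^sub>R \<omega>))"

definition line_symbol :: "nat \<Rightarrow> (real ^ 2) dist" where
  "line_symbol m = dist_scale (complex_of_real (pi / real m))
     (dist_sum (\<lambda>j. dist_mult (\<lambda>\<xi>. complex_of_real (norm \<xi>)) (line_delta (dir m j))) {1..m})"

definition G :: "nat \<Rightarrow> nat \<Rightarrow> (real ^ 2) dist \<Rightarrow> (real ^ 2) dist" where
  "G m k = fourier_multiplier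
     (fun_dist (\<lambda>\<xi>. complex_of_real (2 * cos (2 * real m * real k * polar_angle \<xi>))))"

end

theory Submission
  imports Defs "HOL-Probability.Probability"
begin

text \<open>
  By the slice theorem the one-dimensional Fourier transform of the Radon transform in direction
  \<open>\<omega>\<close> is the restriction of the transform of \<open>f\<close> to the line spanned by \<open>\<omega>\<close>. Hence each filtered
  back projection is a superposition of the plane waves \<open>exp (i \<sigma> x \<bullet> \<omega>\<^sub>j)\<close>, weighted by
  \<open>\<bar>\<sigma>\<bar>\<close> times this restriction, and pairing it with a test function gives the multiplier
  supported on the \<open>m\<close> lines.

  For the series, integration over the plane is written as integration over the slope of lines
  through the origin. A test function turns \<open>f_psi\<close> into a Lipschitz function \<open>L\<close> of the angle with
  period \<open>\<pi>\<close>, and the partial sums become the integrals of \<open>L\<close> against the Dirichlet kernel in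
  \<open>2 m \<theta>\<close>; they tend to \<open>\<pi> / m\<close> times the sum of \<open>L\<close> over the \<open>m\<close> directions. Only decay and the
  Lipschitz property of Fourier transforms of Schwartz functions are used, never their smoothness.
\<close>
section \<open>Lebesgue integration on Euclidean spaces and Gaussians\<close>

text \<open>The weight |s| that the ramp filter puts on each line is also the Jacobian of the plane
  parametrised by lines through the origin. Pairing \<open>f_psi\<close> with a test function is
  therefore the integral of \<open>L\<close> over an interval of length \<pi>, pairing
  \<open>f_psi_delta\<close> is the equispaced quadrature of this integral with nodes \<pi> j / m,
  and the terms \<open>G m k\<close> are the aliasing error: cos (2 m k \<theta>) equals 1 at every
  node, so the rule cannot tell these modes from constants. Evenness of \<psi> enters because a line
  carries both \<omega> and - \<omega>; it makes \<psi> constant along each line without the origin,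
  so that \<psi> factors out of the line integrals.

  The obstacle on the side of distributions is that transforms of test functions are inserted into
  functionals whose continuity is expressed on \<open>schwartz\<close>. These functionals are
  integrals against measures of polynomial growth, so they are estimated on a larger class, given by
  pointwise decay alone, that contains a Schwartz function together with its transform. Inversion is
  then applied only in the order \<open>inv_fourier (fourier \<phi>)\<close>.\<close>

lemma lborel_affine_integral:
  fixes F :: "'a::euclidean_space \<Rightarrow> 'b::{banach, second_countable_topology}"
  assumes c: "c \<noteq> 0" and [measurable]: "F \<in> borel_measurable borel"
  shows "(LINT x|lborel. F x) = \<bar>c\<bar> ^ DIM('a) *\<^sub>R (LINT x|lborel. F (t + c *\<^sub>R x))"
  by (subst lborel_affine[OF c, of t]) (simp add: integral_density integral_distr c)

lemma lborel_affine_integrable: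
  fixes F :: "'a::euclidean_space \<Rightarrow> 'b::{banach, second_countable_topology}"
  assumes c: "c \<noteq> 0" and F: "integrable lborel F"
  shows "integrable lborel (\<lambda>x. F (t + c *\<^sub>R x))"
proof -
  have [measurable]: "F \<in> borel_measurable borel"
    using borel_measurable_integrable[OF F] by simp
  have "integrable (density (distr lborel borel (\<lambda>x. t + c *\<^sub>R x)) (\<lambda>_. \<bar>c\<bar>^DIM('a))) F"
    using F lborel_affine[OF c, of t] by simp
  then have "integrable lborel (\<lambda>x. \<bar>c\<bar> ^ DIM('a) *\<^sub>R F (t + c *\<^sub>R x))"
    by (subst (asm) integrable_density) (simp_all add: integrable_distr_eq)
  then have "integrable lborel (\<lambda>x. (1 / \<bar>c\<bar> ^ DIM('a)) *\<^sub>R \<bar>c\<bar> ^ DIM('a) *\<^sub>R F (t + c *\<^sub>R x))"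
    by (rule integrable_scaleR_right)
  then show ?thesis using c by simp
qed

lemma
  fixes h :: "'a::euclidean_space \<Rightarrow> real \<Rightarrow> 'b::{real_normed_field, banach, second_countable_topology}"
  assumes h: "\<And>b. b \<in> Basis \<Longrightarrow> integrable lborel (h b)"
  shows lborel_integrable_prod_Basis: "integrable lborel (\<lambda>x. \<Prod>b\<in>Basis. h b (x \<bullet> b))"
    and lborel_integral_prod_Basis:
      "(LINT x|lborel. (\<Prod>b\<in>Basis. h b (x \<bullet> b))) = (\<Prod>b\<in>Basis. LINT t|lborel. h b t)"
proof -
  interpret product_sigma_finite "\<lambda>_::'a. lborel :: real measure" ..
  have hm: "h b \<in> borel_measurable borel" if "b \<in> Basis" for b
    using borel_measurable_integrable[OF h[OF that]] by simp
  have m: "(\<lambda>x. \<Prod>b\<in>Basis. h b (x \<bullet> b)) \<in> borel_measurable borel"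
    by (intro borel_measurable_prod measurable_compose[OF _ hm]) auto
  have T: "(\<lambda>f. \<Sum>b\<in>Basis. f b *\<^sub>R b) \<in> (\<Pi>\<^sub>M b\<in>Basis. lborel) \<rightarrow>\<^sub>M (borel :: 'a measure)"
    by measurable
  have eq: "(\<Prod>b\<in>Basis. h b ((\<Sum>c\<in>Basis. f c *\<^sub>R c) \<bullet> b)) = (\<Prod>b\<in>Basis. h b (f b))" for f :: "'a \<Rightarrow> real"
    by (intro prod.cong) auto
  show "integrable lborel (\<lambda>x. \<Prod>b\<in>Basis. h b (x \<bullet> b))"
    by (subst lborel_eq, subst integrable_distr_eq[OF T m], unfold eq)
       (intro product_integrable_prod h; simp)
  show "(LINT x|lborel. (\<Prod>b\<in>Basis. h b (x \<bullet> b))) = (\<Prod>b\<in>Basis. LINT t|lborel. h b t)"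
    by (subst lborel_eq, subst integral_distr[OF T m], unfold eq)
       (intro product_integral_prod h; simp)
qed

text \<open>Each coordinate satisfies 1 + (x \<bullet> b)^2 \<le> (1 + norm x)^2, so a product of
  one-dimensional densities 1 / (1 + t^2) is a majorant. This is the origin of the exponent
  \<open>2 * DIM('a)\<close>, the standard price of integrability in all later estimates.\<close>

lemma integrable_decay:
  "integrable lborel (\<lambda>x::'a::euclidean_space. inverse ((1 + norm x) ^ (2 * DIM('a))))"
proof (rule Bochner_Integration.integrable_bound)
  have "set_integrable lborel (einterval (-\<infinity>) \<infinity>) (\<lambda>x::real. inverse (1 + x\<^sup>2))"
    by (rule integrable_inverse_1_plus_square)
  then have "integrable lborel (\<lambda>x::real. inverse (1 + x\<^sup>2))"
    by (simp add: set_integrable_def)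
  then show "integrable lborel (\<lambda>x::'a. \<Prod>b\<in>Basis. inverse (1 + (x \<bullet> b)\<^sup>2))"
    by (rule lborel_integrable_prod_Basis)
  have "inverse ((1 + norm x) ^ (2 * DIM('a))) \<le> (\<Prod>b\<in>Basis. inverse (1 + (x \<bullet> b)\<^sup>2))" for x :: 'a
  proof -
    have "(\<Prod>b\<in>Basis. 1 + (x \<bullet> b)\<^sup>2) \<le> (\<Prod>b\<in>(Basis::'a set). (1 + norm x)\<^sup>2)"
    proof (intro prod_mono conjI)
      fix b :: 'a assume "b \<in> Basis"
      then have "\<bar>x \<bullet> b\<bar>\<^sup>2 \<le> (norm x)\<^sup>2" by (intro power_mono Basis_le_norm) auto
      then show "1 + (x \<bullet> b)\<^sup>2 \<le> (1 + norm x)\<^sup>2" using norm_ge_zero[of x] by (simp only: power2_sum power2_abs one_power2 mult_1_right)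
    qed auto
    also have "\<dots> = (1 + norm x) ^ (2 * DIM('a))" by (simp add: power_mult)
    finally have "inverse ((1 + norm x) ^ (2 * DIM('a))) \<le> inverse (\<Prod>b\<in>Basis. 1 + (x \<bullet> b)\<^sup>2)"
      by (intro le_imp_inverse_le prod_pos) (auto intro: add_pos_nonneg)
    then show ?thesis by (simp add: prod_inversef[unfolded o_def, symmetric])
  qed
  note decay_le = this
  have "norm (inverse ((1 + norm x) ^ (2 * DIM('a)))) \<le> norm (\<Prod>b\<in>Basis. inverse (1 + (x \<bullet> b)\<^sup>2))" for x :: 'a
  proof -
    have "norm (inverse ((1 + norm x) ^ (2 * DIM('a)))) = inverse ((1 + norm x) ^ (2 * DIM('a)))" by simp
    also have "\<dots> \<le> (\<Prod>b\<in>Basis. inverse (1 + (x \<bullet> b)\<^sup>2))" by (rule decay_le)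
    also have "\<dots> \<le> norm (\<Prod>b\<in>Basis. inverse (1 + (x \<bullet> b)\<^sup>2))" by simp
    finally show ?thesis .
  qed
  then show "AE x in lborel. norm (inverse ((1 + norm (x :: 'a)) ^ (2 * DIM('a))))
      \<le> norm (\<Prod>b\<in>Basis. inverse (1 + (x \<bullet> b)\<^sup>2))"
    by (intro AE_I2)
qed measurable

text \<open>The second conclusion turns a weighted sup bound into an L1 bound whose constant depends
  on the dimension alone; the continuity estimates for distributions rest on this.\<close>

lemma integrable_of_decay:
  fixes F :: "'a::euclidean_space \<Rightarrow> 'b::{banach, second_countable_topology}"
  assumes "F \<in> borel_measurable borel"
    and "\<And>x. (1 + norm x) ^ (2 * DIM('a)) * norm (F x) \<le> C"
  shows "integrable lborel F"
    and "(LINT x|lborel. norm (F x)) \<le> C * (LINT x::'a|lborel. inverse ((1 + norm x) ^ (2 * DIM('a))))"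
proof -
  have *: "norm (F x) \<le> C * inverse ((1 + norm x) ^ (2 * DIM('a)))" for x
  proof -
    have "0 < (1 + norm x) ^ (2 * DIM('a))"
      by (smt (verit) norm_ge_zero zero_less_power)
    then show ?thesis using assms(2)[of x] by (simp add: field_simps)
  qed
  have i: "integrable lborel (\<lambda>x::'a. C * inverse ((1 + norm x) ^ (2 * DIM('a))))"
    by (intro integrable_mult_right integrable_decay)
  show F: "integrable lborel F"
    by (rule Bochner_Integration.integrable_bound[OF i])
      (use assms(1) * in \<open>auto intro!: AE_I2 order_trans[OF * abs_ge_self]\<close>)
  have "(LINT x|lborel. norm (F x)) \<le> (LINT x::'a|lborel. C * inverse ((1 + norm x) ^ (2 * DIM('a))))"
    by (intro integral_mono integrable_norm F i *)
  then show "(LINT x|lborel. norm (F x)) \<le> C * (LINT x::'a|lborel. inverse ((1 + norm x) ^ (2 * DIM('a))))"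
    by simp
qed

section \<open>Gaussian densities and their Fourier transforms\<close>

text \<open>The product form lets total mass and Fourier transform be read off from the
  one-dimensional standard normal distribution.\<close>

definition gauss :: "'a::euclidean_space \<Rightarrow> real" where
  "gauss x = (\<Prod>b\<in>Basis. std_normal_density (x \<bullet> b))"

lemma gauss_eq: "gauss (x::'a::euclidean_space) = (1 / sqrt (2 * pi)) ^ DIM('a) * exp (- (norm x)\<^sup>2 / 2)"
proof -
  have "(norm x)\<^sup>2 = (\<Sum>b\<in>Basis. (x \<bullet> b)\<^sup>2)"
    by (subst power2_norm_eq_inner, subst euclidean_inner) (simp add: power2_eq_square)
  then have "exp (- (norm x)\<^sup>2 / 2) = (\<Prod>b\<in>Basis. exp (- (x \<bullet> b)\<^sup>2 / 2))"
    by (simp add: exp_sum[symmetric] sum_negf sum_divide_distrib)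
  then show ?thesis
    unfolding gauss_def std_normal_density_def by (simp add: prod.distrib prod_dividef power_divide)
qed

lemma gauss_measurable [measurable]: "gauss \<in> borel_measurable borel"
  unfolding gauss_eq[abs_def] by measurable

lemma gauss_pos: "0 < gauss x" and gauss_minus [simp]: "gauss (- x) = gauss x"
  by (auto simp: gauss_eq)

lemma integrable_gauss: "integrable lborel (gauss :: 'a::euclidean_space \<Rightarrow> real)"
  unfolding gauss_def by (rule lborel_integrable_prod_Basis) simp

lemma integral_gauss: "(LINT x::'a::euclidean_space|lborel. gauss x) = 1"
  unfolding gauss_def by (subst lborel_integral_prod_Basis) auto

text \<open>Both the exponential and the density factor over the coordinates, which leaves a product
  of characteristic functions of the standard normal distribution.\<close>

lemma fourier_gauss:
  "(LINT x::'a::euclidean_space|lborel. iexp (x \<bullet> \<xi>) * complex_of_real (gauss x))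
     = complex_of_real (exp (- (norm \<xi>)\<^sup>2 / 2))"
proof -
  have 1: "(LINT t|lborel. iexp (t * s) * complex_of_real (std_normal_density t))
      = complex_of_real (exp (- s\<^sup>2 / 2))" for s
  proof -
    have "char std_normal_distribution s = complex_of_real (exp (- s\<^sup>2 / 2))"
      by (simp add: char_std_normal_distribution)
    also have "char std_normal_distribution s =
        (LINT t|lborel. std_normal_density t *\<^sub>R iexp (s * t))"
      unfolding char_def by (subst integral_density) auto
    finally show ?thesis by (simp add: scaleR_conv_of_real mult.commute)
  qed
  have eq: "iexp (x \<bullet> \<xi>) * complex_of_real (gauss x)
      = (\<Prod>b\<in>Basis. iexp ((x \<bullet> b) * (\<xi> \<bullet> b)) * complex_of_real (std_normal_density (x \<bullet> b)))" for x :: 'a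
  proof -
    have "x \<bullet> \<xi> = (\<Sum>b\<in>Basis. (x \<bullet> b) * (\<xi> \<bullet> b))" by (rule euclidean_inner)
    then show ?thesis
      by (simp add: gauss_def prod.distrib exp_sum[symmetric] sum_distrib_left of_real_sum
            flip: of_real_mult of_real_prod)
  qed
  have int: "integrable lborel (\<lambda>t. iexp (t * s) * complex_of_real (std_normal_density t))" for s
    by (rule Bochner_Integration.integrable_bound[of _ "std_normal_density"])
       (auto simp: norm_mult)
  have "(norm \<xi>)\<^sup>2 = (\<Sum>b\<in>Basis. (\<xi> \<bullet> b)\<^sup>2)"
    by (subst power2_norm_eq_inner, subst euclidean_inner) (simp add: power2_eq_square)
  then have e: "exp (- (norm \<xi>)\<^sup>2 / 2) = (\<Prod>b\<in>Basis. exp (- (\<xi> \<bullet> b)\<^sup>2 / 2))"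
    by (simp add: exp_sum[symmetric] sum_negf sum_divide_distrib)
  show ?thesis
    unfolding eq by (subst lborel_integral_prod_Basis[OF int]) (simp only: 1 e of_real_prod)
qed

section \<open>Fourier inversion\<close>

lemma lborel_integrable_pair_mult:
  fixes f :: "'a::euclidean_space \<Rightarrow> complex" and g :: "'b::euclidean_space \<Rightarrow> complex"
  assumes f: "integrable lborel f" and g: "integrable lborel g"
  shows "integrable (lborel \<Otimes>\<^sub>M lborel) (\<lambda>(x, y). f x * g y)"
proof (rule lborel_pair.Fubini_integrable)
  have [measurable]: "f \<in> borel_measurable borel" "g \<in> borel_measurable borel"
    using borel_measurable_integrable f g by auto
  show "(\<lambda>(x, y). f x * g y) \<in> borel_measurable (lborel \<Otimes>\<^sub>M lborel)"
    by measurable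
  show "integrable lborel (\<lambda>x. LINT y|lborel. norm (case (x, y) of (x, y) \<Rightarrow> f x * g y))"
    using f by (simp add: norm_mult)
  show "AE x in lborel. integrable lborel (\<lambda>y. case (x, y) of (x, y) \<Rightarrow> f x * g y)"
    using g by simp
qed

text \<open>The form of Fubini suited to oscillating kernels: the modulus of the integrand is
  dominated by a multiple of norm (f x) * norm (g y), which is integrable on the product.\<close>

lemma lborel_Fubini_bounded:
  fixes f :: "'a::euclidean_space \<Rightarrow> complex" and g :: "'b::euclidean_space \<Rightarrow> complex"
    and K :: "'a \<Rightarrow> 'b \<Rightarrow> complex"
  assumes f: "integrable lborel f" and g: "integrable lborel g"
    and K[measurable]: "case_prod K \<in> borel_measurable (borel \<Otimes>\<^sub>M borel)"
    and b: "\<And>x y. norm (K x y) \<le> B"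
  shows "(LINT x|lborel. LINT y|lborel. K x y * f x * g y) = (LINT y|lborel. LINT x|lborel. K x y * f x * g y)"
proof -
  have [measurable]: "f \<in> borel_measurable borel" "g \<in> borel_measurable borel"
    using borel_measurable_integrable f g by auto
  have "integrable (lborel \<Otimes>\<^sub>M lborel) (\<lambda>z. complex_of_real B * (case z of (x, y) \<Rightarrow> f x * g y))"
    by (intro integrable_mult_right lborel_integrable_pair_mult f g)
  then have "integrable (lborel \<Otimes>\<^sub>M lborel) (case_prod (\<lambda>x y. K x y * f x * g y))"
  proof (rule Bochner_Integration.integrable_bound)
    have "norm (K x y * f x * g y) \<le> \<bar>B\<bar> * (norm (f x) * norm (g y))" for x y
      unfolding norm_mult mult.assoc using b[of x y] by (intro mult_right_mono) auto
    then show "AE z in lborel \<Otimes>\<^sub>M lborel. norm (case z of (x, y) \<Rightarrow> K x y * f x * g y)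
        \<le> norm (complex_of_real B * (case z of (x, y) \<Rightarrow> f x * g y))"
      by (intro AE_I2) (auto simp: norm_mult)
  qed measurable
  from lborel_pair.Fubini_integral[OF this] show ?thesis by simp
qed

text \<open>Since 1 + t \<le> exp t, the logarithm of the left side is at most N t - c t^2, and
  completing the square bounds this by its maximum, attained at t = N / (2 c).\<close>

lemma poly_exp_bounded:
  assumes c: "(c::real) > 0" and t: "t \<ge> 0"
  shows "(1 + t) ^ N * exp (- c * t\<^sup>2) \<le> exp ((real N)\<^sup>2 / (4 * c))"
proof -
  have "(1 + t) ^ N \<le> exp t ^ N"
    using t by (intro power_mono exp_ge_add_one_self) auto
  also have "\<dots> = exp (real N * t)" by (simp add: exp_of_nat_mult)
  finally have "(1 + t) ^ N * exp (- c * t\<^sup>2) \<le> exp (real N * t) * exp (- c * t\<^sup>2)"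
    by (intro mult_right_mono) auto
  also have "\<dots> = exp (real N * t - c * t\<^sup>2)" by (simp add: exp_add[symmetric])
  also have "\<dots> \<le> exp ((real N)\<^sup>2 / (4 * c))"
  proof -
    have "0 \<le> (2 * c * t - real N)\<^sup>2" by simp
    then have "real N * t - c * t\<^sup>2 \<le> (real N)\<^sup>2 / (4 * c)"
      using c by (simp add: field_simps power2_eq_square)
    then show ?thesis by simp
  qed
  finally show ?thesis .
qed

lemma integrable_poly_gauss:
  "integrable lborel (\<lambda>z::'a::euclidean_space. (1 + norm z) ^ N * gauss z)"
proof (rule integrable_of_decay(1))
  let ?M = "2 * DIM('a) + N"
  fix z :: 'a
  have "(1 + norm z) ^ (2 * DIM('a)) * norm ((1 + norm z) ^ N * gauss z) =
      (1 / sqrt (2 * pi)) ^ DIM('a) * ((1 + norm z) ^ ?M * exp (- (1/2) * (norm z)\<^sup>2))"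
    by (simp add: gauss_eq power_add abs_mult)
  also have "\<dots> \<le> (1 / sqrt (2 * pi)) ^ DIM('a) * exp ((real ?M)\<^sup>2 / (4 * (1/2)))"
    by (intro mult_left_mono poly_exp_bounded) auto
  finally show "(1 + norm z) ^ (2 * DIM('a)) * norm ((1 + norm z) ^ N * gauss z) \<le>
    (1 / sqrt (2 * pi)) ^ DIM('a) * exp ((real ?M)\<^sup>2 / (4 * (1/2)))" .
qed measurable

text \<open>Submultiplicativity of the weight: a translation costs only a constant factor.\<close>

lemma one_add_norm_add_le: "1 + norm (x + y) \<le> (1 + norm x) * (1 + norm y)"
  for x y :: "'a::real_normed_vector"
proof -
  have "1 + norm (x + y) \<le> 1 + norm x + norm y + norm x * norm y"
    using norm_triangle_ineq[of x y] by (smt (verit) mult_nonneg_nonneg norm_ge_zero)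
  then show ?thesis by (simp add: algebra_simps)
qed

text \<open>The scale sits in the argument of g, so the Gaussian stays fixed and can serve in the
  dominating function. As the scale is at most 1, the growth of g at the shifted point is bounded by
  that of (1 + norm y) * (1 + norm z).\<close>

lemma gauss_approximate_identity:
  fixes g :: "'a::euclidean_space \<Rightarrow> complex"
  assumes [measurable]: "g \<in> borel_measurable borel"
    and g: "poly_bounded g" "isCont g y"
  shows "(\<lambda>n. LINT z|lborel. g (y + (1 / real (Suc n)) *\<^sub>R z) * complex_of_real (gauss z)) \<longlonglongrightarrow> g y"
proof -
  obtain C N where C: "\<And>x. norm (g x) \<le> C * (1 + norm x) ^ N"
    using g(1) unfolding poly_bounded_def by blast
  have C0: "0 \<le> C" using C[of 0] norm_ge_zero[of "g 0"] by (auto simp del: norm_ge_zero)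
  let ?w = "\<lambda>z. C * (1 + norm y) ^ N * ((1 + norm z) ^ N * gauss z)"
  have lim0: "(\<lambda>n. 1 / real (Suc n)) \<longlonglongrightarrow> 0" using LIMSEQ_inverse_real_of_nat by (simp add: inverse_eq_divide)
  have "(\<lambda>n. LINT z|lborel. g (y + (1 / real (Suc n)) *\<^sub>R z) * complex_of_real (gauss z))
      \<longlonglongrightarrow> (LINT z::'a|lborel. g y * complex_of_real (gauss z))"
  proof (rule integral_dominated_convergence[where w="?w"])
    show "integrable lborel ?w" by (intro integrable_mult_right integrable_poly_gauss)
    show "AE z in lborel. (\<lambda>n. g (y + (1 / real (Suc n)) *\<^sub>R z) * complex_of_real (gauss z))
        \<longlonglongrightarrow> g y * complex_of_real (gauss z)"
    proof (intro AE_I2 tendsto_mult tendsto_const isCont_tendsto_compose[OF g(2)])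
      fix z :: 'a
      have "(\<lambda>n. y + (1 / real (Suc n)) *\<^sub>R z) \<longlonglongrightarrow> y + 0 *\<^sub>R z"
        by (intro tendsto_intros lim0)
      then show "(\<lambda>n. y + (1 / real (Suc n)) *\<^sub>R z) \<longlonglongrightarrow> y" by simp
    qed
    fix n
    show "AE z in lborel. norm (g (y + (1 / real (Suc n)) *\<^sub>R z) * complex_of_real (gauss z)) \<le> ?w z"
    proof (rule AE_I2)
      fix z :: 'a
      have "norm (g (y + (1 / real (Suc n)) *\<^sub>R z)) \<le> C * (1 + norm (y + (1 / real (Suc n)) *\<^sub>R z)) ^ N"
        by (rule C)
      also have "\<dots> \<le> C * ((1 + norm y) * (1 + norm z)) ^ N"
      proof (intro mult_left_mono power_mono C0)
        have "norm ((1 / real (Suc n)) *\<^sub>R z) \<le> norm z"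
          by (simp add: divide_le_eq mult_le_cancel_left1)
        then have "(1 + norm y) * (1 + norm ((1 / real (Suc n)) *\<^sub>R z)) \<le> (1 + norm y) * (1 + norm z)"
          by (intro mult_left_mono) auto
        then show "1 + norm (y + (1 / real (Suc n)) *\<^sub>R z) \<le> (1 + norm y) * (1 + norm z)"
          using one_add_norm_add_le order_trans by blast
      qed auto
      finally have "norm (g (y + (1 / real (Suc n)) *\<^sub>R z)) * gauss z
          \<le> C * ((1 + norm y) * (1 + norm z)) ^ N * gauss z"
        using gauss_pos[of z] by (intro mult_right_mono) auto
      then show "norm (g (y + (1 / real (Suc n)) *\<^sub>R z) * complex_of_real (gauss z)) \<le> ?w z"
        using gauss_pos[of z] by (simp add: norm_mult power_mult_distrib mult_ac)
    qed
  qed measurable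
  also have "(LINT z::'a|lborel. g y * complex_of_real (gauss z)) = g y"
    by (simp add: integral_gauss)
  finally show ?thesis .
qed

text \<open>Computes the kernel that results from a Gaussian cut-off on the frequency side: up to (2
  \<pi>) ^ DIM, a Gaussian of width e and total mass 1.\<close>

lemma fourier_gauss_dilated:
  fixes v :: "'a::euclidean_space"
  assumes e: "e > 0"
  shows "(LINT \<xi>|lborel. iexp (v \<bullet> \<xi>) * complex_of_real (exp (- (norm (e *\<^sub>R \<xi>))\<^sup>2 / 2)))
    = complex_of_real ((2 * pi) ^ DIM('a) / e ^ DIM('a) * gauss ((1 / e) *\<^sub>R v))"
proof -
  let ?D = "DIM('a)"
  have sq: "sqrt (2 * pi) ^ ?D * sqrt (2 * pi) ^ ?D = (2 * pi) ^ ?D"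
  proof -
    have "sqrt (2 * pi) * sqrt (2 * pi) = 2 * pi" by (simp only: real_sqrt_mult_self) simp
    then show ?thesis by (metis power_mult_distrib)
  qed
  have g: "exp (- (norm z)\<^sup>2 / 2) = sqrt (2 * pi) ^ ?D * gauss z" for z :: 'a
    by (simp add: gauss_eq power_divide)
  have "(LINT \<xi>|lborel. iexp (v \<bullet> \<xi>) * complex_of_real (exp (- (norm (e *\<^sub>R \<xi>))\<^sup>2 / 2)))
    = \<bar>1 / e\<bar> ^ ?D *\<^sub>R (LINT \<xi>|lborel. iexp (v \<bullet> (0 + (1 / e) *\<^sub>R \<xi>)) *
        complex_of_real (exp (- (norm (e *\<^sub>R (0 + (1 / e) *\<^sub>R \<xi>)))\<^sup>2 / 2)))"
    using e by (intro lborel_affine_integral) auto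
  also have "\<dots> = complex_of_real (1 / e ^ ?D) * (LINT \<xi>|lborel. iexp (\<xi> \<bullet> ((1 / e) *\<^sub>R v)) *
        complex_of_real (sqrt (2 * pi) ^ ?D * gauss \<xi>))"
    unfolding g[symmetric] using e by (simp add: inner_commute[of v] scaleR_conv_of_real power_divide)
  also have "(LINT \<xi>|lborel. iexp (\<xi> \<bullet> ((1 / e) *\<^sub>R v)) *
        complex_of_real (sqrt (2 * pi) ^ ?D * gauss \<xi>))
      = complex_of_real (sqrt (2 * pi) ^ ?D) * (LINT \<xi>|lborel. iexp (\<xi> \<bullet> ((1 / e) *\<^sub>R v)) *
        complex_of_real (gauss \<xi>))"
    by (subst integral_mult_right_zero[symmetric], intro Bochner_Integration.integral_cong) auto
  also have "(LINT \<xi>|lborel. iexp (\<xi> \<bullet> ((1 / e) *\<^sub>R v)) * complex_of_real (gauss \<xi>))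
      = complex_of_real (sqrt (2 * pi) ^ ?D * gauss ((1 / e) *\<^sub>R v))"
    unfolding fourier_gauss g ..
  finally show ?thesis
    unfolding of_real_mult[symmetric] of_real_eq_iff sq[symmetric] by (simp only: divide_inverse mult_ac mult_1_left)
qed

lemma fourier_continuous:
  assumes f: "integrable lborel f"
  shows "continuous_on UNIV (fourier f)"
proof -
  have [measurable]: "f \<in> borel_measurable borel"
    using borel_measurable_integrable f by auto
  have "isCont (fourier f) \<xi>" for \<xi>
    unfolding continuous_at_sequentially o_def fourier_def
  proof (intro allI impI)
    fix u assume u: "u \<longlonglongrightarrow> \<xi>"
    show "(\<lambda>n. LINT x|lborel. exp (- \<i> * complex_of_real (x \<bullet> u n)) * f x)
       \<longlonglongrightarrow> (LINT x|lborel. exp (- \<i> * complex_of_real (x \<bullet> \<xi>)) * f x)"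
    proof (rule integral_dominated_convergence[where w="\<lambda>x. norm (f x)"])
      show "integrable lborel (\<lambda>x. norm (f x))" using f by simp
    qed (use u in \<open>auto simp: norm_mult intro!: tendsto_intros AE_I2\<close>)
  qed
  then show ?thesis by (simp add: continuous_at_imp_continuous_on)
qed

lemma fourier_measurable:
  assumes "integrable lborel f"
  shows "fourier f \<in> borel_measurable borel"
  by (rule borel_measurable_continuous_onI[OF fourier_continuous[OF assms]])

lemma norm_fourier_le: "norm (fourier f \<xi>) \<le> (LINT x|lborel. norm (f x))"
proof -
  have "norm (fourier f \<xi>) \<le> (LINT x|lborel. norm (exp (- \<i> * complex_of_real (x \<bullet> \<xi>)) * f x))"
    unfolding fourier_def by (rule integral_norm_bound)
  then show ?thesis by (simp add: norm_mult)
qed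

lemma norm_inv_fourier_factor_le: "norm (complex_of_real (1 / (2 * pi) ^ n)) \<le> 1"
proof -
  have "1 \<le> (2 * pi) ^ n" using pi_gt3 by (intro one_le_power) simp
  then have "1 / (2 * pi) ^ n \<le> 1" by (subst divide_le_eq_1_pos) auto
  then show ?thesis unfolding norm_of_real by (subst abs_of_nonneg) auto
qed

lemma inv_fourier_eq: "inv_fourier g x = complex_of_real (1 / (2 * pi) ^ DIM('a)) * fourier g (- x)"
  for x :: "'a::euclidean_space"
  unfolding inv_fourier_def fourier_def by (simp add: inner_commute)

text \<open>Without a cut-off the double integral behind the formula does not converge absolutely.
  With the factor \<open>K n\<close> it does; removing the cut-off yields the inversion integral,
  while exchanging the integrals first yields Gaussian averages of f around x, which converge at a
  point of continuity.\<close>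

theorem fourier_inversion:
  fixes f :: "'a::euclidean_space \<Rightarrow> complex"
  assumes f: "integrable lborel f" and c: "isCont f x" and p: "poly_bounded f"
    and F: "integrable lborel (fourier f)"
  shows "inv_fourier (fourier f) x = f x"
proof -
  let ?D = "DIM('a)"
  have [measurable]: "f \<in> borel_measurable borel" "fourier f \<in> borel_measurable borel"
    using borel_measurable_integrable f F by auto
  define e where "e n = 1 / real (Suc n)" for n
  have e: "e n > 0" for n by (simp add: e_def)
  have e0: "e \<longlonglongrightarrow> 0"
    unfolding e_def[abs_def] using LIMSEQ_inverse_real_of_nat by (simp add: inverse_eq_divide)
  define K where "K n \<xi> = complex_of_real (exp (- (norm (e n *\<^sub>R \<xi>))\<^sup>2 / 2))" for n and \<xi> :: 'a
  have K_int: "integrable lborel (K n)" for n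
  proof -
    have "integrable lborel (\<lambda>\<xi>. complex_of_real (sqrt (2 * pi) ^ ?D * gauss (0 + e n *\<^sub>R \<xi> :: 'a)))"
      using lborel_affine_integrable[OF _ integrable_gauss, of "e n" 0] e[of n] by auto
    then show ?thesis by (simp add: K_def[abs_def] gauss_eq power_divide)
  qed
  have K_m[measurable]: "K n \<in> borel_measurable borel" for n
    unfolding K_def[abs_def] by measurable
  have nK: "norm (K n \<xi>) \<le> 1" for n \<xi> by (simp add: K_def)
  define A where "A n = (LINT \<xi>|lborel. K n \<xi> * (iexp (x \<bullet> \<xi>) * fourier f \<xi>))" for n
  have 1: "A \<longlonglongrightarrow> (LINT \<xi>|lborel. iexp (x \<bullet> \<xi>) * fourier f \<xi>)"
    unfolding A_def
  proof (rule integral_dominated_convergence[where w="\<lambda>\<xi>. norm (fourier f \<xi>)"])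
    show "integrable lborel (\<lambda>\<xi>. norm (fourier f \<xi>))" using F by simp
    show "AE \<xi> in lborel. (\<lambda>n. K n \<xi> * (iexp (x \<bullet> \<xi>) * fourier f \<xi>))
       \<longlonglongrightarrow> iexp (x \<bullet> \<xi>) * fourier f \<xi>"
    proof (rule AE_I2)
      fix \<xi> :: 'a
      have "(\<lambda>n. K n \<xi>) \<longlonglongrightarrow> complex_of_real (exp (- (norm (0 *\<^sub>R \<xi>))\<^sup>2 / 2))"
        unfolding K_def by (intro tendsto_intros e0) auto
      then have "(\<lambda>n. K n \<xi> * (iexp (x \<bullet> \<xi>) * fourier f \<xi>))
          \<longlonglongrightarrow> 1 * (iexp (x \<bullet> \<xi>) * fourier f \<xi>)"
        by (intro tendsto_intros) simp
      then show "(\<lambda>n. K n \<xi> * (iexp (x \<bullet> \<xi>) * fourier f \<xi>))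
       \<longlonglongrightarrow> iexp (x \<bullet> \<xi>) * fourier f \<xi>" by simp
    qed
    show "AE \<xi> in lborel. norm (K n \<xi> * (iexp (x \<bullet> \<xi>) * fourier f \<xi>)) \<le> norm (fourier f \<xi>)" for n
      by (auto simp: norm_mult nK intro!: mult_left_le_one_le)
  qed measurable
  \<comment> \<open>Fubini moves the cut-off onto f as a narrow Gaussian centred at x; the
    substitution y = x + e z then undoes the dilation, and the powers of e cancel.\<close>
  have 2: "A n = complex_of_real ((2 * pi) ^ ?D) * (LINT z|lborel. f (x + (1 / real (Suc n)) *\<^sub>R z) * complex_of_real (gauss z))" for n
  proof -
    have "A n = (LINT \<xi>|lborel. LINT y|lborel. iexp ((x - y) \<bullet> \<xi>) * K n \<xi> * f y)"
      unfolding A_def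
    proof (rule Bochner_Integration.integral_cong[OF refl])
      fix \<xi> :: 'a
      have "K n \<xi> * (iexp (x \<bullet> \<xi>) * fourier f \<xi>)
          = (LINT y|lborel. (K n \<xi> * iexp (x \<bullet> \<xi>)) * (exp (- \<i> * complex_of_real (y \<bullet> \<xi>)) * f y))"
        by (simp only: fourier_def integral_mult_right_zero mult.assoc)
      also have "\<dots> = (LINT y|lborel. iexp ((x - y) \<bullet> \<xi>) * K n \<xi> * f y)"
      proof (rule Bochner_Integration.integral_cong[OF refl])
        fix y
        have "iexp ((x - y) \<bullet> \<xi>) =
            iexp (x \<bullet> \<xi>) * exp (- \<i> * complex_of_real (y \<bullet> \<xi>))"
          by (simp add: inner_diff_left right_diff_distrib flip: exp_add)
        then show "(K n \<xi> * iexp (x \<bullet> \<xi>)) * (exp (- \<i> * complex_of_real (y \<bullet> \<xi>)) * f y)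
            = iexp ((x - y) \<bullet> \<xi>) * K n \<xi> * f y"
          by (simp only: mult_ac)
      qed
      finally show "K n \<xi> * (iexp (x \<bullet> \<xi>) * fourier f \<xi>)
          = (LINT y|lborel. iexp ((x - y) \<bullet> \<xi>) * K n \<xi> * f y)" .
    qed
    also have "\<dots> = (LINT y|lborel. LINT \<xi>|lborel. iexp ((x - y) \<bullet> \<xi>) * K n \<xi> * f y)"
    proof (rule lborel_Fubini_bounded[where B=1, OF K_int f])
      show "(\<lambda>(\<xi>, y). iexp ((x - y) \<bullet> \<xi>)) \<in> borel_measurable (borel \<Otimes>\<^sub>M borel)"
        by measurable
    qed simp
    also have "\<dots> = (LINT y|lborel. complex_of_real ((2 * pi) ^ ?D / e n ^ ?D * gauss ((1 / e n) *\<^sub>R (x - y))) * f y)"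
      by (simp only: K_def integral_mult_left_zero fourier_gauss_dilated[OF e])
    also have "\<dots> = \<bar>e n\<bar> ^ ?D *\<^sub>R (LINT z|lborel. complex_of_real ((2 * pi) ^ ?D / e n ^ ?D *
         gauss ((1 / e n) *\<^sub>R (x - (x + e n *\<^sub>R z)))) * f (x + e n *\<^sub>R z))"
      using e[of n] by (intro lborel_affine_integral) auto
    also have "\<dots> = complex_of_real (e n ^ ?D) * (LINT z|lborel. complex_of_real ((2 * pi) ^ ?D / e n ^ ?D) *
         (f (x + e n *\<^sub>R z) * complex_of_real (gauss z)))"
      using e[of n] by (simp add: scaleR_conv_of_real mult_ac)
    also have "\<dots> = complex_of_real ((2 * pi) ^ ?D) * (LINT z|lborel. f (x + e n *\<^sub>R z) * complex_of_real (gauss z))"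
      using e[of n] by (subst integral_mult_right_zero) simp
    finally show ?thesis unfolding e_def .
  qed
  have "A \<longlonglongrightarrow> complex_of_real ((2 * pi) ^ ?D) * f x"
    unfolding 2 using p c by (intro tendsto_intros gauss_approximate_identity) auto
  from LIMSEQ_unique[OF 1 this] show ?thesis
    unfolding inv_fourier_def by simp
qed

section \<open>Schwartz functions and decay of their Fourier transforms\<close>

lemma schwartz_differentiable:
  assumes "\<phi> \<in> schwartz" "set bs \<subseteq> Basis"
  shows "iter_partial bs \<phi> differentiable (at x)"
  using assms by (auto simp: schwartz_def smooth_def)

lemma schwartz_partial_continuous:
  assumes "\<phi> \<in> schwartz" "set bs \<subseteq> Basis"
  shows "continuous_on UNIV (iter_partial bs \<phi>)"
  using schwartz_differentiable[OF assms]
  by (simp add: continuous_at_imp_continuous_on differentiable_imp_continuous_within)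

lemma schwartz_partial_measurable:
  assumes "\<phi> \<in> schwartz" "set bs \<subseteq> Basis"
  shows "iter_partial bs \<phi> \<in> borel_measurable borel"
  by (rule borel_measurable_continuous_onI[OF schwartz_partial_continuous[OF assms]])

lemma schwartz_measurable: "\<phi> \<in> schwartz \<Longrightarrow> \<phi> \<in> borel_measurable borel"
  using schwartz_partial_measurable[of \<phi> "[]"] by simp

lemma schwartz_isCont: "\<phi> \<in> schwartz \<Longrightarrow> isCont \<phi> x"
  using schwartz_partial_continuous[of \<phi> "[]"] by (simp add: continuous_on_eq_continuous_at)

lemma schwartz_bdd_above:
  assumes "\<phi> \<in> schwartz" "set bs \<subseteq> Basis"
  shows "bdd_above (range (\<lambda>x. (1 + norm x) ^ N * norm (iter_partial bs \<phi> x)))"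
proof -
  have "bounded (range (\<lambda>x. (1 + norm x) ^ N *\<^sub>R iter_partial bs \<phi> x))"
    using assms by (auto simp: schwartz_def)
  then obtain B where "\<And>x. norm ((1 + norm x) ^ N *\<^sub>R iter_partial bs \<phi> x) \<le> B"
    unfolding bounded_iff by auto
  then show ?thesis
    by (intro bdd_aboveI[of _ B]) auto
qed

text \<open>The index N limits both the order of differentiation and the exponent of the weight. One
  supremum is at most the whole sum because the other suprema are nonnegative, as their value at 0
  shows.\<close>

lemma schwartz_norm_bound:
  fixes \<phi> :: "'a::euclidean_space \<Rightarrow> complex"
  assumes \<phi>: "\<phi> \<in> schwartz" and bs: "set bs \<subseteq> Basis" and len: "length bs \<le> N" and M: "M \<le> N"
  shows "(1 + norm x) ^ M * norm (iter_partial bs \<phi> x) \<le> schwartz_norm N \<phi>"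
proof -
  let ?S = "\<lambda>bs. SUP x. (1 + norm x) ^ N * norm (iter_partial bs \<phi> x)"
  have "(1 + norm x) ^ M * norm (iter_partial bs \<phi> x) \<le> (1 + norm x) ^ N * norm (iter_partial bs \<phi> x)"
    by (intro mult_right_mono power_increasing M) auto
  also have "\<dots> \<le> ?S bs"
    by (rule cSUP_upper[OF UNIV_I schwartz_bdd_above[OF \<phi> bs]])
  also have "\<dots> \<le> schwartz_norm N \<phi>"
    unfolding schwartz_norm_def
  proof (rule member_le_sum)
    show "finite {bs. set bs \<subseteq> (Basis :: 'a set) \<and> length bs \<le> N}"
      by (rule finite_lists_length_le) simp
    fix cs assume cs: "cs \<in> {bs. set bs \<subseteq> (Basis :: 'a set) \<and> length bs \<le> N} - {bs}"
    have "0 \<le> (1 + norm (0::'a)) ^ N * norm (iter_partial cs \<phi> 0)" by simp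
    also have "\<dots> \<le> ?S cs"
      using cs by (intro cSUP_upper[OF UNIV_I schwartz_bdd_above[OF \<phi>]]) auto
    finally show "0 \<le> ?S cs" .
  qed (use bs len in auto)
  finally show ?thesis .
qed

lemma schwartz_norm_nonneg:
  assumes "\<phi> \<in> schwartz"
  shows "0 \<le> schwartz_norm N \<phi>"
  using order_trans[OF norm_ge_zero schwartz_norm_bound[OF assms, of "[]" N 0 0, simplified]] .

lemma schwartz_integrable_weight:
  fixes \<phi> :: "'a::euclidean_space \<Rightarrow> complex"
  assumes \<phi>: "\<phi> \<in> schwartz" and bs: "set bs \<subseteq> Basis"
  shows "integrable lborel (\<lambda>x. (1 + norm x) ^ M * norm (iter_partial bs \<phi> x))"
proof (rule integrable_of_decay(1))
  show "(\<lambda>x. (1 + norm x) ^ M * norm (iter_partial bs \<phi> x)) \<in> borel_measurable borel"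
    using schwartz_partial_measurable[OF \<phi> bs] by measurable
  show "(1 + norm x) ^ (2 * DIM('a)) * norm ((1 + norm x) ^ M * norm (iter_partial bs \<phi> x))
      \<le> schwartz_norm (2 * DIM('a) + M + length bs) \<phi>" for x
    using schwartz_norm_bound[OF \<phi> bs, of "2 * DIM('a) + M + length bs" "2 * DIM('a) + M" x]
    by (simp add: power_add abs_mult mult.assoc)
qed

lemma schwartz_integrable:
  assumes "\<phi> \<in> schwartz" "set bs \<subseteq> Basis"
  shows "integrable lborel (iter_partial bs \<phi>)"
proof (subst integrable_norm_iff[symmetric])
  show "iter_partial bs \<phi> \<in> borel_measurable lborel"
    using schwartz_partial_measurable[OF assms] by simp
  show "integrable lborel (\<lambda>x. norm (iter_partial bs \<phi> x))"
    using schwartz_integrable_weight[OF assms, of 0] by simp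
qed

definition decay_const :: "'a::euclidean_space itself \<Rightarrow> real" where
  "decay_const _ = (LINT x::'a|lborel. inverse ((1 + norm x) ^ (2 * DIM('a))))"

lemma decay_const_nonneg: "0 \<le> decay_const a"
  unfolding decay_const_def by (intro Bochner_Integration.integral_nonneg) auto

text \<open>Of the available powers of the weight, \<open>2 * DIM('a)\<close> pay for integrability
  and M remain.\<close>

lemma schwartz_L1_bound:
  fixes \<phi> :: "'a::euclidean_space \<Rightarrow> complex"
  assumes \<phi>: "\<phi> \<in> schwartz" and bs: "set bs \<subseteq> Basis" and "2 * DIM('a) + M \<le> N" "length bs \<le> N"
  shows "(LINT x|lborel. (1 + norm x) ^ M * norm (iter_partial bs \<phi> x)) \<le> schwartz_norm N \<phi> * decay_const TYPE('a)"
proof -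
  have "(LINT x|lborel. norm ((1 + norm x) ^ M *\<^sub>R iter_partial bs \<phi> x)) \<le> schwartz_norm N \<phi> * decay_const TYPE('a)"
    unfolding decay_const_def
  proof (rule integrable_of_decay(2))
    show "(\<lambda>x. (1 + norm x) ^ M *\<^sub>R iter_partial bs \<phi> x) \<in> borel_measurable borel"
      using schwartz_partial_measurable[OF \<phi> bs] by measurable
    show "(1 + norm x) ^ (2 * DIM('a)) * norm ((1 + norm x) ^ M *\<^sub>R iter_partial bs \<phi> x) \<le> schwartz_norm N \<phi>" for x
      using schwartz_norm_bound[OF \<phi> bs assms(4,3), of x]
      by (simp add: power_add abs_mult mult.assoc)
  qed
  then show ?thesis by simp
qed

section \<open>Lipschitz continuity and decay of Fourier transforms\<close>

text \<open>A chord is no longer than its arc. The estimate serves transforms, difference quotients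
  under the integral, and points of the circle alike.\<close>

lemma norm_iexp_diff_le: "norm (exp (\<i> * complex_of_real a) - exp (\<i> * complex_of_real b)) \<le> \<bar>a - b\<bar>"
proof -
  have "exp (\<i> * complex_of_real a) - exp (\<i> * complex_of_real b)
      = exp (\<i> * complex_of_real b) * (iexp (a - b) - 1)"
    by (simp add: algebra_simps flip: exp_add)
  then have "norm (exp (\<i> * complex_of_real a) - exp (\<i> * complex_of_real b))
      = norm (iexp (a - b) - 1)"
    by (simp add: norm_mult)
  also have "\<dots> \<le> \<bar>a - b\<bar>"
    using iexp_approx1[of "a - b" 0] by simp
  finally show ?thesis .
qed

text \<open>The phases differ by at most norm x * norm (\<xi> - \<eta>), so a first moment of f
  takes the place of a derivative of its transform.\<close>

lemma fourier_Lipschitz: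
  fixes f :: "'a::euclidean_space \<Rightarrow> complex"
  assumes [measurable]: "f \<in> borel_measurable borel"
    and f: "integrable lborel f" "integrable lborel (\<lambda>x. norm x * norm (f x))"
  shows "norm (fourier f \<xi> - fourier f \<eta>) \<le> (LINT x|lborel. norm x * norm (f x)) * norm (\<xi> - \<eta>)"
proof -
  let ?e = "\<lambda>\<xi> x. exp (- \<i> * complex_of_real (x \<bullet> \<xi>))"
  have i: "integrable lborel (\<lambda>x. ?e \<xi> x * f x)" for \<xi>
    by (rule Bochner_Integration.integrable_bound[OF f(1)]) (auto simp: norm_mult)
  have b: "norm ((?e \<xi> x - ?e \<eta> x) * f x) \<le> norm x * norm (f x) * norm (\<xi> - \<eta>)" for x
  proof -
    have "norm (?e \<xi> x - ?e \<eta> x) \<le> \<bar>- (x \<bullet> \<xi>) - (- (x \<bullet> \<eta>))\<bar>"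
      using norm_iexp_diff_le[of "- (x \<bullet> \<xi>)" "- (x \<bullet> \<eta>)"] by simp
    also have "\<dots> = \<bar>x \<bullet> (\<xi> - \<eta>)\<bar>" by (simp add: inner_diff_right)
    also have "\<dots> \<le> norm x * norm (\<xi> - \<eta>)" by (rule Cauchy_Schwarz_ineq2)
    finally have "norm (?e \<xi> x - ?e \<eta> x) \<le> norm x * norm (\<xi> - \<eta>)" .
    from mult_right_mono[OF this norm_ge_zero[of "f x"]] show ?thesis
      by (simp only: norm_mult mult_ac)
  qed
  have "norm (fourier f \<xi> - fourier f \<eta>) = norm (LINT x|lborel. (?e \<xi> x - ?e \<eta> x) * f x)"
    unfolding fourier_def by (subst Bochner_Integration.integral_diff[OF i i, symmetric]) (simp add: left_diff_distrib)
  also have "\<dots> \<le> (LINT x|lborel. norm x * norm (f x) * norm (\<xi> - \<eta>))"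
  proof (rule Bochner_Integration.integral_norm_bound_integral)
    show "integrable lborel (\<lambda>x. (?e \<xi> x - ?e \<eta> x) * f x)"
      using Bochner_Integration.integrable_diff[OF i[of \<xi>] i[of \<eta>]] by (simp add: left_diff_distrib)
    show "integrable lborel (\<lambda>x. norm x * norm (f x) * norm (\<xi> - \<eta>))"
      using f(2) by (intro integrable_mult_left)
  qed (rule b)
  finally show ?thesis by simp
qed

lemma has_vector_derivative_along:
  assumes "F differentiable (at (x + s *\<^sub>R b))"
  shows "((\<lambda>s. F (x + s *\<^sub>R b)) has_vector_derivative frechet_derivative F (at (x + s *\<^sub>R b)) b) (at s)"
proof -
  let ?F' = "frechet_derivative F (at (x + s *\<^sub>R b))"
  have d: "(F has_derivative ?F') (at (x + s *\<^sub>R b))"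
    using assms frechet_derivative_works by blast
  have "((\<lambda>s. x + s *\<^sub>R b) has_derivative (\<lambda>h. h *\<^sub>R b)) (at s)"
    by (auto intro!: derivative_eq_intros)
  from diff_chain_at[OF this d] show ?thesis
    using linear_frechet_derivative[OF assms]
    by (simp add: has_vector_derivative_def o_def linear_cmul)
qed

lemma has_vector_derivative_quotient:
  assumes "(f has_vector_derivative D) (at 0)"
  shows "((\<lambda>s. (1 / s) *\<^sub>R (f s - f 0)) \<longlongrightarrow> D) (at 0)"
proof (subst tendsto_dist_iff)
  have "((\<lambda>s. norm (f s - f 0 - (s - 0) *\<^sub>R D) / norm (s - 0)) \<longlongrightarrow> 0) (at 0)"
    using assms unfolding has_vector_derivative_def has_derivative_iff_norm by blast
  then show "((\<lambda>s. dist ((1 / s) *\<^sub>R (f s - f 0)) D) \<longlongrightarrow> 0) (at 0)"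
  proof (rule Lim_transform_eventually)
    have "norm (f s - f 0 - (s - 0) *\<^sub>R D) / norm (s - 0) = dist ((1 / s) *\<^sub>R (f s - f 0)) D" if "s \<noteq> 0" for s
    proof -
      have "(1 / s) *\<^sub>R (f s - f 0) - D = (1 / s) *\<^sub>R (f s - f 0 - s *\<^sub>R D)"
        using that by (simp add: algebra_simps)
      then show ?thesis by (simp add: dist_norm)
    qed
    then show "\<forall>\<^sub>F s in at 0. norm (f s - f 0 - (s - 0) *\<^sub>R D) / norm (s - 0) = dist ((1 / s) *\<^sub>R (f s - f 0)) D"
      by (auto simp: eventually_at_filter)
  qed
qed

text \<open>The difference quotient turns into multiplication by \<open>(exp (i t \<xi> \<bullet> b) - 1) / t\<close> by
  translation invariance, which replaces integration by parts.\<close>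

lemma fourier_frechet_derivative:
  fixes F :: "'a::euclidean_space \<Rightarrow> complex"
  assumes d: "\<And>x. F differentiable (at x)" and F: "integrable lborel F" and b: "norm b \<le> 1"
    and m[measurable]: "(\<lambda>x. frechet_derivative F (at x) b) \<in> borel_measurable borel"
    and B: "\<And>x. (1 + norm x) ^ (2 * DIM('a)) * norm (frechet_derivative F (at x) b) \<le> C"
  shows "fourier (\<lambda>x. frechet_derivative F (at x) b) \<xi> = \<i> * complex_of_real (\<xi> \<bullet> b) * fourier F \<xi>"
proof -
  let ?D = "2 * DIM('a)"
  let ?F' = "\<lambda>x. frechet_derivative F (at x) b"
  have [measurable]: "F \<in> borel_measurable borel" using borel_measurable_integrable[OF F] by simp
  define t where "t n = 1 / real (Suc n)" for n
  have t: "t n > 0" "t n \<le> 1" for n by (auto simp: t_def)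
  have t0: "t \<longlonglongrightarrow> 0"
    unfolding t_def[abs_def] using LIMSEQ_inverse_real_of_nat by (simp add: inverse_eq_divide)
  let ?e = "\<lambda>x. exp (- \<i> * complex_of_real (x \<bullet> \<xi>))"
  let ?Q = "\<lambda>n x. (1 / t n) *\<^sub>R (F (x + t n *\<^sub>R b) - F x)"
  have lim: "(\<lambda>n. LINT x|lborel. ?e x * ?Q n x) \<longlonglongrightarrow> (LINT x|lborel. ?e x * ?F' x)"
  proof (rule integral_dominated_convergence[where w="\<lambda>x. 2 ^ ?D * C * inverse ((1 + norm x) ^ ?D)"])
    show "integrable lborel (\<lambda>x::'a. 2 ^ ?D * C * inverse ((1 + norm x) ^ ?D))"
      by (intro integrable_mult_right integrable_decay)
    show "AE x in lborel. (\<lambda>n. ?e x * ?Q n x) \<longlonglongrightarrow> ?e x * ?F' x"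
    proof (intro AE_I2 tendsto_mult tendsto_const)
      fix x
      have "((\<lambda>s. F (x + s *\<^sub>R b)) has_vector_derivative ?F' x) (at 0)"
        using has_vector_derivative_along[of F x 0 b] d by simp
      then have "((\<lambda>s. (1 / s) *\<^sub>R (F (x + s *\<^sub>R b) - F x)) \<longlongrightarrow> ?F' x) (at 0)"
        using has_vector_derivative_quotient by fastforce
      moreover have "filterlim t (at 0) sequentially"
        using t0 t(1) by (intro filterlim_atI) (auto intro!: always_eventually simp: less_imp_neq[symmetric] t_def)
      ultimately show "(\<lambda>n. ?Q n x) \<longlonglongrightarrow> ?F' x"
        by (rule filterlim_compose)
    qed
    show "AE x in lborel. norm (?e x * ?Q n x) \<le> 2 ^ ?D * C * inverse ((1 + norm x) ^ ?D)" for n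
    proof (rule AE_I2)
      fix x :: 'a
      let ?B = "2 ^ ?D * C * inverse ((1 + norm x) ^ ?D)"
      \<comment> \<open>Within distance 1 of x the weight changes by a factor of at most 2. Hence
        the derivative along the whole segment has a bound in terms of x alone, independent of n, as
        domination requires.\<close>
      have F': "norm (?F' (x + s *\<^sub>R b)) \<le> ?B" if "s \<in> {0..t n}" for s
      proof -
        let ?y = "x + s *\<^sub>R b"
        have "norm (s *\<^sub>R b) \<le> 1" using that t[of n] b by (auto intro!: mult_le_one)
        then have "1 + norm x \<le> 2 * (1 + norm ?y)"
          using norm_triangle_ineq4[of ?y "s *\<^sub>R b"] norm_ge_zero[of ?y] by (simp only: add_diff_cancel_right' distrib_left)
        then have "(1 + norm x) ^ ?D \<le> 2 ^ ?D * (1 + norm ?y) ^ ?D"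
          unfolding power_mult_distrib[symmetric] by (intro power_mono) auto
        then have "(1 + norm x) ^ ?D * norm (?F' ?y) \<le> 2 ^ ?D * (1 + norm ?y) ^ ?D * norm (?F' ?y)"
          by (intro mult_right_mono) auto
        also have "\<dots> \<le> 2 ^ ?D * C"
          using B[of ?y] by simp
        finally show ?thesis
          by (simp add: field_simps add_pos_nonneg)
      qed
      have "norm (F (x + t n *\<^sub>R b) - F (x + 0 *\<^sub>R b)) \<le> ?B * norm (t n - 0)"
      proof (rule differentiable_bound[where S="{0..t n}" and f="\<lambda>s. F (x + s *\<^sub>R b)"])
        fix s assume s: "s \<in> {0..t n}"
        show "((\<lambda>s. F (x + s *\<^sub>R b)) has_derivative (\<lambda>h. h *\<^sub>R ?F' (x + s *\<^sub>R b))) (at s within {0..t n})"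
          using has_vector_derivative_along[OF d] has_vector_derivative_def has_derivative_at_withinI by blast
        show "onorm (\<lambda>h. h *\<^sub>R ?F' (x + s *\<^sub>R b)) \<le> ?B"
          using F'[OF s] by (intro onorm_le) (simp add: mult.commute mult_left_mono)
      qed (use t[of n] in auto)
      then have "norm (F (x + t n *\<^sub>R b) - F x) / t n \<le> ?B"
        using t[of n] by (simp add: pos_divide_le_eq)
      moreover have "norm (?e x) = 1" by simp
      ultimately show "norm (?e x * ?Q n x) \<le> ?B"
        using t(1)[of n] by (simp only: norm_mult norm_scaleR) simp
    qed
  qed measurable
  have Q: "(LINT x|lborel. ?e x * ?Q n x)
      = (1 / t n) *\<^sub>R (iexp (t n * (\<xi> \<bullet> b)) - 1) * fourier F \<xi>" for n
  proof -
    have i: "integrable lborel (\<lambda>x. ?e x * F x)"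
      by (rule Bochner_Integration.integrable_bound[OF F]) (auto simp: norm_mult)
    have i2: "integrable lborel (\<lambda>x. ?e x * F (x + t n *\<^sub>R b))"
      by (rule Bochner_Integration.integrable_bound[OF lborel_affine_integrable[OF _ F, of 1 "t n *\<^sub>R b"]])
         (auto simp: norm_mult add.commute)
    have "(LINT x|lborel. ?e x * F (x + t n *\<^sub>R b))
        = (LINT x|lborel. ?e (- (t n *\<^sub>R b) + x) * F (- (t n *\<^sub>R b) + x + t n *\<^sub>R b))"
      using lborel_affine_integral[of 1 "\<lambda>x. ?e x * F (x + t n *\<^sub>R b)" "- (t n *\<^sub>R b)"] by simp
    also have "\<dots> = (LINT x|lborel. iexp (t n * (\<xi> \<bullet> b)) * (?e x * F x))"
    proof (rule Bochner_Integration.integral_cong[OF refl])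
      fix x
      have "?e (- (t n *\<^sub>R b) + x) = iexp (t n * (\<xi> \<bullet> b)) * ?e x"
        by (simp add: inner_add_left inner_diff_left inner_commute algebra_simps flip: exp_add)
      then show "?e (- (t n *\<^sub>R b) + x) * F (- (t n *\<^sub>R b) + x + t n *\<^sub>R b)
          = iexp (t n * (\<xi> \<bullet> b)) * (?e x * F x)"
        by simp
    qed
    also have "\<dots> = iexp (t n * (\<xi> \<bullet> b)) * fourier F \<xi>"
      by (simp only: integral_mult_right_zero fourier_def)
    finally have *: "(LINT x|lborel. ?e x * F (x + t n *\<^sub>R b)) = iexp (t n * (\<xi> \<bullet> b)) * fourier F \<xi>" .
    have "(LINT x|lborel. ?e x * ?Q n x)
        = (LINT x|lborel. (1 / t n) *\<^sub>R (?e x * F (x + t n *\<^sub>R b) - ?e x * F x))"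
      by (intro Bochner_Integration.integral_cong refl) (simp add: algebra_simps)
    also have "\<dots> = (1 / t n) *\<^sub>R (iexp (t n * (\<xi> \<bullet> b)) * fourier F \<xi> - fourier F \<xi>)"
      by (simp only: integral_scaleR_right Bochner_Integration.integral_diff[OF i2 i] *) (simp only: fourier_def)
    finally show ?thesis by (simp add: algebra_simps)
  qed
  have "(\<lambda>n. (1 / t n) *\<^sub>R (iexp (t n * (\<xi> \<bullet> b)) - 1) * fourier F \<xi>)
      \<longlonglongrightarrow> \<i> * complex_of_real (\<xi> \<bullet> b) * fourier F \<xi>"
  proof (intro tendsto_mult tendsto_const)
    let ?c = "\<i> * complex_of_real (\<xi> \<bullet> b)"
    have "((\<lambda>z. exp (z * ?c)) has_field_derivative ?c) (at 0)"
      by (auto intro!: derivative_eq_intros)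
    then have "((\<lambda>z. (exp (z * ?c) - 1) / z) \<longlongrightarrow> ?c) (at 0)"
      by (simp add: has_field_derivative_iff)
    moreover have "filterlim (\<lambda>n. complex_of_real (t n)) (at 0) sequentially"
    proof (rule filterlim_atI)
      show "(\<lambda>n. complex_of_real (t n)) \<longlonglongrightarrow> 0"
        using tendsto_of_real[OF t0] by simp
      show "\<forall>\<^sub>F n in sequentially. complex_of_real (t n) \<noteq> 0"
        using t(1) by (simp add: less_imp_neq[symmetric])
    qed
    ultimately have "(\<lambda>n. (exp (complex_of_real (t n) * ?c) - 1) / complex_of_real (t n)) \<longlonglongrightarrow> ?c"
      by (rule filterlim_compose)
    then show "(\<lambda>n. (1 / t n) *\<^sub>R (iexp (t n * (\<xi> \<bullet> b)) - 1)) \<longlonglongrightarrow> ?c"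
      by (simp add: scaleR_conv_of_real mult_ac)
  qed
  from LIMSEQ_unique[OF lim[unfolded Q] this] show ?thesis
    by (simp only: fourier_def[of ?F'])
qed

lemma fourier_partial:
  fixes \<phi> :: "'a::euclidean_space \<Rightarrow> complex"
  assumes \<phi>: "\<phi> \<in> schwartz" and bs: "set (b # bs) \<subseteq> Basis"
  shows "fourier (iter_partial (b # bs) \<phi>) \<xi> = \<i> * complex_of_real (\<xi> \<bullet> b) * fourier (iter_partial bs \<phi>) \<xi>"
proof -
  let ?C = "schwartz_norm (2 * DIM('a) + length (b # bs)) \<phi>"
  have "(1 + norm x) ^ (2 * DIM('a)) * norm (iter_partial (b # bs) \<phi> x) \<le> ?C" for x
    by (rule schwartz_norm_bound[OF \<phi> bs]) auto
  then show ?thesis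
    using fourier_frechet_derivative[of "iter_partial bs \<phi>" b ?C]
      schwartz_differentiable[OF \<phi>, of bs] schwartz_integrable[OF \<phi>, of bs]
      schwartz_partial_measurable[OF \<phi> bs] bs by simp
qed

text \<open>With a the maximum of 1 and the moduli of the coordinates, comparison with the l1 norm
  gives 1 + norm \<xi> \<le> (DIM + 1) a, and a ^ n is dominated by a single term on the right. Only
  pure powers of one coordinate appear, so repeated derivatives in one direction suffice
  afterwards.\<close>

lemma one_add_norm_power_le:
  fixes \<xi> :: "'a::euclidean_space"
  shows "(1 + norm \<xi>) ^ n \<le> (real DIM('a) + 1) ^ n * (1 + (\<Sum>b\<in>Basis. \<bar>\<xi> \<bullet> b\<bar> ^ n))"
proof -
  define a where "a = Max (insert 1 ((\<lambda>b. \<bar>\<xi> \<bullet> b\<bar>) ` Basis))"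
  have "a \<in> insert 1 ((\<lambda>b. \<bar>\<xi> \<bullet> b\<bar>) ` Basis)"
    unfolding a_def by (intro Max_in) auto
  moreover have "\<bar>\<xi> \<bullet> b\<bar> ^ n \<le> (\<Sum>b\<in>Basis. \<bar>\<xi> \<bullet> b\<bar> ^ n)" if "b \<in> Basis" for b
    using that by (intro member_le_sum) auto
  moreover have "0 \<le> (\<Sum>b\<in>Basis. \<bar>\<xi> \<bullet> b\<bar> ^ n)"
    by (intro sum_nonneg) auto
  ultimately have a1: "a ^ n \<le> 1 + (\<Sum>b\<in>Basis. \<bar>\<xi> \<bullet> b\<bar> ^ n)"
    by (fastforce intro: add_increasing)
  have "1 \<le> a" "\<And>b. b \<in> Basis \<Longrightarrow> \<bar>\<xi> \<bullet> b\<bar> \<le> a"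
    unfolding a_def by (intro Max_ge; simp)+
  then have "1 + norm \<xi> \<le> a + (\<Sum>b\<in>(Basis::'a set). a)"
    by (intro add_mono order_trans[OF norm_le_l1] sum_mono) auto
  also have "\<dots> = (real DIM('a) + 1) * a" by (simp add: algebra_simps)
  finally have "(1 + norm \<xi>) ^ n \<le> ((real DIM('a) + 1) * a) ^ n"
    by (intro power_mono) auto
  also have "\<dots> \<le> (real DIM('a) + 1) ^ n * (1 + (\<Sum>b\<in>Basis. \<bar>\<xi> \<bullet> b\<bar> ^ n))"
    unfolding power_mult_distrib by (intro mult_left_mono a1) auto
  finally show ?thesis .
qed

text \<open>The factor (\<xi> \<bullet> b) ^ n is absorbed by n derivatives in direction b, whose L1
  norm bounds the transform. The constant is chosen before \<phi>; this uniformity is what makes the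
  transform of a functional continuous.\<close>

lemma fourier_decay:
  "\<exists>A\<ge>0. \<forall>\<phi>\<in>schwartz. \<forall>\<xi>::'a::euclidean_space.
     (1 + norm \<xi>) ^ n * norm (fourier \<phi> \<xi>) \<le> A * schwartz_norm (n + 2 * DIM('a)) \<phi>"
proof (intro exI conjI ballI allI)
  let ?D = "real DIM('a) + 1" and ?I = "decay_const TYPE('a)" and ?N = "n + 2 * DIM('a)"
  let ?A = "?D ^ n * (?D * ?I)"
  show "0 \<le> ?A" using decay_const_nonneg[of "TYPE('a)"] by simp
  fix \<phi> :: "'a \<Rightarrow> complex" and \<xi> :: 'a assume \<phi>: "\<phi> \<in> schwartz"
  have L1: "norm (fourier (iter_partial bs \<phi>) \<xi>) \<le> schwartz_norm ?N \<phi> * ?I"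
    if "set bs \<subseteq> Basis" "length bs \<le> n" for bs
    using schwartz_L1_bound[OF \<phi> that(1), of 0 ?N] that(2) norm_fourier_le[of "iter_partial bs \<phi>" \<xi>] by simp
  have it: "fourier (iter_partial (replicate k b) \<phi>) \<xi> = (\<i> * complex_of_real (\<xi> \<bullet> b)) ^ k * fourier \<phi> \<xi>"
    if "b \<in> Basis" for k b
  proof (induction k)
    case (Suc k)
    have "set (b # replicate k b) \<subseteq> Basis" using that by auto
    from fourier_partial[OF \<phi> this, of \<xi>] Suc show ?case by simp
  qed simp
  have b: "\<bar>\<xi> \<bullet> b\<bar> ^ n * norm (fourier \<phi> \<xi>) \<le> schwartz_norm ?N \<phi> * ?I" if "b \<in> Basis" for b
    using L1[of "replicate n b"] that by (simp add: it[OF that] norm_mult norm_power set_replicate_conv_if)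
  have "(1 + norm \<xi>) ^ n * norm (fourier \<phi> \<xi>)
      \<le> ?D ^ n * (1 + (\<Sum>b\<in>Basis. \<bar>\<xi> \<bullet> b\<bar> ^ n)) * norm (fourier \<phi> \<xi>)"
    by (intro mult_right_mono one_add_norm_power_le) auto
  also have "\<dots> = ?D ^ n * (norm (fourier \<phi> \<xi>) + (\<Sum>b\<in>Basis. \<bar>\<xi> \<bullet> b\<bar> ^ n * norm (fourier \<phi> \<xi>)))"
    by (simp add: algebra_simps sum_distrib_left)
  also have "\<dots> \<le> ?D ^ n * (schwartz_norm ?N \<phi> * ?I + (\<Sum>b\<in>(Basis::'a set). schwartz_norm ?N \<phi> * ?I))"
    using L1[of "[]"] by (intro mult_left_mono add_mono sum_mono b) auto
  also have "\<dots> = ?A * schwartz_norm ?N \<phi>"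
    by (simp add: algebra_simps)
  finally show "(1 + norm \<xi>) ^ n * norm (fourier \<phi> \<xi>) \<le> ?A * schwartz_norm ?N \<phi>" .
qed

section \<open>Gaussians as test functions\<close>

text \<open>The direction b is fixed first, so only this one partial derivative has to be recognised
  as a polynomial, which an induction over the construction of p provides.\<close>

lemma real_polynomial_function_partial:
  fixes p :: "'a::euclidean_space \<Rightarrow> real"
  assumes "real_polynomial_function p"
  shows "\<exists>p'. real_polynomial_function (\<lambda>x. p' x b) \<and> (\<forall>x. (p has_derivative p' x) (at x))"
  using assms
proof (induction rule: real_polynomial_function.induct)
  case (linear f)
  then show ?case
    by (intro exI[of _ "\<lambda>x. f"]) (auto intro: bounded_linear_imp_has_derivative)
next
  case (const c)
  then show ?case by (intro exI[of _ "\<lambda>x h. 0"]) auto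
next
  case (add f g)
  then obtain f' g' where "real_polynomial_function (\<lambda>x. f' x b)" "\<And>x. (f has_derivative f' x) (at x)"
    "real_polynomial_function (\<lambda>x. g' x b)" "\<And>x. (g has_derivative g' x) (at x)" by blast
  then show ?case
    by (intro exI[of _ "\<lambda>x h. f' x h + g' x h"]) (auto intro: has_derivative_add)
next
  case (mult f g)
  then obtain f' g' where "real_polynomial_function (\<lambda>x. f' x b)" "\<And>x. (f has_derivative f' x) (at x)"
    "real_polynomial_function (\<lambda>x. g' x b)" "\<And>x. (g has_derivative g' x) (at x)" by blast
  with mult.hyps show ?case
    by (intro exI[of _ "\<lambda>x h. f x * g' x h + f' x h * g x"]) (auto intro!: has_derivative_mult)
qed

lemma real_polynomial_function_bound:
  assumes "real_polynomial_function (p :: 'a::euclidean_space \<Rightarrow> real)"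
  shows "\<exists>C N. C \<ge> 0 \<and> (\<forall>x. \<bar>p x\<bar> \<le> C * (1 + norm x) ^ N)"
  using assms
proof (induction rule: real_polynomial_function.induct)
  case (linear f)
  from bounded_linear.pos_bounded[OF this] obtain K where K: "K > 0" "\<And>x. norm (f x) \<le> norm x * K" by auto
  have "\<bar>f x\<bar> \<le> K * (1 + norm x) ^ 1" for x
    using K(2)[of x] K(1) by (simp add: algebra_simps)
  then show ?case using K(1) less_imp_le by blast
next
  case (const c)
  then show ?case by (intro exI[of _ "\<bar>c\<bar>"] exI[of _ 0]) auto
next
  case (add f g)
  then obtain C N D M where CD: "C \<ge> 0" "D \<ge> 0" "\<And>x. \<bar>f x\<bar> \<le> C * (1 + norm x) ^ N" "\<And>x. \<bar>g x\<bar> \<le> D * (1 + norm x) ^ M"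
    by blast
  have "\<bar>f x + g x\<bar> \<le> (C + D) * (1 + norm x) ^ (N + M)" for x
  proof -
    have "\<bar>f x + g x\<bar> \<le> C * (1 + norm x) ^ N + D * (1 + norm x) ^ M"
      using CD(3,4)[of x] by linarith
    also have "\<dots> \<le> C * (1 + norm x) ^ (N + M) + D * (1 + norm x) ^ (N + M)"
      using CD(1,2) by (intro add_mono mult_left_mono power_increasing) auto
    finally show ?thesis by (simp add: algebra_simps)
  qed
  then show ?case using CD(1,2) by (meson add_nonneg_nonneg)
next
  case (mult f g)
  then obtain C N D M where CD: "C \<ge> 0" "D \<ge> 0" "\<And>x. \<bar>f x\<bar> \<le> C * (1 + norm x) ^ N" "\<And>x. \<bar>g x\<bar> \<le> D * (1 + norm x) ^ M"
    by blast
  have "\<bar>f x * g x\<bar> \<le> (C * D) * (1 + norm x) ^ (N + M)" for x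
  proof -
    have "\<bar>f x * g x\<bar> \<le> (C * (1 + norm x) ^ N) * (D * (1 + norm x) ^ M)"
      unfolding abs_mult using CD by (intro mult_mono) auto
    then show ?thesis by (simp add: power_add mult_ac)
  qed
  then show ?case using CD(1,2) by (meson mult_nonneg_nonneg)
qed

lemma real_polynomial_function_norm_square:
  "real_polynomial_function (\<lambda>x::'a::euclidean_space. (norm (x - y))\<^sup>2)"
proof -
  have "(\<lambda>x. (norm (x - y))\<^sup>2) = (\<lambda>x. \<Sum>b\<in>Basis. (x \<bullet> b - y \<bullet> b)\<^sup>2)"
    by (rule ext, subst power2_norm_eq_inner, subst euclidean_inner) (simp add: power2_eq_square inner_diff_left)
  moreover have "real_polynomial_function (\<lambda>x. (x \<bullet> b - y \<bullet> b)\<^sup>2)" for b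
    by (intro real_polynomial_function_power real_polynomial_function_diff real_polynomial_function.intros
        bounded_linear_inner_left)
  ultimately show ?thesis by (auto intro: real_polynomial_function_sum)
qed

text \<open>Polynomials times the given Gaussian form a class stable under partial derivatives, so
  every iterated partial derivative lies in it and decays.\<close>

lemma gauss_schwartz:
  fixes y :: "'a::euclidean_space"
  assumes c: "c > 0"
  shows "(\<lambda>x. complex_of_real (exp (- c * (norm (x - y))\<^sup>2))) \<in> schwartz"
proof -
  let ?E = "\<lambda>x::'a. exp (- c * (norm (x - y))\<^sup>2)"
  let ?f = "\<lambda>x. complex_of_real (?E x)"
  obtain q' :: "'a \<Rightarrow> 'a \<Rightarrow> 'a \<Rightarrow> real" where
    q': "\<And>b. real_polynomial_function (\<lambda>x. q' b x b)" "\<And>b x. ((\<lambda>x. (norm (x - y))\<^sup>2) has_derivative q' b x) (at x)"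
    using real_polynomial_function_partial[OF real_polynomial_function_norm_square[of y]] by metis
  have deriv: "((\<lambda>x. complex_of_real (p x * ?E x)) has_derivative
      (\<lambda>h. complex_of_real (p' h * ?E x + p x * (?E x * (- c * q' b x h))))) (at x)"
    if p': "(p has_derivative p') (at x)" for p p' b x
    by (rule has_derivative_of_real, rule has_derivative_eq_rhs,
        rule has_derivative_mult[OF p' has_derivative_exp[OF has_derivative_mult_right[OF q'(2)[of b]]]])
       (simp add: fun_eq_iff algebra_simps)
  have step: "(\<exists>r. real_polynomial_function r \<and>
      (\<lambda>x. frechet_derivative (\<lambda>x. complex_of_real (p x * ?E x)) (at x) b) = (\<lambda>x. complex_of_real (r x * ?E x)))
      \<and> (\<forall>x. (\<lambda>x. complex_of_real (p x * ?E x)) differentiable (at x))"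
    if p: "real_polynomial_function p" for p b
  proof
    obtain p' where p': "real_polynomial_function (\<lambda>x. p' x b)" "\<And>x. (p has_derivative p' x) (at x)"
      using real_polynomial_function_partial[OF p] by blast
    note d = deriv[OF p'(2)]
    show "\<forall>x. (\<lambda>x. complex_of_real (p x * ?E x)) differentiable (at x)"
      using d differentiableI by blast
    have "frechet_derivative (\<lambda>x. complex_of_real (p x * ?E x)) (at x) b
        = complex_of_real ((p' x b + p x * (- c * q' b x b)) * ?E x)" for x
      by (subst frechet_derivative_at[OF d[of x b], symmetric]) (simp add: algebra_simps)
    moreover have "real_polynomial_function (\<lambda>x. p' x b + p x * (- c * q' b x b))"
      by (intro real_polynomial_function.intros(2-4) p p'(1) q'(1))
    ultimately show "\<exists>r. real_polynomial_function r \<and>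
      (\<lambda>x. frechet_derivative (\<lambda>x. complex_of_real (p x * ?E x)) (at x) b) = (\<lambda>x. complex_of_real (r x * ?E x))"
      by blast
  qed
  have it: "\<exists>p. real_polynomial_function p \<and> iter_partial bs ?f = (\<lambda>x. complex_of_real (p x * ?E x))" for bs
  proof (induction bs)
    case Nil
    show ?case by (intro exI[of _ "\<lambda>x. 1"]) auto
  next
    case (Cons b bs)
    then obtain p where "real_polynomial_function p" "iter_partial bs ?f = (\<lambda>x. complex_of_real (p x * ?E x))" by blast
    then show ?case using step[of p b] by simp
  qed
  show ?thesis
    unfolding schwartz_def smooth_def
  proof (intro CollectI conjI allI impI)
    fix bs :: "'a list" and x
    show "iter_partial bs ?f differentiable (at x)"
      using it[of bs] step by auto
  next
    fix N and bs :: "'a list"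
    obtain p where p: "real_polynomial_function p" "iter_partial bs ?f = (\<lambda>x. complex_of_real (p x * ?E x))"
      using it by blast
    obtain C M where C: "C \<ge> 0" "\<And>x. \<bar>p x\<bar> \<le> C * (1 + norm x) ^ M"
      using real_polynomial_function_bound[OF p(1)] by blast
    let ?B = "C * (1 + norm y) ^ (N + M) * exp ((real (N + M))\<^sup>2 / (4 * c))"
    have "norm ((1 + norm x) ^ N *\<^sub>R iter_partial bs ?f x) \<le> ?B" for x
    proof -
      have "norm ((1 + norm x) ^ N *\<^sub>R iter_partial bs ?f x) = (1 + norm x) ^ N * \<bar>p x\<bar> * ?E x"
        by (simp only: p(2)) (simp add: abs_mult norm_mult)
      also have "\<dots> \<le> (1 + norm x) ^ N * (C * (1 + norm x) ^ M) * ?E x"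
        by (intro mult_right_mono mult_left_mono C) auto
      also have "\<dots> = C * (1 + norm (y + (x - y))) ^ (N + M) * ?E x"
        by (simp add: power_add mult_ac)
      \<comment> \<open>The weight is recentred at y, where the Gaussian lives, at the price of (1 +
        norm y) ^ (N + M).\<close>
      also have "\<dots> \<le> C * ((1 + norm y) * (1 + norm (x - y))) ^ (N + M) * ?E x"
        by (intro mult_right_mono mult_left_mono power_mono one_add_norm_add_le C) auto
      also have "\<dots> = C * (1 + norm y) ^ (N + M) * ((1 + norm (x - y)) ^ (N + M) * ?E x)"
        by (simp only: power_mult_distrib mult_ac)
      also have "\<dots> \<le> ?B"
        using C(1) by (intro mult_left_mono poly_exp_bounded c) auto
      finally show ?thesis .
    qed
    then show "bounded (range (\<lambda>x. (1 + norm x) ^ N *\<^sub>R iter_partial bs ?f x))"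
      by (auto simp: bounded_iff)
  qed
qed

text \<open>Testing against Gaussians centred at \<open>y\<close> recovers the value of a continuous function at \<open>y\<close>.\<close>

lemma fun_dist_unique:
  fixes g h :: "'a::euclidean_space \<Rightarrow> complex"
  assumes g: "g \<in> borel_measurable borel" "poly_bounded g" "isCont g y"
    and h: "h \<in> borel_measurable borel" "poly_bounded h" "isCont h y"
    and eq: "\<And>\<phi>. \<phi> \<in> schwartz \<Longrightarrow> fun_dist g \<phi> = fun_dist h \<phi>"
  shows "g y = h y"
proof -
  define e where "e n = 1 / real (Suc n)" for n
  have e: "e n > 0" for n by (simp add: e_def)
  let ?I = "\<lambda>(g::'a \<Rightarrow> complex) n. LINT z|lborel. g (y + (1 / real (Suc n)) *\<^sub>R z) * complex_of_real (gauss z)"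
  \<comment> \<open>The exponent 1 / (2 e^2) is chosen so that x = y + e z turns the test function
    into sqrt (2 \<pi>) ^ DIM times the standard Gaussian. The remaining factor is nonzero and the
    same for g and h.\<close>
  have I: "fun_dist u (\<lambda>x. complex_of_real (exp (- (1 / (2 * (e n)\<^sup>2)) * (norm (x - y))\<^sup>2)))
      = complex_of_real (e n ^ DIM('a) * sqrt (2 * pi) ^ DIM('a)) * ?I u n"
    if [measurable]: "u \<in> borel_measurable borel" for u n
  proof -
    have "fun_dist u (\<lambda>x. complex_of_real (exp (- (1 / (2 * (e n)\<^sup>2)) * (norm (x - y))\<^sup>2)))
      = \<bar>e n\<bar> ^ DIM('a) *\<^sub>R (LINT z|lborel. u (y + e n *\<^sub>R z) *
          complex_of_real (exp (- (1 / (2 * (e n)\<^sup>2)) * (norm (y + e n *\<^sub>R z - y))\<^sup>2)))"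
      unfolding fun_dist_def using e[of n] by (intro lborel_affine_integral) auto
    also have "\<dots> = \<bar>e n\<bar> ^ DIM('a) *\<^sub>R (LINT z|lborel. complex_of_real (sqrt (2 * pi) ^ DIM('a)) *
         (u (y + e n *\<^sub>R z) * complex_of_real (gauss z)))"
      using e[of n] by (intro arg_cong[where f="\<lambda>t. _ *\<^sub>R t"] Bochner_Integration.integral_cong refl)
        (simp add: gauss_eq power_mult_distrib power_divide)
    also have "\<dots> = complex_of_real (e n ^ DIM('a) * sqrt (2 * pi) ^ DIM('a)) * ?I u n"
      using e[of n] by (simp only: integral_mult_right_zero scaleR_conv_of_real of_real_mult abs_of_pos mult.assoc e_def)
    finally show ?thesis .
  qed
  have "?I g n = ?I h n" for n
  proof -
    have "1 / (2 * (e n)\<^sup>2) > 0" using e[of n] by simp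
    from eq[OF gauss_schwartz[OF this, of y]]
    have "complex_of_real (e n ^ DIM('a) * sqrt (2 * pi) ^ DIM('a)) * ?I g n
        = complex_of_real (e n ^ DIM('a) * sqrt (2 * pi) ^ DIM('a)) * ?I h n"
      unfolding I[OF g(1)] I[OF h(1)] .
    moreover have "complex_of_real (e n ^ DIM('a) * sqrt (2 * pi) ^ DIM('a)) \<noteq> 0" using e[of n] by simp
    ultimately show ?thesis
      using mult_left_cancel[of "complex_of_real (e n ^ DIM('a) * sqrt (2 * pi) ^ DIM('a))"] by blast
  qed
  then have "?I g \<longlonglongrightarrow> h y" using gauss_approximate_identity[OF h] by presburger
  then show ?thesis using gauss_approximate_identity[OF g] LIMSEQ_unique by blast
qed

section \<open>The Hilbert transform\<close>

text \<open>Pairing u with - u lets the even part of a kernel over u cancel before any estimate. The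
  condition at 0 covers the one point that lies in neither open half line.\<close>

lemma integral_split_halves:
  fixes h :: "real \<Rightarrow> complex"
  assumes h: "integrable lborel h" and 0: "h 0 = 0"
  shows "(LINT u|lborel. h u) = (LINT u|lborel. indicator {0<..} u *\<^sub>R (h u + h (- u)))"
proof -
  have i1: "integrable lborel (\<lambda>u. indicator {0<..} u *\<^sub>R h u)"
    using h by (intro integrable_mult_indicator) auto
  have i2: "integrable lborel (\<lambda>u. indicator {..<0} u *\<^sub>R h u)"
    using h by (intro integrable_mult_indicator) auto
  have i3: "integrable lborel (\<lambda>u. indicator {0<..} u *\<^sub>R h (- u))"
    using lborel_integrable_real_affine[OF i2, of "-1" 0] by (simp add: indicator_def)
  have "(LINT u|lborel. h u) = (LINT u|lborel. indicator {0<..} u *\<^sub>R h u + indicator {..<0} u *\<^sub>R h u)"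
    using 0 by (intro Bochner_Integration.integral_cong refl) (auto split: split_indicator)
  also have "\<dots> = (LINT u|lborel. indicator {0<..} u *\<^sub>R h u) + (LINT u|lborel. indicator {..<0} u *\<^sub>R h u)"
    by (rule Bochner_Integration.integral_add[OF i1 i2])
  also have "(LINT u|lborel. indicator {..<0} u *\<^sub>R h u) = (LINT u|lborel. indicator {0<..} u *\<^sub>R h (- u))"
    by (subst lborel_integral_real_affine[of "-1" _ 0]) (auto simp: indicator_def)
  also have "(LINT u|lborel. indicator {0<..} u *\<^sub>R h u) + \<dots>
      = (LINT u|lborel. indicator {0<..} u *\<^sub>R (h u + h (- u)))"
    by (subst Bochner_Integration.integral_add[OF i1 i3, symmetric]) (simp add: scaleR_add_right)
  finally show ?thesis .
qed

lemma integral_sin_div: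
  assumes "0 \<le> R"
  shows "integrable lborel (\<lambda>u. indicator {0<..<R} u *\<^sub>R (sin (u * \<sigma>) / u))"
    and "(LINT u|lborel. indicator {0<..<R} u *\<^sub>R (sin (u * \<sigma>) / u)) = sgn \<sigma> * Si (R * \<bar>\<sigma>\<bar>)"
proof -
  show "integrable lborel (\<lambda>u. indicator {0<..<R} u *\<^sub>R (sin (u * \<sigma>) / u))"
    using integrable_sinc'[of R \<sigma>] assms
    by (simp add: interval_lebesgue_integrable_def set_integrable_def)
  show "(LINT u|lborel. indicator {0<..<R} u *\<^sub>R (sin (u * \<sigma>) / u)) = sgn \<sigma> * Si (R * \<bar>\<sigma>\<bar>)"
    using LBINT_I0c_sin_scale_divide[OF assms, of \<sigma>] assms
    by (simp add: interval_lebesgue_integral_def set_lebesgue_integral_def zero_ereal_def)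
qed

text \<open>Pairing u with - u removes the cosine, which is singular against 1 / u, and leaves - 2
  \<i> sin (\<sigma> u) / u on e < u < R, that is, a difference of two sine integrals.\<close>

lemma integral_truncated_kernel:
  assumes e: "0 < e" "e < R"
  shows "(LINT u|lborel. indicator {u. e < \<bar>u\<bar> \<and> \<bar>u\<bar> < R} u *\<^sub>R (exp (- \<i> * complex_of_real (\<sigma> * u)) / complex_of_real u))
    = - 2 * \<i> * complex_of_real (sgn \<sigma> * (Si (R * \<bar>\<sigma>\<bar>) - Si (e * \<bar>\<sigma>\<bar>)))"
proof -
  let ?A = "{u::real. e < \<bar>u\<bar> \<and> \<bar>u\<bar> < R}"
  let ?h = "\<lambda>u. indicator ?A u *\<^sub>R (exp (- \<i> * complex_of_real (\<sigma> * u)) / complex_of_real u)"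
  have [measurable]: "?A \<in> sets borel" by measurable
  have h: "integrable lborel ?h"
  proof (rule Bochner_Integration.integrable_bound)
    show "integrable lborel (\<lambda>u. indicator {-R..R} u * (1 / e))"
      by (intro integrable_mult_left) (auto simp: integrable_indicator_iff emeasure_lborel_Icc_eq)
    show "AE u in lborel. norm (?h u) \<le> norm (indicator {- R..R} u * (1 / e))"
      using e by (intro AE_I2) (auto simp: norm_divide indicator_def frac_le)
  qed measurable
  have "(LINT u|lborel. ?h u) = (LINT u|lborel. indicator {0<..} u *\<^sub>R (?h u + ?h (- u)))"
    by (rule integral_split_halves[OF h]) (use e in simp)
  also have "\<dots> = (LINT u|lborel. - 2 * \<i> * complex_of_real (indicator {0<..<R} u *\<^sub>R (sin (u * \<sigma>) / u)
       - indicator {0<..<e} u *\<^sub>R (sin (u * \<sigma>) / u)))"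
  \<comment> \<open>The difference of the two open intervals contains the point e, which the
    truncated domain omits, so the integrands agree only almost everywhere.\<close>
  proof (rule integral_cong_AE)
    show "AE u in lborel. indicator {0<..} u *\<^sub>R (?h u + ?h (- u)) = - 2 * \<i> * complex_of_real (indicator {0<..<R} u *\<^sub>R (sin (u * \<sigma>) / u)
       - indicator {0<..<e} u *\<^sub>R (sin (u * \<sigma>) / u))"
      using AE_lborel_singleton[of e]
    proof eventually_elim
      fix u assume u: "u \<noteq> e"
      show "indicator {0<..} u *\<^sub>R (?h u + ?h (- u)) = - 2 * \<i> * complex_of_real (indicator {0<..<R} u *\<^sub>R (sin (u * \<sigma>) / u)
       - indicator {0<..<e} u *\<^sub>R (sin (u * \<sigma>) / u))"
      proof (cases "e < u \<and> u < R")
        case True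
        have "exp (- \<i> * complex_of_real (\<sigma> * u)) - exp (- \<i> * complex_of_real (\<sigma> * - u)) = - 2 * \<i> * complex_of_real (sin (u * \<sigma>))"
          by (simp add: complex_eq_iff Re_exp Im_exp mult.commute)
        then have "exp (- \<i> * complex_of_real (\<sigma> * u)) / complex_of_real u + exp (- \<i> * complex_of_real (\<sigma> * - u)) / complex_of_real (- u)
           = - 2 * \<i> * complex_of_real (sin (u * \<sigma>) / u)"
          by (simp add: diff_divide_distrib[symmetric])
        then show ?thesis using True e by (simp add: indicator_def)
      next
        case False
        then show ?thesis using u e by (auto simp: indicator_def)
      qed
    qed
  qed measurable
  also have "\<dots> = - 2 * \<i> * complex_of_real (LINT u|lborel. (indicator {0<..<R} u *\<^sub>R (sin (u * \<sigma>) / u)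
       - indicator {0<..<e} u *\<^sub>R (sin (u * \<sigma>) / u)))"
    by (simp only: integral_mult_right_zero integral_complex_of_real)
  also have "\<dots> = - 2 * \<i> * complex_of_real (sgn \<sigma> * (Si (R * \<bar>\<sigma>\<bar>) - Si (e * \<bar>\<sigma>\<bar>)))"
    using e by (subst Bochner_Integration.integral_diff)
      (auto simp: integral_sin_div[simplified] right_diff_distrib)
  finally show ?thesis .
qed

text \<open>Cutting the kernel off on both sides makes Fubini applicable. The truncated multipliers are
  differences of values of the sine integral, which is bounded, so both cut-offs can be removed by
  dominated convergence.\<close>

theorem hilbert_fourier_integral:
  fixes k W :: "real \<Rightarrow> complex"
  assumes k: "integrable lborel k" and W: "integrable lborel W"
    and kW: "\<And>s. k s = (LINT \<sigma>|lborel. iexp (\<sigma> * s) * W \<sigma>)"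
  shows "hilbert k p = (LINT \<sigma>|lborel. iexp (\<sigma> * p) * (- \<i> * complex_of_real (sgn \<sigma>) * W \<sigma>))"
proof -
  have [measurable]: "k \<in> borel_measurable borel" "W \<in> borel_measurable borel"
    using borel_measurable_integrable k W by auto
  obtain B where B: "\<And>T. \<bar>Si T\<bar> \<le> B" using bounded_Si by auto
  let ?E = "\<lambda>\<sigma>. iexp (\<sigma> * p) * W \<sigma>"
  let ?S = "\<lambda>c e \<sigma>. - 2 * \<i> * complex_of_real (sgn \<sigma> * (c - Si (e * \<bar>\<sigma>\<bar>)))"
  define I where "I e = (LINT s:{s. e < \<bar>p - s\<bar>}|lborel. k s / complex_of_real (p - s))" for e
  have J: "(LINT s|lborel. indicator {s. e < \<bar>p - s\<bar> \<and> \<bar>p - s\<bar> < R} s *\<^sub>R (k s / complex_of_real (p - s)))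
     = (LINT \<sigma>|lborel. ?S (Si (R * \<bar>\<sigma>\<bar>)) e \<sigma> * ?E \<sigma>)" if e: "0 < e" "e < R" for e R
  proof -
    let ?A = "{s. e < \<bar>p - s\<bar> \<and> \<bar>p - s\<bar> < R}"
    let ?g = "\<lambda>s. indicator ?A s *\<^sub>R (1 / complex_of_real (p - s))"
    have [measurable]: "?A \<in> sets borel" by measurable
    have g: "integrable lborel ?g"
    proof (rule Bochner_Integration.integrable_bound)
      show "integrable lborel (\<lambda>u. indicator {p-R..p+R} u * (1 / e))"
        by (intro integrable_mult_left) (auto simp: integrable_indicator_iff emeasure_lborel_Icc_eq)
      show "AE u in lborel. norm (?g u) \<le> norm (indicator {p-R..p+R} u * (1 / e))"
      proof (rule AE_I2)
        fix u
        have "norm (?g u) = indicator ?A u * (1 / \<bar>p - u\<bar>)"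
          by (simp add: norm_divide flip: of_real_diff)
        also have "\<dots> \<le> indicator {p-R..p+R} u * (1 / e)"
          using e by (auto simp: indicator_def intro!: divide_left_mono)
        also have "\<dots> \<le> norm (indicator {p-R..p+R} u * (1 / e))" using e by simp
        finally show "norm (?g u) \<le> norm (indicator {p-R..p+R} u * (1 / e))" .
      qed
    qed measurable
    have "(LINT s|lborel. indicator ?A s *\<^sub>R (k s / complex_of_real (p - s)))
        = (LINT s|lborel. LINT \<sigma>|lborel. iexp (\<sigma> * s) * ?g s * W \<sigma>)"
    proof (rule Bochner_Integration.integral_cong[OF refl])
      fix s
      have "indicator ?A s *\<^sub>R (k s / complex_of_real (p - s)) = ?g s * k s"
        by (simp add: scaleR_conv_of_real)
      also have "\<dots> = (LINT \<sigma>|lborel. ?g s * (iexp (\<sigma> * s) * W \<sigma>))"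
        by (simp only: kW integral_mult_right_zero)
      finally show "indicator ?A s *\<^sub>R (k s / complex_of_real (p - s)) = (LINT \<sigma>|lborel. iexp (\<sigma> * s) * ?g s * W \<sigma>)"
        by (simp only: mult_ac)
    qed
    also have "\<dots> = (LINT \<sigma>|lborel. LINT s|lborel. iexp (\<sigma> * s) * ?g s * W \<sigma>)"
      by (rule lborel_Fubini_bounded[where B=1, OF g W]) (auto, measurable)
    also have "\<dots> = (LINT \<sigma>|lborel. ?S (Si (R * \<bar>\<sigma>\<bar>)) e \<sigma> * ?E \<sigma>)"
    proof (rule Bochner_Integration.integral_cong[OF refl])
      fix \<sigma>
      have "(LINT s|lborel. iexp (\<sigma> * s) * ?g s * W \<sigma>)
         = (LINT u|lborel. iexp (\<sigma> * (p - u)) * ?g (p - u) * W \<sigma>)"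
        by (subst lborel_integral_real_affine[of "-1" _ p]) auto
      also have "\<dots> = (LINT u|lborel. (indicator {u. e < \<bar>u\<bar> \<and> \<bar>u\<bar> < R} u *\<^sub>R (exp (- \<i> * complex_of_real (\<sigma> * u)) / complex_of_real u)) * ?E \<sigma>)"
      proof (rule Bochner_Integration.integral_cong[OF refl])
        fix u
        have "iexp (\<sigma> * (p - u)) = exp (- \<i> * complex_of_real (\<sigma> * u)) * iexp (\<sigma> * p)"
          by (simp add: algebra_simps flip: exp_add)
        then show "iexp (\<sigma> * (p - u)) * ?g (p - u) * W \<sigma>
          = (indicator {u. e < \<bar>u\<bar> \<and> \<bar>u\<bar> < R} u *\<^sub>R (exp (- \<i> * complex_of_real (\<sigma> * u)) / complex_of_real u)) * ?E \<sigma>"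
          by (simp add: indicator_def)
      qed
      also have "\<dots> = ?S (Si (R * \<bar>\<sigma>\<bar>)) e \<sigma> * ?E \<sigma>"
        by (simp only: integral_mult_left_zero integral_truncated_kernel[OF e])
      finally show "(LINT s|lborel. iexp (\<sigma> * s) * ?g s * W \<sigma>) = ?S (Si (R * \<bar>\<sigma>\<bar>)) e \<sigma> * ?E \<sigma>" .
    qed
    finally show ?thesis .
  qed
  \<comment> \<open>A bound independent of both cut-offs; it supplies the majorant for removing the
    outer one and then the inner one.\<close>
  have normS: "norm (?S c e \<sigma> * ?E \<sigma>) \<le> 2 * (\<bar>c\<bar> + B) * norm (W \<sigma>)" for c e \<sigma>
  proof -
    have "\<bar>sgn \<sigma> * (c - Si (e * \<bar>\<sigma>\<bar>))\<bar> \<le> \<bar>c\<bar> + B"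
      using B[of "e * \<bar>\<sigma>\<bar>"] by (cases \<sigma> "0::real" rule: linorder_cases) auto
    then have "2 * \<bar>sgn \<sigma> * (c - Si (e * \<bar>\<sigma>\<bar>))\<bar> * norm (W \<sigma>) \<le> 2 * (\<bar>c\<bar> + B) * norm (W \<sigma>)"
      by (intro mult_right_mono) auto
    then show ?thesis by (simp only: norm_mult norm_of_real) (simp add: abs_mult)
  qed
  \<comment> \<open>The outer cut-off goes first, with e fixed: Si (R |\<sigma>|) tends to \<pi> / 2
    for \<sigma> \<noteq> 0, and at \<sigma> = 0 the factor sgn \<sigma> vanishes.\<close>
  have I: "I e = (LINT \<sigma>|lborel. ?S (pi / 2) e \<sigma> * ?E \<sigma>)" if e: "0 < e" for e
  proof -
    let ?R = "\<lambda>n. e + 1 + real n"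
    let ?Ae = "{s. e < \<bar>p - s\<bar>}"
    have [measurable]: "?Ae \<in> sets borel" "\<And>n. {s. e < \<bar>p - s\<bar> \<and> \<bar>p - s\<bar> < ?R n} \<in> sets borel" by measurable
    have Rlim: "filterlim ?R at_top sequentially"
      by (intro filterlim_tendsto_add_at_top[OF tendsto_const] filterlim_real_sequentially)
    have "(\<lambda>n. LINT s|lborel. indicator {s. e < \<bar>p - s\<bar> \<and> \<bar>p - s\<bar> < ?R n} s *\<^sub>R (k s / complex_of_real (p - s)))
       \<longlonglongrightarrow> (LINT s|lborel. indicator ?Ae s *\<^sub>R (k s / complex_of_real (p - s)))"
    proof (rule integral_dominated_convergence[where w="\<lambda>s. norm (k s) * (1 / e)"])
      show "integrable lborel (\<lambda>s. norm (k s) * (1 / e))"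
        using k by (intro integrable_mult_left integrable_norm)
      show "AE s in lborel. (\<lambda>n. indicator {s. e < \<bar>p - s\<bar> \<and> \<bar>p - s\<bar> < ?R n} s *\<^sub>R (k s / complex_of_real (p - s)))
         \<longlonglongrightarrow> indicator ?Ae s *\<^sub>R (k s / complex_of_real (p - s))"
      proof (intro AE_I2 tendsto_eventually)
        fix s
        have "\<forall>\<^sub>F n in sequentially. \<bar>p - s\<bar> < ?R n"
          using Rlim unfolding filterlim_at_top_dense by blast
        then show "\<forall>\<^sub>F n in sequentially. indicator {s. e < \<bar>p - s\<bar> \<and> \<bar>p - s\<bar> < ?R n} s *\<^sub>R (k s / complex_of_real (p - s))
            = indicator ?Ae s *\<^sub>R (k s / complex_of_real (p - s))"
          by eventually_elim (auto simp: indicator_def)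
      qed
      fix n
      show "AE s in lborel. norm (indicator {s. e < \<bar>p - s\<bar> \<and> \<bar>p - s\<bar> < ?R n} s *\<^sub>R (k s / complex_of_real (p - s))) \<le> norm (k s) * (1 / e)"
      proof (rule AE_I2)
        fix s
        have "norm (k s) / \<bar>p - s\<bar> \<le> norm (k s) / e" if "e < \<bar>p - s\<bar>"
          using that e by (intro divide_left_mono) auto
        then show "norm (indicator {s. e < \<bar>p - s\<bar> \<and> \<bar>p - s\<bar> < ?R n} s *\<^sub>R (k s / complex_of_real (p - s))) \<le> norm (k s) * (1 / e)"
          using e by (auto simp: indicator_def norm_divide simp flip: of_real_diff)
      qed
    qed measurable
    moreover have "(\<lambda>n. LINT \<sigma>|lborel. ?S (Si (?R n * \<bar>\<sigma>\<bar>)) e \<sigma> * ?E \<sigma>) \<longlonglongrightarrow> (LINT \<sigma>|lborel. ?S (pi / 2) e \<sigma> * ?E \<sigma>)"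
    proof (rule integral_dominated_convergence[where w="\<lambda>\<sigma>. 2 * (B + B) * norm (W \<sigma>)"])
      show "integrable lborel (\<lambda>\<sigma>. 2 * (B + B) * norm (W \<sigma>))"
        using W by (intro integrable_mult_right integrable_norm)
      show "AE \<sigma> in lborel. (\<lambda>n. ?S (Si (?R n * \<bar>\<sigma>\<bar>)) e \<sigma> * ?E \<sigma>) \<longlonglongrightarrow> ?S (pi / 2) e \<sigma> * ?E \<sigma>"
      proof (rule AE_I2)
        fix \<sigma> :: real
        show "(\<lambda>n. ?S (Si (?R n * \<bar>\<sigma>\<bar>)) e \<sigma> * ?E \<sigma>) \<longlonglongrightarrow> ?S (pi / 2) e \<sigma> * ?E \<sigma>"
        proof (cases "\<sigma> = 0")
          case False
          then have "filterlim (\<lambda>n. ?R n * \<bar>\<sigma>\<bar>) at_top sequentially"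
            by (intro filterlim_at_top_mult_tendsto_pos[OF tendsto_const _ Rlim]) auto
          then have "(\<lambda>n. Si (?R n * \<bar>\<sigma>\<bar>)) \<longlonglongrightarrow> pi / 2"
            by (rule filterlim_compose[OF Si_at_top])
          then show ?thesis by (intro tendsto_intros)
        qed simp
      qed
      show "AE \<sigma> in lborel. norm (?S (Si (?R n * \<bar>\<sigma>\<bar>)) e \<sigma> * ?E \<sigma>) \<le> 2 * (B + B) * norm (W \<sigma>)" for n
      proof (rule AE_I2)
        fix \<sigma>
        have "2 * (\<bar>Si (?R n * \<bar>\<sigma>\<bar>)\<bar> + B) * norm (W \<sigma>) \<le> 2 * (B + B) * norm (W \<sigma>)"
          using B[of "?R n * \<bar>\<sigma>\<bar>"] by (intro mult_right_mono) auto
        then show "norm (?S (Si (?R n * \<bar>\<sigma>\<bar>)) e \<sigma> * ?E \<sigma>) \<le> 2 * (B + B) * norm (W \<sigma>)"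
          using normS order_trans by blast
      qed
    qed measurable
    moreover have "(LINT s|lborel. indicator {s. e < \<bar>p - s\<bar> \<and> \<bar>p - s\<bar> < ?R n} s *\<^sub>R (k s / complex_of_real (p - s)))
      = (LINT \<sigma>|lborel. ?S (Si (?R n * \<bar>\<sigma>\<bar>)) e \<sigma> * ?E \<sigma>)" for n
      by (rule J) (use e in auto)
    ultimately have "(LINT s|lborel. indicator ?Ae s *\<^sub>R (k s / complex_of_real (p - s))) = (LINT \<sigma>|lborel. ?S (pi / 2) e \<sigma> * ?E \<sigma>)"
      using LIMSEQ_unique by simp
    then show ?thesis unfolding I_def set_lebesgue_integral_def .
  qed
  \<comment> \<open>As Si 0 = 0, the limiting multiplier is - 2 \<i> sgn \<sigma> * \<pi> / 2, and
    the prefactor 1 / \<pi> of \<open>hilbert\<close> reduces it to - \<i> sgn \<sigma>.\<close>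
  let ?L = "LINT \<sigma>|lborel. ?S (pi / 2) 0 \<sigma> * ?E \<sigma>"
  have "(I \<longlongrightarrow> ?L) (at_right 0)"
    unfolding tendsto_at_iff_sequentially
  proof (intro allI impI)
    fix X :: "nat \<Rightarrow> real" assume X: "\<forall>i. X i \<in> {0<..} - {0}" "X \<longlonglongrightarrow> 0"
    have "(\<lambda>n. LINT \<sigma>|lborel. ?S (pi / 2) (X n) \<sigma> * ?E \<sigma>) \<longlonglongrightarrow> ?L"
    proof (rule integral_dominated_convergence[where w="\<lambda>\<sigma>. 2 * (\<bar>pi / 2\<bar> + B) * norm (W \<sigma>)"])
      show "integrable lborel (\<lambda>\<sigma>. 2 * (\<bar>pi / 2\<bar> + B) * norm (W \<sigma>))"
        using W by (intro integrable_mult_right integrable_norm)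
      show "AE \<sigma> in lborel. (\<lambda>n. ?S (pi / 2) (X n) \<sigma> * ?E \<sigma>) \<longlonglongrightarrow> ?S (pi / 2) 0 \<sigma> * ?E \<sigma>"
        by (intro AE_I2 tendsto_intros isCont_tendsto_compose[OF isCont_Si] X(2))
      show "AE \<sigma> in lborel. norm (?S (pi / 2) (X n) \<sigma> * ?E \<sigma>) \<le> 2 * (\<bar>pi / 2\<bar> + B) * norm (W \<sigma>)" for n
        by (rule AE_I2) (rule normS)
    qed measurable
    moreover have "(I \<circ> X) n = (LINT \<sigma>|lborel. ?S (pi / 2) (X n) \<sigma> * ?E \<sigma>)" for n
      using I[of "X n"] X(1) by simp
    ultimately show "(I \<circ> X) \<longlonglongrightarrow> ?L" by presburger
  qed
  then have "Lim (at_right 0) I = ?L"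
    by (intro tendsto_Lim) auto
  then have "hilbert k p = complex_of_real (1 / pi) * ?L"
    unfolding hilbert_def I_def[abs_def] by simp
  also have "\<dots> = (LINT \<sigma>|lborel. complex_of_real (1 / pi) * (?S (pi / 2) 0 \<sigma> * ?E \<sigma>))"
    by (simp only: integral_mult_right_zero)
  also have "\<dots> = (LINT \<sigma>|lborel. iexp (\<sigma> * p) * (- \<i> * complex_of_real (sgn \<sigma>) * W \<sigma>))"
  proof -
    have "Si 0 = 0" using Si_neg[of 0] by simp
    then show ?thesis
      by (intro Bochner_Integration.integral_cong refl) (simp add: field_simps)
  qed
  finally show ?thesis .
qed

section \<open>The Radon transform\<close>

lemma inner_real2: "x \<bullet> y = x $ 1 * y $ 1 + x $ 2 * y $ 2" for x y :: "real ^ 2"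
  by (simp add: inner_vec_def sum_2)

lemma perp_component [simp]: "perp \<omega> $ 1 = - (\<omega> $ 2)" "perp \<omega> $ 2 = \<omega> $ 1"
  by (simp_all add: perp_def)

lemma norm_perp [simp]: "norm (perp \<omega>) = norm \<omega>"
  by (simp add: norm_eq_sqrt_inner inner_real2)

lemma perp_inner [simp]: "perp \<omega> \<bullet> \<omega> = 0" "\<omega> \<bullet> perp \<omega> = 0"
  by (simp_all add: inner_real2)

lemma lborel_vector2: "(lborel :: (real ^ 2) measure) = distr (lborel \<Otimes>\<^sub>M lborel) borel (\<lambda>(p, t). vector [p, t])"
proof (rule lborel_eqI)
  fix l u :: "real ^ 2" assume le: "\<And>b. b \<in> Basis \<Longrightarrow> l \<bullet> b \<le> u \<bullet> b"
  have V: "(\<lambda>(p, t). vector [p, t] :: real ^ 2) = (\<lambda>z. fst z *\<^sub>R axis 1 1 + snd z *\<^sub>R axis 2 1)"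
    by (auto simp: fun_eq_iff vec_eq_iff forall_2 axis_def)
  have [measurable]: "(\<lambda>(p, t). vector [p, t] :: real ^ 2) \<in> (lborel :: real measure) \<Otimes>\<^sub>M (lborel :: real measure) \<rightarrow>\<^sub>M borel"
    unfolding V by measurable
  have le': "l $ i \<le> u $ i" for i
    using le[of "axis i 1"] by (simp add: inner_axis)
  have "(\<lambda>(p, t). vector [p, t]) -` box l u = {l $ 1 <..< u $ 1} \<times> {l $ 2 <..< u $ 2}"
    by (auto simp: mem_box_cart forall_2)
  then have "emeasure (distr (lborel \<Otimes>\<^sub>M lborel) borel (\<lambda>(p, t). vector [p, t])) (box l u)
      = emeasure (lborel \<Otimes>\<^sub>M lborel) ({l $ 1 <..< u $ 1} \<times> {l $ 2 <..< u $ 2})"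
    by (subst emeasure_distr) (auto simp: space_pair_measure)
  also have "\<dots> = ennreal (u $ 1 - l $ 1) * ennreal (u $ 2 - l $ 2)"
    by (subst lborel.emeasure_pair_measure_Times) (auto simp: le')
  also have "\<dots> = ennreal ((u $ 1 - l $ 1) * (u $ 2 - l $ 2))"
    using le' by (simp add: ennreal_mult)
  also have "(u $ 1 - l $ 1) * (u $ 2 - l $ 2) = (\<Prod>b\<in>Basis. (u - l) \<bullet> b)"
  proof -
    have B: "(Basis :: (real ^ 2) set) = {axis 1 1, axis 2 1}"
      by (auto simp: Basis_vec_def exhaust_2 UNIV_2)
    have "axis 1 1 \<noteq> (axis 2 1 :: real ^ 2)" by (simp add: axis_eq_axis)
    then show ?thesis unfolding B by (simp add: inner_axis)
  qed
  finally show "emeasure (distr (lborel \<Otimes>\<^sub>M lborel) borel (\<lambda>(p, t). vector [p, t])) (box l u)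
      = ennreal (\<Prod>b\<in>Basis. (u - l) \<bullet> b)" .
qed simp

text \<open>Lebesgue measure is determined by its values on boxes. The preimage of a box under
  \<open>?R\<close> is its image under the inverse \<open>?Q\<close>, and the invariance of measure
  under orthogonal maps is a statement about images.\<close>

lemma lborel_rotate:
  fixes \<omega> :: "real ^ 2"
  assumes \<omega>: "norm \<omega> = 1"
  shows "lborel = distr lborel borel (\<lambda>x :: real ^ 2. x $ 1 *\<^sub>R \<omega> + x $ 2 *\<^sub>R perp \<omega>)" (is "_ = distr _ _ ?R")
proof (rule lborel_eqI)
  fix l u :: "real ^ 2" assume le: "\<And>b. b \<in> Basis \<Longrightarrow> l \<bullet> b \<le> u \<bullet> b"
  let ?Q = "\<lambda>x. vector [x \<bullet> \<omega>, x \<bullet> perp \<omega>] :: real ^ 2"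
  have \<omega>': "\<omega> $ 1 * \<omega> $ 1 + \<omega> $ 2 * \<omega> $ 2 = 1"
    using \<omega> by (simp add: norm_eq_sqrt_inner inner_real2)
  have o: "orthogonal_transformation ?Q"
  proof -
    have "linear ?Q"
      by (rule linearI) (auto simp: vec_eq_iff forall_2 inner_add_left)
    moreover have "?Q v \<bullet> ?Q w = v \<bullet> w" for v w
    proof -
      have "?Q v \<bullet> ?Q w = (v $ 1 * w $ 1 + v $ 2 * w $ 2) * (\<omega> $ 1 * \<omega> $ 1 + \<omega> $ 2 * \<omega> $ 2)"
        by (simp add: inner_real2 algebra_simps)
      then show ?thesis by (simp add: \<omega>' inner_real2)
    qed
    ultimately show ?thesis by (simp add: orthogonal_transformation_def)
  qed
  have QR: "?Q (?R x) = x" for x :: "real ^ 2"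
  proof -
    have "?R x \<bullet> \<omega> = x $ 1 * (\<omega> $ 1 * \<omega> $ 1 + \<omega> $ 2 * \<omega> $ 2)"
      "?R x \<bullet> perp \<omega> = x $ 2 * (\<omega> $ 1 * \<omega> $ 1 + \<omega> $ 2 * \<omega> $ 2)"
      by (simp_all add: inner_real2 algebra_simps)
    then show ?thesis by (simp add: \<omega>' vec_eq_iff forall_2)
  qed
  have RQ: "?R (?Q x) = x" for x :: "real ^ 2"
  proof -
    have "?R (?Q x) $ 1 = x $ 1 * (\<omega> $ 1 * \<omega> $ 1 + \<omega> $ 2 * \<omega> $ 2)"
      "?R (?Q x) $ 2 = x $ 2 * (\<omega> $ 1 * \<omega> $ 1 + \<omega> $ 2 * \<omega> $ 2)"
      by (simp_all add: inner_real2 algebra_simps)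
    then show ?thesis by (simp only: \<omega>' vec_eq_iff forall_2 mult_1_right)
  qed
  have [measurable]: "?R \<in> borel \<rightarrow>\<^sub>M borel"
    by (intro borel_measurable_continuous_onI continuous_intros)
  have vimage: "?R -` box l u = ?Q ` box l u"
  proof (intro equalityI subsetI)
    fix x assume "x \<in> ?R -` box l u"
    then have "?R x \<in> box l u" by simp
    then show "x \<in> ?Q ` box l u" by (intro image_eqI[where x="?R x"] QR[symmetric])
  next
    fix x assume "x \<in> ?Q ` box l u"
    then show "x \<in> ?R -` box l u" using RQ by auto
  qed
  have S: "box l u \<in> lmeasurable" by simp
  have Qb: "?Q ` box l u \<in> sets borel"
    unfolding vimage[symmetric] using measurable_sets[of ?R borel borel "box l u"] by simp
  have "emeasure (distr lborel borel ?R) (box l u) = emeasure lebesgue (?Q ` box l u)"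
    using Qb by (subst emeasure_distr) (auto simp: vimage)
  also have "\<dots> = ennreal (measure lebesgue (?Q ` box l u))"
    using measurable_orthogonal_image[OF o S] by (intro emeasure_eq_ennreal_measure) (auto simp: fmeasurable_def)
  also have "\<dots> = ennreal (measure lebesgue (box l u))"
    by (subst measure_orthogonal_image[OF o S]) simp
  also have "\<dots> = emeasure lebesgue (box l u)"
    by (rule emeasure_eq_ennreal_measure[symmetric]) (rule fmeasurableD2[OF S])
  also have "\<dots> = ennreal (\<Prod>b\<in>Basis. (u - l) \<bullet> b)"
    using le by simp
  finally show "emeasure (distr lborel borel ?R) (box l u) = ennreal (\<Prod>b\<in>Basis. (u - l) \<bullet> b)" .
qed simp

lemma lborel_plane:
  fixes \<omega> :: "real ^ 2"
  assumes \<omega>: "norm \<omega> = 1"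
  shows "lborel = distr (lborel \<Otimes>\<^sub>M lborel) borel (\<lambda>(p, t). p *\<^sub>R \<omega> + t *\<^sub>R perp \<omega>)"
proof -
  let ?R = "\<lambda>x::real ^ 2. x $ 1 *\<^sub>R \<omega> + x $ 2 *\<^sub>R perp \<omega>"
  let ?V = "\<lambda>(p, t). vector [p, t] :: real ^ 2"
  have V: "?V = (\<lambda>z. fst z *\<^sub>R axis 1 1 + snd z *\<^sub>R axis 2 1)"
    by (auto simp: fun_eq_iff vec_eq_iff forall_2 axis_def)
  have m[measurable]: "?V \<in> (lborel :: real measure) \<Otimes>\<^sub>M (lborel :: real measure) \<rightarrow>\<^sub>M borel"
    unfolding V by measurable
  have r[measurable]: "?R \<in> borel \<rightarrow>\<^sub>M borel"
    by (intro borel_measurable_continuous_onI continuous_intros)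
  have "lborel = distr (distr (lborel \<Otimes>\<^sub>M lborel) borel ?V) borel ?R"
    using lborel_rotate[OF \<omega>] lborel_vector2 by simp
  also have "\<dots> = distr (lborel \<Otimes>\<^sub>M lborel) borel (?R \<circ> ?V)"
    by (rule distr_distr[OF r m])
  also have "?R \<circ> ?V = (\<lambda>(p, t). p *\<^sub>R \<omega> + t *\<^sub>R perp \<omega>)"
    by (auto simp: fun_eq_iff)
  finally show ?thesis .
qed

lemma
  fixes \<omega> :: "real ^ 2" and F :: "real ^ 2 \<Rightarrow> complex"
  assumes \<omega>: "norm \<omega> = 1" and F: "integrable lborel F"
  shows plane_integrable: "integrable (lborel \<Otimes>\<^sub>M lborel) (\<lambda>(p, t). F (p *\<^sub>R \<omega> + t *\<^sub>R perp \<omega>))"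
    and plane_integral: "(LINT x|lborel. F x) = (LINT p|lborel. LINT t|lborel. F (p *\<^sub>R \<omega> + t *\<^sub>R perp \<omega>))"
proof -
  let ?T = "\<lambda>(p, t). p *\<^sub>R \<omega> + t *\<^sub>R perp \<omega>"
  have F'[measurable]: "F \<in> borel_measurable borel" using borel_measurable_integrable[OF F] by simp
  have T: "?T \<in> (lborel \<Otimes>\<^sub>M lborel) \<rightarrow>\<^sub>M borel" by measurable
  have eq: "(\<lambda>z. F (?T z)) = (\<lambda>(p, t). F (p *\<^sub>R \<omega> + t *\<^sub>R perp \<omega>))" by auto
  show i: "integrable (lborel \<Otimes>\<^sub>M lborel) (\<lambda>(p, t). F (p *\<^sub>R \<omega> + t *\<^sub>R perp \<omega>))"
    using F unfolding eq[symmetric] by (subst (asm) lborel_plane[OF \<omega>], subst (asm) integrable_distr_eq[OF T F'])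
  have "(LINT x|lborel. F x) = (LINT z|(lborel \<Otimes>\<^sub>M lborel). F (?T z))"
    by (subst lborel_plane[OF \<omega>], rule integral_distr[OF T F'])
  also have "\<dots> = (LINT p|lborel. LINT t|lborel. F (p *\<^sub>R \<omega> + t *\<^sub>R perp \<omega>))"
    unfolding eq lborel_pair.integral_fst'[OF i, symmetric] by simp
  finally show "(LINT x|lborel. F x) = (LINT p|lborel. LINT t|lborel. F (p *\<^sub>R \<omega> + t *\<^sub>R perp \<omega>))" .
qed

section \<open>The slice theorem and filtered projections\<close>

text \<open>On the line x \<bullet> \<omega> = p the phase x \<bullet> (\<sigma> \<omega>) has the
  constant value p \<sigma>, so it leaves the inner integral.\<close>

lemma fourier_radon:
  fixes F :: "real ^ 2 \<Rightarrow> complex"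
  assumes F: "integrable lborel F" and \<omega>: "norm \<omega> = 1"
  shows "fourier (radon F \<omega>) \<sigma> = fourier F (\<sigma> *\<^sub>R \<omega>)"
proof -
  have i: "integrable lborel (\<lambda>x. exp (- \<i> * complex_of_real (x \<bullet> (\<sigma> *\<^sub>R \<omega>))) * F x)"
    by (rule Bochner_Integration.integrable_bound[OF F])
       (use borel_measurable_integrable[OF F] in \<open>auto simp: norm_mult\<close>)
  have \<omega>2: "\<omega> \<bullet> \<omega> = 1" using \<omega> by (simp add: dot_square_norm)
  have "fourier F (\<sigma> *\<^sub>R \<omega>) = (LINT p|lborel. LINT t|lborel.
      exp (- \<i> * complex_of_real ((p *\<^sub>R \<omega> + t *\<^sub>R perp \<omega>) \<bullet> (\<sigma> *\<^sub>R \<omega>))) * F (p *\<^sub>R \<omega> + t *\<^sub>R perp \<omega>))"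
    unfolding fourier_def by (rule plane_integral[OF \<omega> i])
  also have "\<dots> = (LINT p|lborel. LINT t|lborel. exp (- \<i> * complex_of_real (p \<bullet> \<sigma>)) * F (p *\<^sub>R \<omega> + t *\<^sub>R perp \<omega>))"
    by (simp add: inner_add_left \<omega>2 mult.commute)
  also have "\<dots> = fourier (radon F \<omega>) \<sigma>"
    unfolding fourier_def radon_def by (simp only: integral_mult_right_zero)
  finally show ?thesis ..
qed

lemma radon_integrable:
  fixes F :: "real ^ 2 \<Rightarrow> complex"
  assumes "integrable lborel F" and "norm \<omega> = 1"
  shows "integrable lborel (radon F \<omega>)"
  unfolding radon_def[abs_def] using lborel_pair.integrable_fst'[OF plane_integrable[OF assms(2,1)]] by simp

text \<open>The norm of p \<omega> + t \<omega>\<bottom> is at least |t|, which turns the decay of F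
  into a majorant in t that is uniform in p. Continuity and boundedness are what Fourier inversion
  asks of the Radon transform.\<close>

lemma
  fixes F :: "real ^ 2 \<Rightarrow> complex"
  assumes c: "continuous_on UNIV F" and b: "\<And>x. (1 + norm x) ^ 2 * norm (F x) \<le> C" and \<omega>: "norm \<omega> = 1"
  shows radon_isCont: "isCont (radon F \<omega>) p" and radon_bounded: "norm (radon F \<omega> p) \<le> C * decay_const TYPE(real)"
proof -
  have [measurable]: "F \<in> borel_measurable borel" by (rule borel_measurable_continuous_onI[OF c])
  have \<omega>2: "\<omega> \<bullet> \<omega> = 1" "perp \<omega> \<bullet> perp \<omega> = 1" using \<omega> by (simp_all add: dot_square_norm)
  have nt: "\<bar>t\<bar> \<le> norm (p *\<^sub>R \<omega> + t *\<^sub>R perp \<omega>)" for p t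
  proof -
    have "t = (p *\<^sub>R \<omega> + t *\<^sub>R perp \<omega>) \<bullet> perp \<omega>" by (simp add: inner_add_left \<omega>2)
    also have "\<bar>\<dots>\<bar> \<le> norm (p *\<^sub>R \<omega> + t *\<^sub>R perp \<omega>) * norm (perp \<omega>)" by (rule Cauchy_Schwarz_ineq2)
    finally show ?thesis using \<omega> by simp
  qed
  have b': "(1 + norm t) ^ (2 * DIM(real)) * norm (F (p *\<^sub>R \<omega> + t *\<^sub>R perp \<omega>)) \<le> C" for p t
  proof -
    have "(1 + norm t) ^ (2 * DIM(real)) * norm (F (p *\<^sub>R \<omega> + t *\<^sub>R perp \<omega>))
        \<le> (1 + norm (p *\<^sub>R \<omega> + t *\<^sub>R perp \<omega>)) ^ 2 * norm (F (p *\<^sub>R \<omega> + t *\<^sub>R perp \<omega>))"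
      using nt[of t p] by (intro mult_right_mono) (auto intro!: power_mono)
    then show ?thesis using b order_trans by blast
  qed
  have b2: "norm (F (p *\<^sub>R \<omega> + t *\<^sub>R perp \<omega>)) \<le> C * inverse ((1 + norm t) ^ (2 * DIM(real)))" for p t
  proof -
    have "0 < (1 + norm t) ^ (2 * DIM(real))" by (intro zero_less_power add_pos_nonneg) auto
    then show ?thesis using b'[of t p] by (simp add: field_simps)
  qed
  show "norm (radon F \<omega> p) \<le> C * decay_const TYPE(real)"
  proof -
    have "norm (radon F \<omega> p) \<le> (LINT t|lborel. norm (F (p *\<^sub>R \<omega> + t *\<^sub>R perp \<omega>)))"
      unfolding radon_def by (rule integral_norm_bound)
    also have "\<dots> \<le> C * decay_const TYPE(real)"
      unfolding decay_const_def using b' by (intro integrable_of_decay(2)) measurable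
    finally show ?thesis .
  qed
  show "isCont (radon F \<omega>) p"
    unfolding continuous_at_sequentially o_def radon_def
  proof (intro allI impI)
    fix u assume u: "u \<longlonglongrightarrow> p"
    show "(\<lambda>n. LINT t|lborel. F (u n *\<^sub>R \<omega> + t *\<^sub>R perp \<omega>)) \<longlonglongrightarrow> (LINT t|lborel. F (p *\<^sub>R \<omega> + t *\<^sub>R perp \<omega>))"
    proof (rule integral_dominated_convergence[where w="\<lambda>t::real. C * inverse ((1 + norm t) ^ (2 * DIM(real)))"])
      show "integrable lborel (\<lambda>t::real. C * inverse ((1 + norm t) ^ (2 * DIM(real))))"
        by (intro integrable_mult_right integrable_decay)
      show "AE t in lborel. (\<lambda>n. F (u n *\<^sub>R \<omega> + t *\<^sub>R perp \<omega>)) \<longlonglongrightarrow> F (p *\<^sub>R \<omega> + t *\<^sub>R perp \<omega>)"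
        using c by (intro AE_I2 isCont_tendsto_compose[of _ F] tendsto_intros u)
          (simp add: continuous_on_eq_continuous_at)
      show "AE t in lborel. norm (F (u n *\<^sub>R \<omega> + t *\<^sub>R perp \<omega>)) \<le> C * inverse ((1 + norm t) ^ (2 * DIM(real)))" for n
        using b2 by (intro AE_I2)
    qed measurable
  qed
qed

text \<open>Of the N + 2 powers of decay, N absorb the weight |\<sigma>| ^ N and two give
  integrability on a line.\<close>

lemma line_integrable:
  fixes H :: "'a::euclidean_space \<Rightarrow> complex"
  assumes [measurable]: "H \<in> borel_measurable borel" and \<omega>: "norm \<omega> = 1"
    and b: "\<And>x. (1 + norm x) ^ (N + 2) * norm (H x) \<le> C"
  shows "integrable lborel (\<lambda>\<sigma>::real. complex_of_real (\<bar>\<sigma>\<bar> ^ N) * H (\<sigma> *\<^sub>R \<omega>))"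
    and "norm (LINT \<sigma>|lborel. complex_of_real (\<bar>\<sigma>\<bar> ^ N) * H (\<sigma> *\<^sub>R \<omega>)) \<le> C * decay_const TYPE(real)"
proof -
  have *: "(1 + norm \<sigma>) ^ (2 * DIM(real)) * norm (complex_of_real (\<bar>\<sigma>\<bar> ^ N) * H (\<sigma> *\<^sub>R \<omega>)) \<le> C" for \<sigma>
  proof -
    have nd: "(1 + norm \<sigma>) ^ (2 * DIM(real)) = (1 + \<bar>\<sigma>\<bar>) ^ 2" by simp
    have "(1 + norm \<sigma>) ^ (2 * DIM(real)) * norm (complex_of_real (\<bar>\<sigma>\<bar> ^ N) * H (\<sigma> *\<^sub>R \<omega>))
        = ((1 + \<bar>\<sigma>\<bar>) ^ 2 * \<bar>\<sigma>\<bar> ^ N) * norm (H (\<sigma> *\<^sub>R \<omega>))"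
      by (simp only: nd norm_mult norm_of_real power_abs abs_abs mult.assoc)
    also have "\<dots> \<le> ((1 + \<bar>\<sigma>\<bar>) ^ 2 * (1 + \<bar>\<sigma>\<bar>) ^ N) * norm (H (\<sigma> *\<^sub>R \<omega>))"
      by (intro mult_right_mono mult_left_mono power_mono) auto
    also have "\<dots> = (1 + norm (\<sigma> *\<^sub>R \<omega>)) ^ (N + 2) * norm (H (\<sigma> *\<^sub>R \<omega>))"
      using \<omega> by (simp add: power_add power2_eq_square mult_ac)
    also have "\<dots> \<le> C" by (rule b)
    finally show ?thesis .
  qed
  have m: "(\<lambda>\<sigma>::real. complex_of_real (\<bar>\<sigma>\<bar> ^ N) * H (\<sigma> *\<^sub>R \<omega>)) \<in> borel_measurable borel" by measurable
  show "integrable lborel (\<lambda>\<sigma>::real. complex_of_real (\<bar>\<sigma>\<bar> ^ N) * H (\<sigma> *\<^sub>R \<omega>))"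
    by (rule integrable_of_decay(1)[OF m *])
  have "norm (LINT \<sigma>|lborel. complex_of_real (\<bar>\<sigma>\<bar> ^ N) * H (\<sigma> *\<^sub>R \<omega>))
      \<le> (LINT \<sigma>|lborel. norm (complex_of_real (\<bar>\<sigma>\<bar> ^ N) * H (\<sigma> *\<^sub>R \<omega>)))"
    by (rule integral_norm_bound)
  also have "\<dots> \<le> C * decay_const TYPE(real)"
    unfolding decay_const_def by (rule integrable_of_decay(2)[OF m *])
  finally show "norm (LINT \<sigma>|lborel. complex_of_real (\<bar>\<sigma>\<bar> ^ N) * H (\<sigma> *\<^sub>R \<omega>)) \<le> C * decay_const TYPE(real)" .
qed

lemma has_vector_derivative_of_quotient:
  fixes G :: "real \<Rightarrow> 'a::real_normed_vector"
  assumes "((\<lambda>h. (1 / h) *\<^sub>R (G (s + h) - G s)) \<longlongrightarrow> D) (at 0)"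
  shows "(G has_vector_derivative D) (at s)"
  unfolding has_vector_derivative_def has_derivative_at
proof
  show "bounded_linear (\<lambda>h. h *\<^sub>R D)" by (rule bounded_linear_scaleR_left)
  have "((\<lambda>h. norm ((1 / h) *\<^sub>R (G (s + h) - G s) - D)) \<longlongrightarrow> 0) (at 0)"
    using assms by (intro tendsto_norm_zero) (simp add: LIM_zero_iff)
  then show "(\<lambda>h. norm (G (s + h) - G s - h *\<^sub>R D) / norm h) \<midarrow>0\<rightarrow> 0"
  proof (rule Lim_transform_eventually)
    have "norm ((1 / h) *\<^sub>R (G (s + h) - G s) - D) = norm (G (s + h) - G s - h *\<^sub>R D) / norm h" if "h \<noteq> 0" for h
    proof -
      have "(1 / h) *\<^sub>R (G (s + h) - G s) - D = (1 / h) *\<^sub>R (G (s + h) - G s - h *\<^sub>R D)"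
        using that by (simp add: algebra_simps)
      then show ?thesis by simp
    qed
    then show "\<forall>\<^sub>F h in at 0. norm ((1 / h) *\<^sub>R (G (s + h) - G s) - D) = norm (G (s + h) - G s - h *\<^sub>R D) / norm h"
      by (auto simp: eventually_at_filter)
  qed
qed

text \<open>The difference quotient of the phase is at most |\<sigma>| in modulus for every step h,
  so the first moment of W dominates and the limit passes under the integral.\<close>

lemma has_vector_derivative_exp_integral:
  fixes W :: "real \<Rightarrow> complex"
  assumes W: "integrable lborel W" and W1: "integrable lborel (\<lambda>\<sigma>. complex_of_real \<sigma> * W \<sigma>)"
  shows "((\<lambda>s. LINT \<sigma>|lborel. iexp (\<sigma> * s) * W \<sigma>) has_vector_derivative
     (LINT \<sigma>|lborel. iexp (\<sigma> * s) * (\<i> * complex_of_real \<sigma> * W \<sigma>))) (at s)"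
proof -
  have [measurable]: "W \<in> borel_measurable borel" using borel_measurable_integrable[OF W] by simp
  let ?e = "\<lambda>\<sigma> s. iexp (\<sigma> * s)"
  let ?G = "\<lambda>s. LINT \<sigma>|lborel. ?e \<sigma> s * W \<sigma>"
  have i: "integrable lborel (\<lambda>\<sigma>. ?e \<sigma> s * W \<sigma>)" for s
    by (rule Bochner_Integration.integrable_bound[OF W]) (auto simp: norm_mult)
  let ?q = "\<lambda>h \<sigma>. (1 / h) *\<^sub>R (?e \<sigma> (s + h) - ?e \<sigma> s)"
  have quot: "(1 / h) *\<^sub>R (?G (s + h) - ?G s) = (LINT \<sigma>|lborel. ?q h \<sigma> * W \<sigma>)" for h
  proof -
    have "(1 / h) *\<^sub>R (?G (s + h) - ?G s) = (LINT \<sigma>|lborel. (1 / h) *\<^sub>R (?e \<sigma> (s + h) * W \<sigma> - ?e \<sigma> s * W \<sigma>))"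
      by (simp only: integral_scaleR_right Bochner_Integration.integral_diff[OF i i])
    then show ?thesis by (simp add: algebra_simps)
  qed
  have lim: "((\<lambda>h. (1 / h) *\<^sub>R (?G (s + h) - ?G s)) \<longlongrightarrow> (LINT \<sigma>|lborel. ?e \<sigma> s * (\<i> * complex_of_real \<sigma> * W \<sigma>))) (at 0)"
    unfolding tendsto_at_iff_sequentially
  proof (intro allI impI)
    fix X :: "nat \<Rightarrow> real" assume X: "\<forall>i. X i \<in> UNIV - {0}" "X \<longlonglongrightarrow> 0"
    have "(\<lambda>n. LINT \<sigma>|lborel. ?q (X n) \<sigma> * W \<sigma>) \<longlonglongrightarrow> (LINT \<sigma>|lborel. ?e \<sigma> s * (\<i> * complex_of_real \<sigma> * W \<sigma>))"
    proof (rule integral_dominated_convergence[where w="\<lambda>\<sigma>. norm (complex_of_real \<sigma> * W \<sigma>)"])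
      show "integrable lborel (\<lambda>\<sigma>. norm (complex_of_real \<sigma> * W \<sigma>))" using W1 by (rule integrable_norm)
      show "AE \<sigma> in lborel. (\<lambda>n. ?q (X n) \<sigma> * W \<sigma>) \<longlonglongrightarrow> ?e \<sigma> s * (\<i> * complex_of_real \<sigma> * W \<sigma>)"
      proof (rule AE_I2)
        fix \<sigma> :: real
        have "((\<lambda>h. ?e \<sigma> (s + h)) has_vector_derivative (\<i> * complex_of_real \<sigma> * ?e \<sigma> s)) (at 0)"
        proof -
          have "((\<lambda>z. exp (\<i> * (complex_of_real \<sigma> * (complex_of_real s + z)))) has_field_derivative
              (\<i> * complex_of_real \<sigma> * ?e \<sigma> s)) (at (complex_of_real 0))"
            by (auto intro!: derivative_eq_intros)
          from has_vector_derivative_real_field[OF this] show ?thesis by simp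
        qed
        from has_vector_derivative_quotient[OF this]
        have "((\<lambda>h. ?q h \<sigma>) \<longlongrightarrow> \<i> * complex_of_real \<sigma> * ?e \<sigma> s) (at 0)" by simp
        moreover have "filterlim X (at 0) sequentially"
          using X by (intro filterlim_atI) auto
        ultimately have "(\<lambda>n. ?q (X n) \<sigma>) \<longlonglongrightarrow> \<i> * complex_of_real \<sigma> * ?e \<sigma> s"
          by (rule filterlim_compose)
        then have "(\<lambda>n. ?q (X n) \<sigma> * W \<sigma>) \<longlonglongrightarrow> (\<i> * complex_of_real \<sigma> * ?e \<sigma> s) * W \<sigma>"
          by (intro tendsto_mult tendsto_const)
        then show "(\<lambda>n. ?q (X n) \<sigma> * W \<sigma>) \<longlonglongrightarrow> ?e \<sigma> s * (\<i> * complex_of_real \<sigma> * W \<sigma>)"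
          by (simp only: mult_ac)
      qed
      show "AE \<sigma> in lborel. norm (?q (X n) \<sigma> * W \<sigma>) \<le> norm (complex_of_real \<sigma> * W \<sigma>)" for n
      proof (rule AE_I2)
        fix \<sigma>
        have "norm (?e \<sigma> (s + X n) - ?e \<sigma> s) \<le> \<bar>\<sigma> * (s + X n) - \<sigma> * s\<bar>"
          by (rule norm_iexp_diff_le)
        also have "\<dots> = \<bar>X n\<bar> * \<bar>\<sigma>\<bar>" by (simp add: algebra_simps abs_mult)
        finally have "norm (?q (X n) \<sigma>) \<le> \<bar>\<sigma>\<bar>"
          using X(1) by (simp add: divide_le_eq mult.commute)
        then have "norm (?q (X n) \<sigma>) * norm (W \<sigma>) \<le> \<bar>\<sigma>\<bar> * norm (W \<sigma>)"
          by (rule mult_right_mono) simp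
        then show "norm (?q (X n) \<sigma> * W \<sigma>) \<le> norm (complex_of_real \<sigma> * W \<sigma>)"
          by (simp only: norm_mult norm_of_real)
      qed
    qed measurable
    then show "((\<lambda>h. (1 / h) *\<^sub>R (?G (s + h) - ?G s)) \<circ> X) \<longlonglongrightarrow> (LINT \<sigma>|lborel. ?e \<sigma> s * (\<i> * complex_of_real \<sigma> * W \<sigma>))"
      by (simp only: quot o_def)
  qed
  show ?thesis
    by (rule has_vector_derivative_of_quotient[OF lim])
qed

text \<open>\<open>k\<close> is the Radon transform of the derivative of \<open>f\<close> in direction \<open>\<omega>\<close>; inverting the Fourier
  transforms of both shows that it is the derivative of the Radon transform of \<open>f\<close>.\<close>

theorem ramp_filter_radon:
  fixes f :: "real ^ 2 \<Rightarrow> complex"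
  assumes f: "f \<in> schwartz" and \<omega>: "norm \<omega> = 1"
  shows "ramp_filter (radon f \<omega>) p = complex_of_real (1 / (8 * pi ^ 2)) *
    (LINT \<sigma>|lborel. iexp (\<sigma> * p) * (complex_of_real \<bar>\<sigma>\<bar> * fourier f (\<sigma> *\<^sub>R \<omega>)))"
proof -
  let ?D = "2 * DIM(real ^ 2)"
  let ?f' = "\<lambda>x. frechet_derivative f (at x) \<omega>"
  define N where "N = ?D + 3"
  \<comment> \<open>The directional derivative is a combination of two partial derivatives with
    coefficients of modulus at most 1, whence the factor 2.\<close>
  define C where "C = 2 * schwartz_norm N f"
  have fint: "integrable lborel f" using schwartz_integrable[OF f, of "[]"] by simp
  have fc: "continuous_on UNIV f" using schwartz_partial_continuous[OF f, of "[]"] by simp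
  have f'eq: "?f' x = (\<Sum>b\<in>Basis. (\<omega> \<bullet> b) *\<^sub>R iter_partial [b] f x)" for x
  proof -
    have l: "linear (frechet_derivative f (at x))"
      using schwartz_differentiable[OF f, of "[]" x] linear_frechet_derivative by auto
    have "?f' x = frechet_derivative f (at x) (\<Sum>b\<in>Basis. (\<omega> \<bullet> b) *\<^sub>R b)"
      by (simp add: euclidean_representation)
    also have "\<dots> = (\<Sum>b\<in>Basis. (\<omega> \<bullet> b) *\<^sub>R frechet_derivative f (at x) b)"
      using l by (simp add: linear_sum linear_cmul)
    finally show ?thesis by simp
  qed
  have f'c: "continuous_on UNIV ?f'"
    unfolding f'eq by (intro continuous_intros schwartz_partial_continuous[OF f]) auto
  have f'm[measurable]: "?f' \<in> borel_measurable borel" by (rule borel_measurable_continuous_onI[OF f'c])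
  have f'b: "(1 + norm x) ^ M * norm (?f' x) \<le> C" if "M \<le> N" for x M
  proof -
    have "norm (?f' x) \<le> (\<Sum>b\<in>(Basis::(real ^ 2) set). norm (iter_partial [b] f x))"
      unfolding f'eq
    proof (intro sum_norm_le)
      fix b :: "real ^ 2" assume "b \<in> Basis"
      then have "\<bar>\<omega> \<bullet> b\<bar> \<le> 1" using Basis_le_norm \<omega> by metis
      then show "norm ((\<omega> \<bullet> b) *\<^sub>R iter_partial [b] f x) \<le> norm (iter_partial [b] f x)"
        by (simp add: mult_left_le_one_le)
    qed
    then have "(1 + norm x) ^ M * norm (?f' x) \<le> (\<Sum>b\<in>(Basis::(real ^ 2) set). (1 + norm x) ^ M * norm (iter_partial [b] f x))"
      unfolding sum_distrib_left[symmetric] by (intro mult_left_mono) auto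
    also have "\<dots> \<le> (\<Sum>b\<in>(Basis::(real ^ 2) set). schwartz_norm N f)"
      using that by (intro sum_mono schwartz_norm_bound[OF f]) (auto simp: N_def)
    also have "\<dots> = C" by (simp add: C_def)
    finally show ?thesis .
  qed
  have f'int: "integrable lborel ?f'"
    by (rule integrable_of_decay(1)[OF f'm f'b]) (simp add: N_def)
  have fb: "(1 + norm x) ^ 2 * norm (f x) \<le> schwartz_norm N f" for x
    using schwartz_norm_bound[OF f, of "[]" N 2 x] by (simp add: N_def)
  define W where "W \<sigma> = fourier f (\<sigma> *\<^sub>R \<omega>)" for \<sigma>
  \<comment> \<open>Three powers: one for the weight |\<sigma>| and two for integrability along the
    line.\<close>
  obtain A where A: "\<And>\<xi>. (1 + norm \<xi>) ^ 3 * norm (fourier f \<xi>) \<le> A"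
    using fourier_decay[where n=3 and 'a="real ^ 2"] f by blast
  have fm: "fourier f \<in> borel_measurable borel" by (rule fourier_measurable[OF fint])
  have W1: "integrable lborel (\<lambda>\<sigma>. complex_of_real (\<bar>\<sigma>\<bar> ^ 1) * W \<sigma>)"
    unfolding W_def by (rule line_integrable(1)[OF fm \<omega>, of 1 A]) (use A in \<open>simp add: eval_nat_numeral\<close>)
  have W0: "integrable lborel W"
  proof -
    have "(1 + norm \<xi>) ^ (0 + 2) * norm (fourier f \<xi>) \<le> A" for \<xi>
    proof -
      have "(1 + norm \<xi>) ^ (0 + 2) * norm (fourier f \<xi>) \<le> (1 + norm \<xi>) ^ 3 * norm (fourier f \<xi>)"
        by (intro mult_right_mono power_increasing) auto
      then show ?thesis using A order_trans by blast
    qed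
    from line_integrable(1)[OF fm \<omega> this] show ?thesis unfolding W_def by simp
  qed
  have [measurable]: "W \<in> borel_measurable borel" using borel_measurable_integrable[OF W0] by simp
  have Ws: "integrable lborel (\<lambda>\<sigma>. complex_of_real \<sigma> * W \<sigma>)"
    by (rule Bochner_Integration.integrable_bound[OF W1]) (auto simp: norm_mult)
  have Wk: "integrable lborel (\<lambda>\<sigma>. \<i> * complex_of_real \<sigma> * W \<sigma>)"
    using integrable_mult_right[of "\<i>" lborel "\<lambda>\<sigma>. complex_of_real \<sigma> * W \<sigma>"] Ws by (simp add: mult.assoc)
  have Fg: "fourier (radon f \<omega>) = W"
    by (simp add: fun_eq_iff W_def fourier_radon[OF fint \<omega>])
  have Fk: "fourier (radon ?f' \<omega>) = (\<lambda>\<sigma>. \<i> * complex_of_real \<sigma> * W \<sigma>)"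
  proof
    fix \<sigma>
    have "fourier (radon ?f' \<omega>) \<sigma> = fourier ?f' (\<sigma> *\<^sub>R \<omega>)" by (rule fourier_radon[OF f'int \<omega>])
    also have "\<dots> = \<i> * complex_of_real ((\<sigma> *\<^sub>R \<omega>) \<bullet> \<omega>) * fourier f (\<sigma> *\<^sub>R \<omega>)"
      by (rule fourier_frechet_derivative[OF _ fint _ f'm f'b])
        (use schwartz_differentiable[OF f, of "[]"] \<omega> in \<open>auto simp: N_def\<close>)
    also have "\<dots> = \<i> * complex_of_real \<sigma> * W \<sigma>"
      using \<omega> by (simp add: W_def dot_square_norm)
    finally show "fourier (radon ?f' \<omega>) \<sigma> = \<i> * complex_of_real \<sigma> * W \<sigma>" .
  qed
  have inv: "radon F \<omega> s = complex_of_real (1 / (2 * pi)) * (LINT \<sigma>|lborel. iexp (\<sigma> * s) * V \<sigma>)"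
    if "integrable lborel F" "continuous_on UNIV F" "\<And>x. (1 + norm x) ^ 2 * norm (F x) \<le> B"
      "fourier (radon F \<omega>) = V" "integrable lborel V" for F V B s
  proof -
    have "poly_bounded (radon F \<omega>)"
      unfolding poly_bounded_def using radon_bounded[OF that(2,3) \<omega>]
      by (intro exI[of _ "B * decay_const TYPE(real)"] exI[of _ 0]) simp
    then have "radon F \<omega> s = inv_fourier (fourier (radon F \<omega>)) s"
      using radon_isCont[OF that(2,3) \<omega>] that
      by (intro fourier_inversion[symmetric] radon_integrable[OF that(1) \<omega>]) auto
    then show ?thesis
      unfolding that(4) by (simp add: inv_fourier_def mult.commute)
  qed
  have g: "radon f \<omega> = (\<lambda>s. complex_of_real (1 / (2 * pi)) * (LINT \<sigma>|lborel. iexp (\<sigma> * s) * W \<sigma>))"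
    by (rule ext, rule inv[OF fint fc fb Fg W0])
  have k: "radon ?f' \<omega> s = complex_of_real (1 / (2 * pi)) * (LINT \<sigma>|lborel. iexp (\<sigma> * s) * (\<i> * complex_of_real \<sigma> * W \<sigma>))" for s
    by (rule inv[OF f'int f'c f'b Fk Wk]) (simp add: N_def)
  have "vector_derivative (radon f \<omega>) (at s) = radon ?f' \<omega> s" for s
    unfolding k unfolding g
    by (intro vector_derivative_at has_vector_derivative_mult_right has_vector_derivative_exp_integral W0 Ws)
  then have "ramp_filter (radon f \<omega>) p = complex_of_real (1 / (4 * pi)) * hilbert (radon ?f' \<omega>) p"
    unfolding ramp_filter_def by simp
  also have "hilbert (radon ?f' \<omega>) p = (LINT \<sigma>|lborel. iexp (\<sigma> * p) *
      (- \<i> * complex_of_real (sgn \<sigma>) * (complex_of_real (1 / (2 * pi)) * (\<i> * complex_of_real \<sigma> * W \<sigma>))))"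
  proof (rule hilbert_fourier_integral)
    show "integrable lborel (radon ?f' \<omega>)" by (rule radon_integrable[OF f'int \<omega>])
    show "integrable lborel (\<lambda>\<sigma>. complex_of_real (1 / (2 * pi)) * (\<i> * complex_of_real \<sigma> * W \<sigma>))"
      using Wk by (intro integrable_mult_right)
    show "radon ?f' \<omega> s = (LINT \<sigma>|lborel. iexp (\<sigma> * s) * (complex_of_real (1 / (2 * pi)) * (\<i> * complex_of_real \<sigma> * W \<sigma>)))" for s
      unfolding k by (subst integral_mult_right_zero[symmetric]) (simp only: mult_ac)
  qed
  \<comment> \<open>The factor - \<i> sgn \<sigma> of the Hilbert transform and the factor \<i>
    \<sigma> of the derivative combine to |\<sigma>|. The constants 1 / (4 \<pi>) of the filter and
    1 / (2 \<pi>) of the inversion give 1 / (8 \<pi>^2).\<close>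
  also have "\<dots> = (LINT \<sigma>|lborel. complex_of_real (1 / (2 * pi)) * (iexp (\<sigma> * p) * (complex_of_real \<bar>\<sigma>\<bar> * W \<sigma>)))"
  proof (rule Bochner_Integration.integral_cong[OF refl])
    fix \<sigma> :: real
    have "complex_of_real (sgn \<sigma>) * complex_of_real \<sigma> = complex_of_real \<bar>\<sigma>\<bar>"
      by (simp add: abs_sgn[of \<sigma>] mult.commute flip: of_real_mult)
    moreover have "- \<i> * complex_of_real (sgn \<sigma>) * (complex_of_real (1 / (2 * pi)) * (\<i> * complex_of_real \<sigma> * W \<sigma>))
       = (- \<i> * \<i>) * (complex_of_real (1 / (2 * pi)) * ((complex_of_real (sgn \<sigma>) * complex_of_real \<sigma>) * W \<sigma>))"
      by (simp only: mult_ac)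
    ultimately have "- \<i> * complex_of_real (sgn \<sigma>) * (complex_of_real (1 / (2 * pi)) * (\<i> * complex_of_real \<sigma> * W \<sigma>))
       = complex_of_real (1 / (2 * pi)) * (complex_of_real \<bar>\<sigma>\<bar> * W \<sigma>)"
      by simp
    then show "iexp (\<sigma> * p) * (- \<i> * complex_of_real (sgn \<sigma>) * (complex_of_real (1 / (2 * pi)) * (\<i> * complex_of_real \<sigma> * W \<sigma>)))
       = complex_of_real (1 / (2 * pi)) * (iexp (\<sigma> * p) * (complex_of_real \<bar>\<sigma>\<bar> * W \<sigma>))"
      by (simp only: mult_ac)
  qed
  also have "\<dots> = complex_of_real (1 / (2 * pi)) * (LINT \<sigma>|lborel. iexp (\<sigma> * p) * (complex_of_real \<bar>\<sigma>\<bar> * W \<sigma>))"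
    by (rule integral_mult_right_zero)
  finally show ?thesis
    unfolding W_def by (simp add: power2_eq_square)
qed

section \<open>The Dirichlet kernel\<close>

text \<open>Bessel's inequality makes the squared coefficients summable, so they tend to 0. In this
  form the Riemann-Lebesgue lemma asks only for square integrability of q.\<close>

lemma bessel_tendsto_zero:
  fixes q :: "'a \<Rightarrow> real" and s :: "nat \<Rightarrow> 'a \<Rightarrow> real"
  assumes c: "c > 0" and q: "integrable M (\<lambda>x. q x * q x)"
    and qs: "\<And>k. integrable M (\<lambda>x. q x * s k x)"
    and ss: "\<And>j k. integrable M (\<lambda>x. s j x * s k x)"
    and orth: "\<And>j k. (LINT x|M. s j x * s k x) = (if j = k then c else 0)"
  shows "(\<lambda>k. LINT x|M. q x * s k x) \<longlonglongrightarrow> 0"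
proof -
  define a where "a k = (LINT x|M. q x * s k x)" for k
  have bound: "(\<Sum>k<n. (a k)\<^sup>2) \<le> c * (LINT x|M. q x * q x)" for n
  proof -
    let ?r = "\<lambda>x. \<Sum>k<n. a k * s k x"
    have i2: "integrable M (\<lambda>x. \<Sum>k<n. a k * (q x * s k x))"
      by (intro Bochner_Integration.integrable_sum integrable_mult_right qs)
    have i3: "integrable M (\<lambda>x. \<Sum>j<n. \<Sum>k<n. a j * a k * (s j x * s k x))"
      by (intro Bochner_Integration.integrable_sum integrable_mult_right ss)
    \<comment> \<open>The projection of q has coefficients a k / c; multiplying through by c keeps
      the expansion free of divisions.\<close>
    have eq: "(c * q x - ?r x)\<^sup>2 = c\<^sup>2 * (q x * q x) - 2 * c * (\<Sum>k<n. a k * (q x * s k x))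
        + (\<Sum>j<n. \<Sum>k<n. a j * a k * (s j x * s k x))" for x
    proof -
      have "?r x * ?r x = (\<Sum>j<n. \<Sum>k<n. a j * a k * (s j x * s k x))"
        by (simp add: sum_product mult_ac)
      moreover have "q x * ?r x = (\<Sum>k<n. a k * (q x * s k x))"
        by (simp add: sum_distrib_left mult_ac)
      moreover have "(c * q x - ?r x)\<^sup>2 = c\<^sup>2 * (q x * q x) - 2 * c * (q x * ?r x) + ?r x * ?r x"
        by (simp add: power2_eq_square algebra_simps)
      ultimately show ?thesis by simp
    qed
    have "0 \<le> (LINT x|M. (c * q x - ?r x)\<^sup>2)" by simp
    also have "\<dots> = c\<^sup>2 * (LINT x|M. q x * q x) - 2 * c * (\<Sum>k<n. a k * a k)
        + (\<Sum>j<n. \<Sum>k<n. a j * a k * (if j = k then c else 0))"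
    proof -
      have "(LINT x|M. (\<Sum>k<n. a k * (q x * s k x))) = (\<Sum>k<n. a k * a k)"
        by (subst Bochner_Integration.integral_sum) (auto simp: qs a_def)
      moreover have "(LINT x|M. (\<Sum>j<n. \<Sum>k<n. a j * a k * (s j x * s k x)))
          = (\<Sum>j<n. \<Sum>k<n. a j * a k * (if j = k then c else 0))"
        by (subst Bochner_Integration.integral_sum, intro Bochner_Integration.integrable_sum integrable_mult_right ss,
            intro sum.cong refl, subst Bochner_Integration.integral_sum, intro integrable_mult_right ss)
           (simp add: orth[symmetric])
      ultimately show ?thesis
        unfolding eq using q i2 i3 by simp
    qed
    also have "(\<Sum>j<n. \<Sum>k<n. a j * a k * (if j = k then c else 0)) = c * (\<Sum>k<n. a k * a k)"
      by (simp add: if_distrib[of "\<lambda>z. _ * z"] sum_distrib_left mult_ac cong: if_cong)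
    finally have "c * (\<Sum>k<n. a k * a k) \<le> c * (c * (LINT x|M. q x * q x))"
      by (simp add: power2_eq_square)
    then show ?thesis using c by (simp add: power2_eq_square)
  qed
  have "summable (\<lambda>k. (a k)\<^sup>2)"
  proof (rule bounded_imp_summable[where B="c * (LINT x|M. q x * q x)"])
    show "(\<Sum>k\<le>n. (a k)\<^sup>2) \<le> c * (LINT x|M. q x * q x)" for n
      using bound[of "Suc n"] by (simp only: lessThan_Suc_atMost)
  qed simp
  then have "(\<lambda>k. (a k)\<^sup>2) \<longlonglongrightarrow> 0" by (rule summable_LIMSEQ_zero)
  then have "(\<lambda>k. sqrt ((a k)\<^sup>2)) \<longlonglongrightarrow> sqrt 0" by (intro tendsto_intros)
  then have "a \<longlonglongrightarrow> 0" by (simp add: tendsto_rabs_zero_iff)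
  then show ?thesis by (simp add: a_def[abs_def])
qed

lemma integral_cos_int:
  assumes n: "n \<noteq> 0"
  shows "(LINT x|lborel. indicator {-pi..pi} x *\<^sub>R cos (real_of_int n * x)) = 0"
proof -
  have "(LINT x|lborel. indicator {-pi..pi} x *\<^sub>R cos (real_of_int n * x))
      = sin (real_of_int n * pi) / real_of_int n - sin (real_of_int n * (- pi)) / real_of_int n"
  proof (rule integral_FTC_Icc)
    show "((\<lambda>x. sin (real_of_int n * x) / real_of_int n) has_vector_derivative cos (real_of_int n * x)) (at x within {- pi..pi})" for x
      unfolding has_real_derivative_iff_has_vector_derivative[symmetric]
      using n by (auto intro!: derivative_eq_intros)
  qed (auto intro!: continuous_intros)
  also have "\<dots> = 0" using sin_int_times_real[of n] by (simp add: mult.commute sin_zero_iff_int2)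
  finally show ?thesis .
qed

lemma integrable_Icc_continuous:
  fixes g :: "real \<Rightarrow> 'b::euclidean_space"
  assumes "continuous_on UNIV g"
  shows "integrable lborel (\<lambda>x. indicator {a..b} x *\<^sub>R g x)"
  using borel_integrable_compact[of "{a..b}" g] continuous_on_subset[OF assms] by auto

text \<open>The product-to-sum formula yields the integer frequencies j - k and j + k + 1, of which
  the second is never 0.\<close>

lemma orthogonal_half_sines:
  "(LINT x|lborel. indicator {-pi..pi} x *\<^sub>R (sin ((real j + 1/2) * x) * sin ((real k + 1/2) * x))) = (if j = k then pi else 0)"
proof -
  have eq: "sin ((real j + 1/2) * x) * sin ((real k + 1/2) * x)
      = (1/2) * cos (real_of_int (int j - int k) * x) - (1/2) * cos (real_of_int (int j + int k + 1) * x)" for x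
    by (subst sin_times_sin) (simp add: algebra_simps diff_divide_distrib)
  have i: "integrable lborel (\<lambda>x. indicator {-pi..pi} x *\<^sub>R cos (real_of_int n * x))" for n
    by (intro integrable_Icc_continuous continuous_intros)
  have "(LINT x|lborel. indicator {-pi..pi} x *\<^sub>R (sin ((real j + 1/2) * x) * sin ((real k + 1/2) * x)))
     = (LINT x|lborel. (1/2) * (indicator {-pi..pi} x *\<^sub>R cos (real_of_int (int j - int k) * x))
         - (1/2) * (indicator {-pi..pi} x *\<^sub>R cos (real_of_int (int j + int k + 1) * x)))"
    unfolding eq by (intro Bochner_Integration.integral_cong refl) (simp add: algebra_simps)
  also have "\<dots> = (1/2) * (LINT x|lborel. indicator {-pi..pi} x *\<^sub>R cos (real_of_int (int j - int k) * x))
     - (1/2) * (LINT x|lborel. indicator {-pi..pi} x *\<^sub>R cos (real_of_int (int j + int k + 1) * x))"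
    by (subst Bochner_Integration.integral_diff) (intro integrable_mult_right i, intro integrable_mult_right i, simp only: integral_mult_right_zero)
  also have "\<dots> = (if j = k then pi else 0)"
    using integral_cos_int[of "int j + int k + 1"] integral_cos_int[of "int j - int k"] by auto
  finally show ?thesis .
qed

section \<open>The kernel and its convergence at Lipschitz points\<close>

text \<open>The sum of exp (\<i> k x) over |k| \<le> K in real form. Evaluated at 2 m \<theta> it is
  1 plus the symbols of the first K multipliers \<open>G m (Suc k)\<close>.\<close>

definition dirichlet :: "nat \<Rightarrow> real \<Rightarrow> real" where
  "dirichlet K x = 1 + 2 * (\<Sum>k<K. cos (real (Suc k) * x))"

lemma dirichlet_continuous: "continuous_on UNIV (dirichlet K)"
  unfolding dirichlet_def[abs_def] by (intro continuous_intros)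

text \<open>Multiplication by sin (x / 2) makes the cosine sum telescope. In product form the
  identity also holds at the zeros of the sine.\<close>

lemma dirichlet_mult_sin: "dirichlet K x * sin (x / 2) = sin ((real K + 1/2) * x)"
proof (induction K)
  case (Suc K)
  have "2 * cos (real (Suc K) * x) * sin (x / 2) = sin ((real (Suc K) + 1/2) * x) - sin ((real K + 1/2) * x)"
    by (subst sin_diff_sin) (simp add: algebra_simps add_divide_distrib)
  then show ?case using Suc by (simp add: dirichlet_def algebra_simps)
qed (simp add: dirichlet_def)

lemma integral_dirichlet: "(LINT x|lborel. indicator {-pi..pi} x *\<^sub>R dirichlet K x) = 2 * pi"
proof -
  have i: "integrable lborel (\<lambda>x. indicator {-pi..pi} x *\<^sub>R cos (real_of_int n * x))" for n
    by (intro integrable_Icc_continuous continuous_intros)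
  have i1: "integrable lborel (indicator {-pi..pi} :: real \<Rightarrow> real)"
    by (auto simp: integrable_indicator_iff emeasure_lborel_Icc_eq)
  have i2: "integrable lborel (\<lambda>x. \<Sum>k<K. 2 * (indicator {-pi..pi} x *\<^sub>R cos (real_of_int (int (Suc k)) * x)))"
    by (intro Bochner_Integration.integrable_sum integrable_mult_right i)
  have "(LINT x|lborel. indicator {-pi..pi} x *\<^sub>R dirichlet K x)
      = (LINT x|lborel. indicator {-pi..pi} x + (\<Sum>k<K. 2 * (indicator {-pi..pi} x *\<^sub>R cos (real_of_int (int (Suc k)) * x))))"
    by (intro Bochner_Integration.integral_cong refl) (simp add: dirichlet_def algebra_simps sum_distrib_left)
  also have "\<dots> = (LINT x|lborel. indicator {-pi..pi} x) + (\<Sum>k<K. 2 * (LINT x|lborel. indicator {-pi..pi} x *\<^sub>R cos (real_of_int (int (Suc k)) * x)))"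
    by (simp only: Bochner_Integration.integral_add[OF i1 i2] Bochner_Integration.integral_sum[OF integrable_mult_right[OF i]] integral_mult_right_zero)
  also have "\<dots> = 2 * pi"
    by (subst integral_cos_int) auto
  finally show ?thesis .
qed

text \<open>For 0 \<le> x \<le> \<pi> one has x^2 \<le> 12, so the Taylor remainder (x / 2)^3 / 6 is
  at most x / 4 and the sine is at least x / 4. The constant 1/8 is a convenient weakening.\<close>

lemma abs_sin_half_ge: "\<bar>x\<bar> / 8 \<le> \<bar>sin (x / 2)\<bar>" if x: "\<bar>x\<bar> \<le> pi"
proof -
  have *: "x / 8 \<le> sin (x / 2)" if "0 \<le> x" "x \<le> pi" for x
  proof -
    have "\<bar>sin (x / 2) - (\<Sum>m<3. sin_coeff m * (x / 2) ^ m)\<bar> \<le> inverse (fact 3) * \<bar>x / 2\<bar> ^ 3"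
      by (rule Maclaurin_sin_bound)
    then have "\<bar>sin (x / 2) - x / 2\<bar> \<le> (x / 2) ^ 3 / 6"
      using that by (simp add: eval_nat_numeral sin_coeff_def)
    moreover have "(x / 2) ^ 3 / 6 \<le> x / 4"
    proof -
      have "x \<le> 3.2" using that pi_approx by simp
      then have "x * x \<le> 3.2 * 3.2" using that by (intro mult_mono) auto
      then have "x * (x * x) \<le> x * 12" using that by (intro mult_left_mono) auto
      then show ?thesis by (simp add: power3_eq_cube)
    qed
    ultimately show ?thesis using that by linarith
  qed
  show ?thesis
    using *[of x] *[of "- x"] x by (cases "0 \<le> x") auto
qed

text \<open>The constant F 0 is reproduced exactly because the kernel has integral 2 \<pi>. What
  remains is q times a sine of half-integer frequency, where the Lipschitz bound at 0 cancels the
  zero of sin (x / 2); the coefficients of the bounded function q against an orthogonal system tend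
  to 0.\<close>

lemma dirichlet_tendsto_real:
  fixes F :: "real \<Rightarrow> real"
  assumes c: "continuous_on UNIV F" and C: "\<And>x. \<bar>F x - F 0\<bar> \<le> C * \<bar>x\<bar>"
  shows "(\<lambda>K. LINT x|lborel. indicator {-pi..pi} x *\<^sub>R (dirichlet K x * F x)) \<longlonglongrightarrow> 2 * pi * F 0"
proof -
  have [measurable]: "F \<in> borel_measurable borel" by (rule borel_measurable_continuous_onI[OF c])
  let ?I = "indicator {-pi..pi} :: real \<Rightarrow> real"
  \<comment> \<open>At x = 0 the numerator vanishes, so q 0 = 0 and the splitting of the integrand
    below holds there as well.\<close>
  define q where "q x = ?I x * ((F x - F 0) / sin (x / 2))" for x
  define s where "s k x = ?I x * sin ((real k + 1/2) * x)" for k x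
  have [measurable]: "q \<in> borel_measurable borel" "\<And>k. s k \<in> borel_measurable borel"
    unfolding q_def[abs_def] s_def[abs_def] by measurable
  have C0: "0 \<le> C" using order_trans[OF abs_ge_zero C[of 1]] by simp
  have q: "\<bar>q x\<bar> \<le> ?I x * (8 * C)" for x
  proof (cases "\<bar>x\<bar> \<le> pi \<and> x \<noteq> 0")
    case True
    then have s: "\<bar>x\<bar> / 8 \<le> \<bar>sin (x / 2)\<bar>" "0 < \<bar>x\<bar> / 8" using abs_sin_half_ge by auto
    have "\<bar>F x - F 0\<bar> / \<bar>sin (x / 2)\<bar> \<le> (C * \<bar>x\<bar>) / (\<bar>x\<bar> / 8)"
      using C s C0 by (intro frac_le) auto
    also have "\<dots> = 8 * C" using True by simp
    finally show ?thesis using True by (simp add: q_def indicator_def abs_divide)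
  qed (use C0 in \<open>auto simp: q_def indicator_def\<close>)
  have bnd: "integrable lborel u" if [measurable]: "u \<in> borel_measurable borel" and "\<And>x. \<bar>u x\<bar> \<le> ?I x * B" for u B
  proof (rule Bochner_Integration.integrable_bound)
    show "integrable lborel (\<lambda>x. ?I x * B)"
      by (intro integrable_mult_left) (auto simp: integrable_indicator_iff emeasure_lborel_Icc_eq)
    show "AE x in lborel. norm (u x) \<le> norm (?I x * B)"
      using that(2) by (intro AE_I2) (metis abs_ge_self order_trans real_norm_def)
  qed simp
  have s: "\<bar>s k x\<bar> \<le> 1" for k x by (simp add: s_def indicator_def)
  have "(\<lambda>k. LINT x|lborel. q x * s k x) \<longlonglongrightarrow> 0"
  proof (rule bessel_tendsto_zero[where c=pi])
    show "integrable lborel (\<lambda>x. q x * q x)"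
    proof (rule bnd[where B="8 * C * (8 * C)"])
      fix x show "\<bar>q x * q x\<bar> \<le> ?I x * (8 * C * (8 * C))"
      proof -
        have "\<bar>q x\<bar> * \<bar>q x\<bar> \<le> (?I x * (8 * C)) * (?I x * (8 * C))"
          using C0 by (intro mult_mono q) auto
        then show ?thesis by (cases "x \<in> {-pi..pi}") (simp_all add: abs_mult)
      qed
    qed simp
    show "integrable lborel (\<lambda>x. q x * s k x)" for k
    proof (rule bnd[where B="8 * C * 1"])
      fix x show "\<bar>q x * s k x\<bar> \<le> ?I x * (8 * C * 1)"
        using mult_mono[OF q s, of x k x] C0 by (simp add: abs_mult indicator_def)
    qed simp
    show "integrable lborel (\<lambda>x. s j x * s k x)" for j k
    proof (rule bnd[where B="1 * 1"])
      fix x show "\<bar>s j x * s k x\<bar> \<le> ?I x * (1 * 1)"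
        using mult_mono[OF s s, of k x j x] by (simp add: abs_mult) (auto simp: s_def indicator_def)
    qed simp
    show "(LINT x|lborel. s j x * s k x) = (if j = k then pi else 0)" for j k
      using orthogonal_half_sines[of j k]
      by (subst (asm) Bochner_Integration.integral_cong[OF refl, of lborel _ "\<lambda>x. s j x * s k x"])
         (auto simp: s_def indicator_def)
  qed simp
  moreover have "(LINT x|lborel. q x * s k x) + F 0 * (2 * pi) = (LINT x|lborel. indicator {-pi..pi} x *\<^sub>R (dirichlet k x * F x))" for k
  proof -
    have i: "integrable lborel (\<lambda>x. q x * s k x)"
    proof (rule bnd[where B="8 * C * 1"])
      fix x show "\<bar>q x * s k x\<bar> \<le> ?I x * (8 * C * 1)"
        using mult_mono[OF q s, of x k x] C0 by (simp add: abs_mult indicator_def)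
    qed simp
    have i2: "integrable lborel (\<lambda>x. F 0 * (indicator {-pi..pi} x *\<^sub>R dirichlet k x))"
      by (intro integrable_mult_right integrable_Icc_continuous dirichlet_continuous)
    have "indicator {-pi..pi} x *\<^sub>R (dirichlet k x * F x) = q x * s k x + F 0 * (indicator {-pi..pi} x *\<^sub>R dirichlet k x)" for x
    proof (cases "\<bar>x\<bar> \<le> pi \<and> x \<noteq> 0")
      case True
      then have "sin (x / 2) \<noteq> 0" using abs_sin_half_ge[of x] by auto
      then have "dirichlet k x * (F x - F 0) = (F x - F 0) / sin (x / 2) * sin ((real k + 1/2) * x)"
        using dirichlet_mult_sin[of k x, symmetric] by simp
      then show ?thesis using True by (simp add: q_def s_def indicator_def algebra_simps)
    qed (auto simp: q_def s_def indicator_def)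
    then have "(LINT x|lborel. indicator {-pi..pi} x *\<^sub>R (dirichlet k x * F x))
       = (LINT x|lborel. q x * s k x + F 0 * (indicator {-pi..pi} x *\<^sub>R dirichlet k x))"
      by (intro Bochner_Integration.integral_cong refl)
    also have "\<dots> = (LINT x|lborel. q x * s k x) + F 0 * (2 * pi)"
      by (simp only: Bochner_Integration.integral_add[OF i i2] integral_mult_right_zero integral_dirichlet)
    finally show ?thesis ..
  qed
  ultimately have "(\<lambda>k. LINT x|lborel. indicator {-pi..pi} x *\<^sub>R (dirichlet k x * F x)) \<longlonglongrightarrow> 0 + F 0 * (2 * pi)"
    using tendsto_add[OF _ tendsto_const[of "F 0 * (2 * pi)"]] by force
  then show ?thesis by (simp add: mult_ac)
qed

lemma dirichlet_tendsto:
  fixes F :: "real \<Rightarrow> complex"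
  assumes c: "continuous_on UNIV F" and C: "\<And>x. norm (F x - F 0) \<le> C * \<bar>x\<bar>"
  shows "(\<lambda>K. LINT x|lborel. indicator {-pi..pi} x *\<^sub>R (complex_of_real (dirichlet K x) * F x)) \<longlonglongrightarrow> complex_of_real (2 * pi) * F 0"
proof -
  have i: "integrable lborel (\<lambda>x. indicator {-pi..pi} x *\<^sub>R (complex_of_real (dirichlet K x) * F x))" for K
    by (intro integrable_Icc_continuous continuous_intros c dirichlet_continuous)
  have 1: "(\<lambda>K. LINT x|lborel. indicator {-pi..pi} x *\<^sub>R (dirichlet K x * Re (F x))) \<longlonglongrightarrow> 2 * pi * Re (F 0)"
    by (rule dirichlet_tendsto_real[where C=C])
      (auto intro!: continuous_intros c order_trans[OF _ C] simp: abs_Re_le_cmod simp flip: minus_complex.sel)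
  have 2: "(\<lambda>K. LINT x|lborel. indicator {-pi..pi} x *\<^sub>R (dirichlet K x * Im (F x))) \<longlonglongrightarrow> 2 * pi * Im (F 0)"
    by (rule dirichlet_tendsto_real[where C=C])
      (auto intro!: continuous_intros c order_trans[OF _ C] simp: abs_Im_le_cmod simp flip: minus_complex.sel)
  show ?thesis
    unfolding tendsto_complex_iff integral_Re[OF i, symmetric] integral_Im[OF i, symmetric]
    using 1 2 by simp
qed

section \<open>Localisation at m equally spaced nodes\<close>

text \<open>Intervals of length \<pi> / m around the nodes \<pi> j / m abut, so the increments of an
  antiderivative telescope to the increment over an interval of length \<pi> that starts at \<pi> /
  (2 m). Periodicity of the integrand makes this increment independent of the starting
  point.\<close>

lemma integral_periodic_split:
  fixes H :: "real \<Rightarrow> complex" and m :: nat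
  assumes c: "continuous_on UNIV H" and per: "\<And>x. H (x + pi) = H x" and m: "m \<ge> 1"
  shows "(LINT x|lborel. indicator {-pi/2..pi/2} x *\<^sub>R H x)
    = (\<Sum>j=1..m. LINT x|lborel. indicator {-pi/(2*m)..pi/(2*m)} x *\<^sub>R H (x + pi * j / m))"
proof -
  \<comment> \<open>The antiderivative is taken on a compact interval; this one is large enough to
    contain every endpoint used below.\<close>
  let ?R = "4 * pi"
  obtain A where A: "\<And>x. x \<in> {- ?R..?R} \<Longrightarrow> (A has_vector_derivative H x) (at x within {- ?R..?R})"
    using antiderivative_continuous[of "- ?R" ?R H] continuous_on_subset[OF c] by auto
  have FTC: "(LINT x|lborel. indicator {a..b} x *\<^sub>R H (x + d)) = A (b + d) - A (a + d)"
    if "a \<le> b" "- ?R \<le> a + d" "b + d \<le> ?R" for a b d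
  proof (rule integral_FTC_Icc[OF that(1), where F="\<lambda>x. A (x + d)"])
    fix x assume x: "a \<le> x" "x \<le> b"
    have "((\<lambda>x. x + d) has_vector_derivative 1) (at x within {a..b})"
      by (auto intro!: derivative_eq_intros)
    moreover have "(A has_vector_derivative H (x + d)) (at (x + d) within (\<lambda>x. x + d) ` {a..b})"
      by (rule has_vector_derivative_within_subset[OF A]) (use that x in auto)
    ultimately show "((\<lambda>x. A (x + d)) has_vector_derivative H (x + d)) (at x within {a..b})"
      using vector_diff_chain_within[of "\<lambda>x. x + d" 1 x "{a..b}" A "H (x + d)"] by (simp add: o_def)
  next
    show "continuous_on {a..b} (\<lambda>x. H (x + d))"
      by (rule continuous_on_compose2[OF c]) (auto intro!: continuous_intros)
  qed
  \<comment> \<open>Both A (\<pi> + x) and A x are compared with the increments from the left end of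
    the period, where the two integrands coincide after a shift by \<pi>.\<close>
  have shift: "A (pi + x) - A x = A (pi / 2) - A (- pi / 2)" if "0 \<le> x" "x \<le> pi" for x
  proof -
    have "A (pi + x) - A (pi / 2) = (LINT t|lborel. indicator {- pi/2..x} t *\<^sub>R H (t + pi))"
      using FTC[of "- pi/2" x pi] that by (simp add: add.commute)
    also have "\<dots> = (LINT t|lborel. indicator {- pi/2..x} t *\<^sub>R H (t + 0))"
      by (simp add: per)
    also have "\<dots> = A x - A (- pi / 2)"
      using that by (subst FTC) auto
    finally show ?thesis by (simp add: algebra_simps)
  qed
  let ?d = "pi / (2 * real m)"
  define B where "B j = A (real j * (pi / m) + ?d)" for j
  have m': "0 < real m" using m by simp
  have "(\<Sum>j=1..m. LINT x|lborel. indicator {-pi/(2*m)..pi/(2*m)} x *\<^sub>R H (x + pi * j / m)) = (\<Sum>j=1..m. B j - B (j - 1))"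
  proof (rule sum.cong[OF refl])
    fix j assume j: "j \<in> {1..m}"
    have jm: "0 \<le> pi * j / m" "pi * j / m \<le> pi" "0 \<le> ?d" "?d \<le> pi"
      using j m by (auto simp: divide_simps)
    have "(LINT x|lborel. indicator {-pi/(2*m)..pi/(2*m)} x *\<^sub>R H (x + pi * j / m)) = A (pi/(2*m) + pi * j / m) - A (-pi/(2*m) + pi * j / m)"
      by (intro FTC; use jm pi_gt_zero in linarith)
    also have "pi/(2*m) + pi * j / m = real j * (pi / m) + ?d" by simp
    also have "-pi/(2*m) + pi * j / m = real (j - 1) * (pi / m) + ?d"
      using j m' by (simp add: of_nat_diff field_simps)
    finally show "(LINT x|lborel. indicator {-pi/(2*m)..pi/(2*m)} x *\<^sub>R H (x + pi * j / m)) = B j - B (j - 1)"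
      unfolding B_def .
  qed
  also have "\<dots> = B m - B 0"
  proof -
    have "(\<Sum>j=1..n. B j - B (j - 1)) = B n - B 0" for n by (induction n) auto
    then show ?thesis .
  qed
  also have "\<dots> = A (pi + ?d) - A ?d" using m' by (simp add: B_def)
  also have "\<dots> = A (pi / 2) - A (- pi / 2)" using m' m by (intro shift) (auto simp: divide_simps)
  also have "\<dots> = (LINT x|lborel. indicator {-pi/2..pi/2} x *\<^sub>R H x)"
    using FTC[of "-pi/2" "pi/2" 0] by simp
  finally show ?thesis ..
qed

text \<open>In x the kernel has period \<pi> / m, so on each of the m cells it is a copy of the
  kernel on [-\<pi>, \<pi>] scaled by 2 m. A cell contributes (1 / (2 m)) * 2 \<pi> times the value
  of L at its node, which is the weight \<pi> / m.\<close>

theorem dirichlet_periodic_tendsto: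
  fixes L :: "real \<Rightarrow> complex"
  assumes C: "\<And>x y. norm (L x - L y) \<le> C * \<bar>x - y\<bar>" and per: "\<And>x. L (x + pi) = L x" and m: "m \<ge> 1"
  shows "(\<lambda>K. LINT x|lborel. indicator {-pi/2..pi/2} x *\<^sub>R (complex_of_real (dirichlet K (2 * real m * x)) * L x))
    \<longlonglongrightarrow> complex_of_real (pi / real m) * (\<Sum>j=1..m. L (pi * real j / real m))"
proof -
  have m': "0 < real m" using m by simp
  have C0: "0 \<le> C" using order_trans[OF norm_ge_zero C[of 1 0]] by simp
  have c: "continuous_on UNIV L"
  proof (rule lipschitz_on_continuous_on)
    show "C-lipschitz_on UNIV L" by (rule lipschitz_onI) (auto simp: dist_norm C C0)
  qed
  have dper: "dirichlet K (2 * real m * (x + pi * real j / real m)) = dirichlet K (2 * real m * x)" for K j x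
  proof -
    have "cos (real (Suc k) * (2 * real m * (x + pi * real j / real m))) = cos (real (Suc k) * (2 * real m * x))" for k
    proof -
      have "real (Suc k) * (2 * real m * (x + pi * real j / real m))
          = real (Suc k) * (2 * real m * x) + 2 * real_of_int (int (Suc k * j)) * pi"
        using m' by (simp add: field_simps)
      then show ?thesis using cos.plus_of_int[of "real (Suc k) * (2 * real m * x)" "int (Suc k * j)"]
        by (simp only: mult_ac of_real_eq_id id_apply)
    qed
    then show ?thesis by (simp only: dirichlet_def)
  qed
  let ?H = "\<lambda>K x. complex_of_real (dirichlet K (2 * real m * x)) * L x"
  have Hc: "continuous_on UNIV (?H K)" for K
    by (intro continuous_intros c continuous_on_compose2[OF dirichlet_continuous]) auto
  have Hper: "?H K (x + pi) = ?H K x" for K x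
    using dper[of K x m] m' per by simp
  have eq: "(LINT x|lborel. indicator {-pi/2..pi/2} x *\<^sub>R ?H K x)
      = (\<Sum>j=1..m. complex_of_real (1 / (2 * real m)) * (LINT x|lborel. indicator {-pi..pi} x *\<^sub>R
           (complex_of_real (dirichlet K x) * L (x / (2 * real m) + pi * real j / real m))))" for K
    unfolding integral_periodic_split[OF Hc Hper m]
  proof (rule sum.cong[OF refl])
    fix j :: nat
    have "(LINT x|lborel. indicator {-pi/(2*m)..pi/(2*m)} x *\<^sub>R ?H K (x + pi * j / m))
      = \<bar>1 / (2 * real m)\<bar> *\<^sub>R (LINT x|lborel. indicator {-pi/(2*m)..pi/(2*m)} (0 + (1 / (2 * real m)) * x) *\<^sub>R ?H K (0 + (1 / (2 * real m)) * x + pi * j / m))"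
      using m' by (intro lborel_integral_real_affine) auto
    also have "\<dots> = complex_of_real (1 / (2 * real m)) * (LINT x|lborel. indicator {-pi..pi} x *\<^sub>R
           (complex_of_real (dirichlet K x) * L (x / (2 * real m) + pi * real j / real m)))"
    proof -
      have "indicator {-pi/(2*m)..pi/(2*m)} (0 + (1 / (2 * real m)) * x) = (indicator {-pi..pi} x :: real)" for x
        using m' by (auto simp: indicator_def field_simps)
      moreover have "dirichlet K (2 * real m * (0 + (1 / (2 * real m)) * x + pi * j / m)) = dirichlet K x" for x
        unfolding dper using m' by simp
      ultimately show ?thesis using m' by (simp add: scaleR_conv_of_real)
    qed
    finally show "(LINT x|lborel. indicator {-pi/(2*m)..pi/(2*m)} x *\<^sub>R ?H K (x + pi * j / m)) = \<dots>" .
  qed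
  have "(\<lambda>K. LINT x|lborel. indicator {-pi/2..pi/2} x *\<^sub>R ?H K x)
      \<longlonglongrightarrow> (\<Sum>j=1..m. complex_of_real (1 / (2 * real m)) * (complex_of_real (2 * pi) * L (0 / (2 * real m) + pi * real j / real m)))"
    unfolding eq
  proof (intro tendsto_sum tendsto_mult tendsto_const dirichlet_tendsto)
    fix j
    show "continuous_on UNIV (\<lambda>x. L (x / (2 * real m) + pi * real j / real m))"
      by (rule continuous_on_compose2[OF c]) (use m' in \<open>auto intro!: continuous_intros\<close>)
    fix x
    show "norm (L (x / (2 * real m) + pi * real j / real m) - L (0 / (2 * real m) + pi * real j / real m)) \<le> (C / (2 * real m)) * \<bar>x\<bar>"
      using C[of "x / (2 * real m) + pi * real j / real m" "0 / (2 * real m) + pi * real j / real m"] m' by simp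
  qed
  also have "(\<Sum>j=1..m. complex_of_real (1 / (2 * real m)) * (complex_of_real (2 * pi) * L (0 / (2 * real m) + pi * real j / real m)))
     = complex_of_real (pi / real m) * (\<Sum>j=1..m. L (pi * real j / real m))"
    by (simp add: sum_distrib_left)
  finally show ?thesis .
qed

section \<open>Lines through the origin\<close>

lemma circle_point_component [simp]: "circle_point \<theta> $ 1 = cos \<theta>" "circle_point \<theta> $ 2 = sin \<theta>"
  by (simp_all add: circle_point_def)

lemma norm_circle_point [simp]: "norm (circle_point \<theta>) = 1"
  by (simp add: norm_eq_sqrt_inner inner_real2 power2_eq_square[symmetric])

lemma circle_point_add_pi [simp]: "circle_point (\<theta> + pi) = - circle_point \<theta>"
  by (simp add: vec_eq_iff forall_2)

lemma norm_circle_point_diff: "norm (circle_point x - circle_point y) \<le> \<bar>x - y\<bar>"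
proof -
  have "norm (circle_point x - circle_point y) = norm (exp (\<i> * complex_of_real x) - exp (\<i> * complex_of_real y))"
  proof -
    have "norm (circle_point x - circle_point y) = sqrt ((cos x - cos y)\<^sup>2 + (sin x - sin y)\<^sup>2)"
      by (simp add: norm_eq_sqrt_inner inner_real2 power2_eq_square)
    then show ?thesis by (simp add: cmod_def Re_exp Im_exp)
  qed
  then show ?thesis using norm_iexp_diff_le by simp
qed

section \<open>Integration over lines through the origin\<close>

text \<open>Both rays of the line are covered, with the Jacobian of polar coordinates as weight, so
  the angle matters only modulo \<pi>.\<close>

definition line_moment :: "(real ^ 2 \<Rightarrow> complex) \<Rightarrow> real \<Rightarrow> complex" where
  "line_moment h \<theta> = (LINT s|lborel. complex_of_real \<bar>s\<bar> * h (s *\<^sub>R circle_point \<theta>))"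

lemma line_moment_add_pi: "line_moment h (\<theta> + pi) = line_moment h \<theta>"
  unfolding line_moment_def by (subst lborel_integral_real_affine[of "-1" _ 0]) auto

text \<open>Polar coordinates without a change of variables in the plane: substituting \<open>y = x t\<close> in the
  inner of two iterated integrals parametrises the plane by the lines through the origin with slope
  \<open>t = tan \<theta>\<close>.\<close>

lemma integral_lines_slope:
  fixes h :: "real ^ 2 \<Rightarrow> complex"
  assumes h: "integrable lborel h"
  shows "(LINT x|lborel. h x) = (LINT t|lborel. inverse (1 + t\<^sup>2) *\<^sub>R line_moment h (arctan t))"
proof -
  let ?e = "axis 1 1 :: real ^ 2"
  have [measurable]: "h \<in> borel_measurable borel" using borel_measurable_integrable[OF h] by simp
  have e: "norm ?e = 1" by simp
  define H where "H x y = h (x *\<^sub>R ?e + y *\<^sub>R perp ?e)" for x y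
  \<comment> \<open>The factor |x| is the Jacobian of y = x t in the inner integral. The
    substitution fails on the line x = 0, which is a null set, so all comparisons of H and K are
    almost everywhere in x.\<close>
  define K where "K x t = \<bar>x\<bar> *\<^sub>R H x (x * t)" for x t
  have [measurable]: "case_prod H \<in> borel_measurable (borel \<Otimes>\<^sub>M borel)"
    unfolding H_def by measurable
  have [measurable]: "case_prod K \<in> borel_measurable (borel \<Otimes>\<^sub>M borel)"
    unfolding K_def H_def by measurable
  have HI: "integrable (lborel \<Otimes>\<^sub>M lborel) (case_prod H)"
    using plane_integrable[OF e h] by (simp add: H_def[abs_def])
  have nHI: "integrable (lborel \<Otimes>\<^sub>M lborel) (\<lambda>z. norm (case_prod H z))"
    using HI by (rule integrable_norm)
  have Kx: "(LINT y|lborel. H x y) = (LINT t|lborel. K x t)"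
    "(LINT y|lborel. norm (H x y)) = (LINT t|lborel. norm (K x t))"
    "integrable lborel (H x) \<Longrightarrow> integrable lborel (K x)" if "x \<noteq> 0" for x
    using that lborel_integral_real_affine[of x "H x" 0] lborel_integral_real_affine[of x "\<lambda>y. norm (H x y)" 0]
      lborel_integrable_real_affine[of "H x" x 0]
    by (auto simp: K_def[abs_def])
  have KI: "integrable (lborel \<Otimes>\<^sub>M lborel) (case_prod K)"
  proof (rule lborel_pair.Fubini_integrable)
    have "integrable lborel (\<lambda>x. LINT y|lborel. norm (H x y))"
      using lborel_pair.integrable_fst'[OF nHI] by simp
    then show "integrable lborel (\<lambda>x. LINT t|lborel. norm (case (x, t) of (x, t) \<Rightarrow> K x t))"
    proof (rule integrable_cong_AE_imp)
      show "AE x in lborel. (LINT y|lborel. norm (H x y)) = (LINT t|lborel. norm (case (x, t) of (x, t) \<Rightarrow> K x t))"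
        using AE_lborel_singleton[of 0] by eventually_elim (simp add: Kx)
    qed measurable
    show "AE x in lborel. integrable lborel (\<lambda>t. case (x, t) of (x, t) \<Rightarrow> K x t)"
      using lborel_pair.AE_integrable_fst'[OF HI] AE_lborel_singleton[of 0] by eventually_elim (simp add: Kx)
  qed measurable
  have inner: "(LINT x|lborel. K x t) = inverse (1 + t\<^sup>2) *\<^sub>R line_moment h (arctan t)" for t
  proof -
    \<comment> \<open>c is the length of (1, t), so (x, x t) is the point with parameter s = c x on
      the line of angle arctan t. One factor c comes from ds and one from |s|; together they are the
      1 + t^2 in the denominator.\<close>
    define c where "c = sqrt (1 + t\<^sup>2)"
    have c: "c > 0" "c\<^sup>2 = 1 + t\<^sup>2" by (auto simp: c_def add_pos_nonneg)
    have line: "x *\<^sub>R ?e + (x * t) *\<^sub>R perp ?e = (c * x) *\<^sub>R circle_point (arctan t)" for x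
      using c(1) by (simp add: vec_eq_iff forall_2 cos_arctan sin_arctan c_def[symmetric] axis_def)
    have "line_moment h (arctan t) = \<bar>c\<bar> *\<^sub>R (LINT x|lborel. complex_of_real \<bar>0 + c * x\<bar> * h ((0 + c * x) *\<^sub>R circle_point (arctan t)))"
      unfolding line_moment_def using c by (intro lborel_integral_real_affine) auto
    also have "\<dots> = c *\<^sub>R (LINT x|lborel. c *\<^sub>R K x t)"
    proof -
      have "complex_of_real \<bar>0 + c * x\<bar> * h ((0 + c * x) *\<^sub>R circle_point (arctan t)) = c *\<^sub>R K x t" for x
        using c(1) by (simp only: K_def H_def line abs_mult of_real_mult add_0 scaleR_conv_of_real[where 'a=complex] abs_of_pos mult.assoc)
      then show ?thesis using c(1) by simp
    qed
    also have "\<dots> = c\<^sup>2 *\<^sub>R (LINT x|lborel. K x t)"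
      by (simp add: power2_eq_square)
    finally show ?thesis using c by (simp add: add_nonneg_eq_0_iff)
  qed
  have "(LINT x|lborel. h x) = (LINT x|lborel. LINT y|lborel. H x y)"
    unfolding H_def by (rule plane_integral[OF e h])
  also have "\<dots> = (LINT x|lborel. LINT t|lborel. K x t)"
  proof (rule integral_cong_AE)
    show "AE x in lborel. (LINT y|lborel. H x y) = (LINT t|lborel. K x t)"
      using AE_lborel_singleton[of 0] by eventually_elim (simp add: Kx)
  qed measurable
  also have "\<dots> = (LINT t|lborel. LINT x|lborel. K x t)"
    by (rule lborel_pair.Fubini_integral[OF KI, symmetric])
  finally show ?thesis unfolding inner .
qed

text \<open>Here dt / (1 + t^2) is the differential of arctan t, and the bound B makes the integrand
  on the whole line integrable, as the substitution rule demands.\<close>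

lemma integral_arctan_substitution:
  fixes M :: "real \<Rightarrow> complex"
  assumes M: "continuous_on UNIV M" and B: "\<And>x. norm (M x) \<le> B"
  shows "(LINT t|lborel. inverse (1 + t\<^sup>2) *\<^sub>R M (arctan t)) = (LINT x|lborel. indicator {-pi/2..pi/2} x *\<^sub>R M x)"
proof -
  have [measurable]: "M \<in> borel_measurable borel" by (rule borel_measurable_continuous_onI[OF M])
  have Mc: "isCont M x" for x using M by (simp add: continuous_on_eq_continuous_at)
  have "(LBINT x=ereal (-pi/2)..ereal (pi/2). M x) = (LBINT t=-\<infinity>..\<infinity>. inverse (1 + t\<^sup>2) *\<^sub>R M (arctan t))"
  proof (rule interval_integral_substitution_integrable)
    show "DERIV arctan t :> inverse (1 + t\<^sup>2)" for t by (rule DERIV_arctan)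
    show "isCont M (arctan t)" for t by (rule Mc)
    show "isCont (\<lambda>t::real. inverse (1 + t\<^sup>2)) t" for t
      by (intro continuous_intros) (auto simp: add_nonneg_eq_0_iff)
    show "((ereal \<circ> arctan \<circ> real_of_ereal) \<longlongrightarrow> ereal (-pi/2)) (at_right (-\<infinity>))"
      using tendsto_arctan_at_bot by (simp add: ereal_tendsto_simps)
    show "((ereal \<circ> arctan \<circ> real_of_ereal) \<longlongrightarrow> ereal (pi/2)) (at_left \<infinity>)"
      using tendsto_arctan_at_top by (simp add: ereal_tendsto_simps)
    show "set_integrable lborel (einterval (-\<infinity>) \<infinity>) (\<lambda>t. inverse (1 + t\<^sup>2) *\<^sub>R M (arctan t))"
    proof -
      have "integrable lborel (\<lambda>t::real. inverse (1 + t\<^sup>2) * B)"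
        using integrable_inverse_1_plus_square by (intro integrable_mult_left) (simp add: set_integrable_def)
      then have "integrable lborel (\<lambda>t::real. inverse (1 + t\<^sup>2) *\<^sub>R M (arctan t))"
      proof (rule Bochner_Integration.integrable_bound)
        show "AE t in lborel. norm (inverse (1 + t\<^sup>2) *\<^sub>R M (arctan t)) \<le> norm (inverse (1 + t\<^sup>2) * B)"
        proof (rule AE_I2)
          fix t :: real
          have "norm (M (arctan t)) \<le> \<bar>B\<bar>" using B order_trans abs_ge_self by blast
          then show "norm (inverse (1 + t\<^sup>2) *\<^sub>R M (arctan t)) \<le> norm (inverse (1 + t\<^sup>2) * B)"
            by (simp add: abs_mult mult_left_mono)
        qed
      qed measurable
      then show ?thesis by (simp add: set_integrable_def)
    qed
    show "set_integrable lborel (einterval (ereal (-pi/2)) (ereal (pi/2))) M"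
    proof (rule set_integrable_subset)
      show "set_integrable lborel {-pi/2..pi/2} M"
        unfolding set_integrable_def by (rule integrable_Icc_continuous[OF M])
    qed (auto simp: einterval_def)
  qed auto
  moreover have "(LBINT x=ereal (-pi/2)..ereal (pi/2). M x) = (LINT x|lborel. indicator {-pi/2..pi/2} x *\<^sub>R M x)"
    by (subst interval_integral_Icc) (auto simp: set_lebesgue_integral_def)
  moreover have "(LBINT t=-\<infinity>..\<infinity>. inverse (1 + t\<^sup>2) *\<^sub>R M (arctan t)) = (LINT t|lborel. inverse (1 + t\<^sup>2) *\<^sub>R M (arctan t))"
    by (simp add: interval_lebesgue_integral_def set_lebesgue_integral_def)
  ultimately show ?thesis by simp
qed

theorem integral_lines:
  fixes h :: "real ^ 2 \<Rightarrow> complex"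
  assumes h: "integrable lborel h" and c: "continuous_on UNIV (line_moment h)" and B: "\<And>x. norm (line_moment h x) \<le> B"
  shows "(LINT x|lborel. h x) = (LINT x|lborel. indicator {-pi/2..pi/2} x *\<^sub>R line_moment h x)"
  using integral_lines_slope[OF h] integral_arctan_substitution[OF c B] by simp

section \<open>The polar angle on lines and the measurability of its even cosines\<close>

lemma polar_angle_decomp: "\<xi> = norm \<xi> *\<^sub>R circle_point (polar_angle \<xi>)"
proof (cases "\<xi> = 0")
  case False
  let ?z = "Complex (\<xi> $ 1) (\<xi> $ 2)"
  have n: "cmod ?z = norm \<xi>" by (simp add: cmod_def norm_eq_sqrt_inner inner_real2 power2_eq_square)
  have "?z = complex_of_real (norm \<xi>) * cis (polar_angle \<xi>)"
    using rcis_cmod_Arg[of ?z] by (simp add: n rcis_def polar_angle_def)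
  then have "\<xi> $ 1 = norm \<xi> * cos (polar_angle \<xi>)" "\<xi> $ 2 = norm \<xi> * sin (polar_angle \<xi>)"
    by (simp_all add: complex_eq_iff)
  then show ?thesis by (simp add: vec_eq_iff forall_2)
qed simp

lemma sgn_polar: "\<xi> \<noteq> 0 \<Longrightarrow> sgn \<xi> = circle_point (polar_angle \<xi>)"
  by (subst polar_angle_decomp) (simp add: sgn_div_norm)

text \<open>Since s may be negative, the angles a and b agree only modulo \<pi>. Squaring the unit
  vectors removes the sign, so cosines of even multiples are functions of the line.\<close>

lemma cos_even_multiple_eq:
  assumes "r *\<^sub>R circle_point a = s *\<^sub>R circle_point b" "s \<noteq> 0" "r \<ge> 0"
  shows "cos (2 * real n * a) = cos (2 * real n * b)"
proof -
  have "norm (r *\<^sub>R circle_point a) = norm (s *\<^sub>R circle_point b)" using assms(1) by simp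
  then have rs: "r = \<bar>s\<bar>" using assms(3) by simp
  have "complex_of_real r * cis a = complex_of_real s * cis b"
    using assms(1) by (simp add: vec_eq_iff forall_2 complex_eq_iff)
  then have "(complex_of_real r * cis a) ^ 2 = (complex_of_real s * cis b) ^ 2" by simp
  then have "complex_of_real (s\<^sup>2) * (cis a) ^ 2 = complex_of_real (s\<^sup>2) * (cis b) ^ 2"
    by (simp add: power_mult_distrib rs flip: of_real_power)
  then have "(cis a) ^ 2 = (cis b) ^ 2" using assms(2) by simp
  then have "(cis a ^ 2) ^ n = (cis b ^ 2) ^ n" by simp
  moreover have "cis (2 * real n * t) = (cis t ^ 2) ^ n" for t
    by (simp add: Complex.DeMoivre mult_ac)
  ultimately have "cis (2 * real n * a) = cis (2 * real n * b)" by simp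
  then show ?thesis by (simp add: complex_eq_iff)
qed

lemma cos_polar_angle:
  assumes "s \<noteq> 0"
  shows "cos (2 * real n * polar_angle (s *\<^sub>R circle_point \<theta>)) = cos (2 * real n * \<theta>)"
  by (rule cos_even_multiple_eq[where r="norm (s *\<^sub>R circle_point \<theta>)" and s=s])
    (use polar_angle_decomp[of "s *\<^sub>R circle_point \<theta>"] assms in auto)

text \<open>The branch cut of the argument is avoided by writing the cosine as the real part of (z /
  |z|) ^ (2 n). The origin is treated apart: there the argument is 0 by convention and the cosine is
  1.\<close>

lemma cos_polar_angle_measurable [measurable]: "(\<lambda>\<xi>. cos (2 * real n * polar_angle \<xi>)) \<in> borel_measurable borel"
proof -
  let ?z = "\<lambda>\<xi>::real ^ 2. (complex_of_real (\<xi> $ 1) + \<i> * complex_of_real (\<xi> $ 2)) / complex_of_real (norm \<xi>)"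
  have "cos (2 * real n * polar_angle \<xi>) = (if \<xi> = 0 then 1 else Re (?z \<xi> ^ (2 * n)))" for \<xi>
  proof (cases "\<xi> = 0")
    case True
    have "Complex 0 0 = 0" by (simp add: complex_eq_iff)
    then show ?thesis using True by (simp add: polar_angle_def Arg_zero)
  next
    case False
    let ?p = "polar_angle \<xi>"
    have "\<xi> $ 1 = norm \<xi> * cos ?p" "\<xi> $ 2 = norm \<xi> * sin ?p"
      using arg_cong[OF polar_angle_decomp[of \<xi>], of "\<lambda>v. v $ 1"] arg_cong[OF polar_angle_decomp[of \<xi>], of "\<lambda>v. v $ 2"] by auto
    then have "?z \<xi> = (complex_of_real (norm \<xi>) * cis ?p) / complex_of_real (norm \<xi>)"
      by (intro arg_cong2[where f="(/)"] refl) (simp add: complex_eq_iff)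
    also have "\<dots> = cis ?p" using False by simp
    finally have "?z \<xi> ^ (2 * n) = cis (2 * real n * ?p)" by (simp only: Complex.DeMoivre) simp
    then show ?thesis using False by simp
  qed
  moreover have "(\<lambda>\<xi>. if \<xi> = 0 then 1 else Re (?z \<xi> ^ (2 * n))) \<in> borel_measurable borel" by measurable
  ultimately show ?thesis by presburger
qed

text \<open>A chart of directions on the open half plane that faces x0: (\<xi> \<bullet> x0, \<xi>
  \<bullet> perp x0) are the coordinates in the rotated frame and the arctangent of their slope is
  the angle relative to \<theta>0. Unlike \<open>polar_angle\<close> it is continuous on the whole
  half plane.\<close>

lemma sgn_chart:
  assumes "x0 = circle_point \<theta>0" "\<xi> \<bullet> x0 > 0"
  shows "sgn \<xi> = circle_point (\<theta>0 + arctan ((\<xi> \<bullet> perp x0) / (\<xi> \<bullet> x0)))"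
proof -
  define a where "a = \<xi> \<bullet> x0"
  define v where "v = (\<xi> \<bullet> perp x0) / a"
  have a: "a > 0" using assms by (simp add: a_def)
  define r where "r = a * sqrt (1 + v\<^sup>2)"
  have r: "r > 0" using a by (auto simp: r_def add_pos_nonneg)
  have x0: "x0 $ 1 = cos \<theta>0" "x0 $ 2 = sin \<theta>0" by (simp_all add: assms(1))
  have cs: "cos \<theta>0 * cos \<theta>0 + sin \<theta>0 * sin \<theta>0 = 1"
    using sin_cos_squared_add3 .
  have av: "a * v = \<xi> \<bullet> perp x0" using a by (simp add: v_def)
  have sq: "sqrt (1 + v\<^sup>2) > 0" by (simp add: add_pos_nonneg)
  have c1: "\<xi> $ 1 = a * cos \<theta>0 - a * v * sin \<theta>0"
  proof -
    have "a * cos \<theta>0 - a * v * sin \<theta>0 = \<xi> $ 1 * (cos \<theta>0 * cos \<theta>0 + sin \<theta>0 * sin \<theta>0)"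
      unfolding av unfolding a_def inner_real2 x0 perp_component by algebra
    then show ?thesis by (simp only: cs mult_1_right)
  qed
  have c2: "\<xi> $ 2 = a * sin \<theta>0 + a * v * cos \<theta>0"
  proof -
    have "a * sin \<theta>0 + a * v * cos \<theta>0 = \<xi> $ 2 * (cos \<theta>0 * cos \<theta>0 + sin \<theta>0 * sin \<theta>0)"
      unfolding av unfolding a_def inner_real2 x0 perp_component by algebra
    then show ?thesis by (simp only: cs mult_1_right)
  qed
  have "\<xi> = r *\<^sub>R circle_point (\<theta>0 + arctan v)"
    using c1 c2 sq by (simp add: vec_eq_iff forall_2 cos_add sin_add cos_arctan sin_arctan r_def algebra_simps)
  then have "sgn \<xi> = sgn (r *\<^sub>R circle_point (\<theta>0 + arctan v))" by simp
  also have "\<dots> = circle_point (\<theta>0 + arctan v)" using r by (simp add: sgn_div_norm)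
  finally show ?thesis by (simp add: v_def a_def)
qed

text \<open>The assumption concerns \<psi> as a function of the angle, and the principal angle jumps
  across the negative axis. The chart centred at the direction of the point under consideration
  gives a continuous angle nearby.\<close>

lemma continuous_on_sgn_comp:
  fixes \<psi> :: "real ^ 2 \<Rightarrow> complex"
  assumes c: "continuous_on UNIV (\<lambda>\<theta>. \<psi> (circle_point \<theta>))"
  shows "continuous_on (- {0}) (\<lambda>\<xi>. \<psi> (sgn \<xi>))"
proof (rule continuous_at_imp_continuous_on, rule ballI)
  fix \<xi>0 :: "real ^ 2" assume "\<xi>0 \<in> - {0}"
  then have ne: "\<xi>0 \<noteq> 0" by simp
  define \<theta>0 where "\<theta>0 = polar_angle \<xi>0"
  define x0 where "x0 = circle_point \<theta>0"
  let ?S = "{\<xi>. 0 < \<xi> \<bullet> x0}"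
  have "\<xi>0 \<bullet> x0 = (norm \<xi>0 *\<^sub>R x0) \<bullet> x0"
    using polar_angle_decomp[of \<xi>0] by (simp add: x0_def \<theta>0_def)
  then have S0: "\<xi>0 \<in> ?S" using ne by (simp add: x0_def dot_square_norm)
  let ?g = "\<lambda>\<xi>. \<psi> (circle_point (\<theta>0 + arctan ((\<xi> \<bullet> perp x0) / (\<xi> \<bullet> x0))))"
  have cont: "isCont ?g \<xi>0"
  proof (rule isCont_o2[where g="\<lambda>\<theta>. \<psi> (circle_point \<theta>)"])
    show "isCont (\<lambda>\<xi>. \<theta>0 + arctan ((\<xi> \<bullet> perp x0) / (\<xi> \<bullet> x0))) \<xi>0"
      using S0 by (intro continuous_intros) auto
    show "isCont (\<lambda>\<theta>. \<psi> (circle_point \<theta>)) (\<theta>0 + arctan ((\<xi>0 \<bullet> perp x0) / (\<xi>0 \<bullet> x0)))"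
      using c by (simp add: continuous_on_eq_continuous_at)
  qed
  have ev: "\<forall>\<^sub>F \<xi> in nhds \<xi>0. ?g \<xi> = \<psi> (sgn \<xi>)"
  proof -
    have "open ?S" by (intro open_Collect_less continuous_intros)
    from eventually_nhds_in_open[OF this S0] show ?thesis
    proof eventually_elim
      case (elim \<xi>)
      then show ?case by (subst sgn_chart[of x0 \<theta>0 \<xi>]) (simp_all add: x0_def)
    qed
  qed
  show "isCont (\<lambda>\<xi>. \<psi> (sgn \<xi>)) \<xi>0"
    by (rule iffD1[OF isCont_cong[OF ev] cont])
qed

lemma periodic_bounded:
  fixes F :: "real \<Rightarrow> complex"
  assumes c: "continuous_on UNIV F" and per: "\<And>x. F (x + pi) = F x"
  obtains B where "\<And>x. norm (F x) \<le> B"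
proof -
  interpret periodic_fun_simple F pi by standard (rule per)
  have "compact (F ` {0..pi})"
    by (intro compact_continuous_image continuous_on_subset[OF c]) auto
  from compact_imp_bounded[OF this] obtain B where "\<forall>y\<in>F ` {0..pi}. norm y \<le> B"
    unfolding bounded_iff by blast
  then have B: "norm (F x) \<le> B" if "x \<in> {0..pi}" for x using that by blast
  have "norm (F x) \<le> B" for x
  proof -
    let ?n = "\<lfloor>x / pi\<rfloor>"
    have "of_int ?n \<le> x / pi" "x / pi < of_int ?n + 1" by linarith+
    then have "of_int ?n * pi \<le> x" "x < (of_int ?n + 1) * pi"
      by (simp_all only: pos_le_divide_eq[OF pi_gt_zero] pos_divide_less_eq[OF pi_gt_zero])
    then have "x - of_int ?n * pi \<in> {0..pi}" by (simp add: algebra_simps)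
    then have "norm (F (x - of_int ?n * pi)) \<le> B" by (rule B)
    then show ?thesis using minus_of_int[of x ?n] by simp
  qed
  then show ?thesis by (rule that)
qed

text \<open>Evenness gives \<psi> along the circle the period \<pi>, and its derivative inherits it.
  Both are continuous, hence bounded by compactness of one period, and the mean value inequality
  gives K.\<close>

lemma smooth_on_circle_Lipschitz:
  assumes s: "smooth_on_circle \<psi>" and e: "even_on_circle \<psi>"
  obtains B K where "\<And>\<theta>. norm (\<psi> (circle_point \<theta>)) \<le> B"
    "\<And>x y. norm (\<psi> (circle_point x) - \<psi> (circle_point y)) \<le> K * \<bar>x - y\<bar>"
    "continuous_on UNIV (\<lambda>\<theta>. \<psi> (circle_point \<theta>))"
proof -
  let ?P = "\<lambda>\<theta>. \<psi> (circle_point \<theta>)"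
  define D where "D \<theta> = frechet_derivative ?P (at \<theta>) 1" for \<theta>
  have per: "?P (\<theta> + pi) = ?P \<theta>" for \<theta>
    using e unfolding even_on_circle_def by simp
  have d0: "?P differentiable (at x)" for x
    using s[unfolded smooth_on_circle_def smooth_def, rule_format, of "[]" x] by simp
  have "D differentiable (at x)" for x
    using s[unfolded smooth_on_circle_def smooth_def, rule_format, of "[1]" x] by (simp add: D_def[abs_def])
  then have Dc: "continuous_on UNIV D"
    by (simp add: continuous_at_imp_continuous_on differentiable_imp_continuous_within)
  have Dv: "(?P has_vector_derivative D s) (at s)" for s
    using has_vector_derivative_along[of ?P 0 s 1] d0 by (simp add: D_def)
  have Dper: "D (s + pi) = D s" for s
  proof (rule vector_derivative_unique_at)
    show "(?P has_vector_derivative D s) (at s)" by (rule Dv)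
    have "((\<lambda>s. ?P (pi + s *\<^sub>R 1)) has_vector_derivative D (s + pi)) (at s)"
      using has_vector_derivative_along[of ?P pi s 1] d0 by (simp add: D_def add.commute)
    then show "(?P has_vector_derivative D (s + pi)) (at s)"
      using per by (simp add: add.commute[of pi])
  qed
  have Pc: "continuous_on UNIV ?P"
    using d0 by (simp add: continuous_at_imp_continuous_on differentiable_imp_continuous_within)
  obtain B where B: "\<And>x. norm (?P x) \<le> B" using periodic_bounded[OF Pc per] by blast
  obtain K where K: "\<And>x. norm (D x) \<le> K" using periodic_bounded[OF Dc Dper] by blast
  have lip: "norm (?P x - ?P y) \<le> K * norm (x - y)" for x y
  proof (rule differentiable_bound[where S=UNIV])
    show "(?P has_derivative (\<lambda>h. h *\<^sub>R D s)) (at s within UNIV)" for s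
      using Dv[of s] by (simp add: has_vector_derivative_def)
    show "onorm (\<lambda>h. h *\<^sub>R D s) \<le> K" for s
    proof (rule onorm_le)
      show "norm (h *\<^sub>R D s) \<le> K * norm h" for h
        using mult_right_mono[OF K[of s] norm_ge_zero[of h]] by (simp add: mult.commute)
    qed
  qed auto
  show ?thesis by (rule that[OF B lip[unfolded real_norm_def] Pc])
qed

section \<open>Tempered functionals and multipliers\<close>

lemma schwartz_norm_mono:
  fixes \<phi> :: "'a::euclidean_space \<Rightarrow> complex"
  assumes \<phi>: "\<phi> \<in> schwartz" and NM: "N \<le> M"
  shows "schwartz_norm N \<phi> \<le> schwartz_norm M \<phi>"
proof -
  let ?S = "\<lambda>N bs. SUP x. (1 + norm x) ^ N * norm (iter_partial bs \<phi> x)"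
  let ?L = "\<lambda>N. {bs. set bs \<subseteq> (Basis::'a set) \<and> length bs \<le> N}"
  have nonneg: "0 \<le> ?S N bs" if "set bs \<subseteq> Basis" for N bs
  proof -
    have "0 \<le> (1 + norm (0::'a)) ^ N * norm (iter_partial bs \<phi> 0)" by simp
    also have "\<dots> \<le> ?S N bs" by (rule cSUP_upper[OF UNIV_I schwartz_bdd_above[OF \<phi> that]])
    finally show ?thesis .
  qed
  have "(\<Sum>bs\<in>?L N. ?S N bs) \<le> (\<Sum>bs\<in>?L N. ?S M bs)"
  proof (rule sum_mono)
    fix bs assume "bs \<in> ?L N"
    then have "set bs \<subseteq> Basis" by simp
    then have "bdd_above (range (\<lambda>x. (1 + norm x) ^ M * norm (iter_partial bs \<phi> x)))"
      by (rule schwartz_bdd_above[OF \<phi>])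
    then show "?S N bs \<le> ?S M bs"
    proof (rule cSUP_mono[rotated])
      show "\<exists>m\<in>UNIV. (1 + norm x) ^ N * norm (iter_partial bs \<phi> x) \<le> (1 + norm m) ^ M * norm (iter_partial bs \<phi> m)" for x
        by (intro bexI[of _ x] mult_right_mono power_increasing NM) auto
    qed simp
  qed
  also have "\<dots> \<le> (\<Sum>bs\<in>?L M. ?S M bs)"
    using NM nonneg by (intro sum_mono2 finite_lists_length_le) auto
  finally show ?thesis unfolding schwartz_norm_def .
qed

section \<open>Functionals controlled by pointwise decay\<close>

text \<open>The bound A is an argument instead of being quantified, so that estimates linear in A
  can be stated. It holds at every point, not just almost everywhere, because functions will be
  restricted to lines.\<close>

definition rapid :: "nat \<Rightarrow> ('a::euclidean_space \<Rightarrow> complex) \<Rightarrow> real \<Rightarrow> bool" where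
  "rapid N u A \<longleftrightarrow> u \<in> borel_measurable borel \<and> (\<forall>x. (1 + norm x) ^ N * norm (u x) \<le> A)"

text \<open>Only weighted sup norms without derivatives enter, so not only \<open>\<phi>\<close> but also its Fourier
  transform may be inserted.\<close>

definition slowly_growing :: "'a::euclidean_space dist \<Rightarrow> bool" where
  "slowly_growing M \<longleftrightarrow> (\<exists>N K. 0 \<le> K \<and>
     (\<forall>u v A B a b. rapid N u A \<longrightarrow> rapid N v B \<longrightarrow> M (\<lambda>x. a * u x + b * v x) = a * M u + b * M v) \<and>
     (\<forall>u A. rapid N u A \<longrightarrow> norm (M u) \<le> K * A))"

lemma temperedI:
  assumes "\<And>\<phi> \<theta> a b. \<phi> \<in> schwartz \<Longrightarrow> \<theta> \<in> schwartz \<Longrightarrow> T (\<lambda>x. a * \<phi> x + b * \<theta> x) = a * T \<phi> + b * T \<theta>"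
    and "\<And>\<phi>. \<phi> \<in> schwartz \<Longrightarrow> norm (T \<phi>) \<le> C * schwartz_norm N \<phi>"
  shows "tempered T"
  unfolding tempered_def using assms by blast

lemma temperedE:
  assumes "tempered (T :: 'a::euclidean_space dist)"
  obtains C N where "C \<ge> 0" "\<And>\<phi>. \<phi> \<in> schwartz \<Longrightarrow> norm (T \<phi>) \<le> C * schwartz_norm N \<phi>"
proof -
  obtain C N where C: "\<And>\<phi>. \<phi> \<in> schwartz \<Longrightarrow> norm (T \<phi>) \<le> C * schwartz_norm N \<phi>"
    using assms unfolding tempered_def by blast
  have "norm (T \<phi>) \<le> \<bar>C\<bar> * schwartz_norm N \<phi>" if "\<phi> \<in> schwartz" for \<phi>
    using C[OF that] mult_right_mono[OF abs_ge_self schwartz_norm_nonneg[OF that]] order_trans by blast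
  then show ?thesis using that[of "\<bar>C\<bar>" N] by simp
qed

lemma tempered_lin:
  "tempered T \<Longrightarrow> \<phi> \<in> schwartz \<Longrightarrow> \<theta> \<in> schwartz \<Longrightarrow> T (\<lambda>x. a * \<phi> x + b * \<theta> x) = a * T \<phi> + b * T \<theta>"
  unfolding tempered_def by blast

text \<open>Agreement on \<open>schwartz\<close> carries over the bound. Linearity is a separate
  premise: it involves the value of T at a combination, where agreement with S is not
  assumed.\<close>

lemma tempered_cong:
  assumes S: "tempered S" and eq: "\<And>\<phi>. \<phi> \<in> schwartz \<Longrightarrow> T \<phi> = S \<phi>"
    and lin: "\<And>\<phi> \<theta> a b. \<phi> \<in> schwartz \<Longrightarrow> \<theta> \<in> schwartz \<Longrightarrow> T (\<lambda>x. a * \<phi> x + b * \<theta> x) = a * T \<phi> + b * T \<theta>"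
  shows "tempered T"
proof -
  obtain C N where "\<And>\<phi>. \<phi> \<in> schwartz \<Longrightarrow> norm (S \<phi>) \<le> C * schwartz_norm N \<phi>"
    using temperedE[OF S] by blast
  then show ?thesis using lin eq by (intro temperedI[where C=C and N=N]) auto
qed

lemma tempered_combination:
  fixes S T :: "'a::euclidean_space dist"
  assumes S: "tempered S" and T: "tempered T"
  shows "tempered (dist_add (dist_scale a S) (dist_scale b T))"
proof -
  obtain C1 N1 where 1: "C1 \<ge> 0" "\<And>\<phi>. \<phi> \<in> schwartz \<Longrightarrow> norm (S \<phi>) \<le> C1 * schwartz_norm N1 \<phi>"
    using temperedE[OF S] by blast
  obtain C2 N2 where 2: "C2 \<ge> 0" "\<And>\<phi>. \<phi> \<in> schwartz \<Longrightarrow> norm (T \<phi>) \<le> C2 * schwartz_norm N2 \<phi>"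
    using temperedE[OF T] by blast
  show ?thesis
  proof (rule temperedI)
    fix \<phi> \<theta> :: "'a \<Rightarrow> complex" and c d assume "\<phi> \<in> schwartz" "\<theta> \<in> schwartz"
    then show "dist_add (dist_scale a S) (dist_scale b T) (\<lambda>x. c * \<phi> x + d * \<theta> x)
      = c * dist_add (dist_scale a S) (dist_scale b T) \<phi> + d * dist_add (dist_scale a S) (dist_scale b T) \<theta>"
      by (simp add: dist_add_def dist_scale_def tempered_lin[OF S] tempered_lin[OF T] algebra_simps)
  next
    fix \<phi> :: "'a \<Rightarrow> complex" assume \<phi>: "\<phi> \<in> schwartz"
    have "norm (S \<phi>) \<le> C1 * schwartz_norm (max N1 N2) \<phi>"
      using 1(2)[OF \<phi>] mult_left_mono[OF schwartz_norm_mono[OF \<phi>, of N1 "max N1 N2"] 1(1)] by simp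
    moreover have "norm (T \<phi>) \<le> C2 * schwartz_norm (max N1 N2) \<phi>"
      using 2(2)[OF \<phi>] mult_left_mono[OF schwartz_norm_mono[OF \<phi>, of N2 "max N1 N2"] 2(1)] by simp
    ultimately have "norm a * norm (S \<phi>) + norm b * norm (T \<phi>)
        \<le> norm a * (C1 * schwartz_norm (max N1 N2) \<phi>) + norm b * (C2 * schwartz_norm (max N1 N2) \<phi>)"
      by (intro add_mono mult_left_mono) auto
    moreover have "norm (a * S \<phi> + b * T \<phi>) \<le> norm a * norm (S \<phi>) + norm b * norm (T \<phi>)"
      using norm_triangle_ineq[of "a * S \<phi>" "b * T \<phi>"] by (simp only: norm_mult)
    ultimately show "norm (dist_add (dist_scale a S) (dist_scale b T) \<phi>)
        \<le> (norm a * C1 + norm b * C2) * schwartz_norm (max N1 N2) \<phi>"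
      unfolding dist_add_def dist_scale_def by (simp add: algebra_simps)
  qed
qed

lemma schwartz_integrable': "\<phi> \<in> schwartz \<Longrightarrow> integrable lborel \<phi>"
  using schwartz_integrable[of \<phi> "[]"] by simp

lemma fourier_lin:
  fixes \<phi> \<theta> :: "'a::euclidean_space \<Rightarrow> complex"
  assumes "integrable lborel \<phi>" "integrable lborel \<theta>"
  shows "fourier (\<lambda>x. a * \<phi> x + b * \<theta> x) = (\<lambda>\<xi>. a * fourier \<phi> \<xi> + b * fourier \<theta> \<xi>)"
proof
  fix \<xi> :: 'a
  let ?e = "\<lambda>x. exp (- \<i> * complex_of_real (x \<bullet> \<xi>))"
  have i: "integrable lborel (\<lambda>x. ?e x * u x)" if "integrable lborel u" for u :: "'a \<Rightarrow> complex"
    by (rule Bochner_Integration.integrable_bound[OF that])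
       (use borel_measurable_integrable[OF that] in \<open>auto simp: norm_mult\<close>)
  have "fourier (\<lambda>x. a * \<phi> x + b * \<theta> x) \<xi> = (LINT x|lborel. a * (?e x * \<phi> x) + b * (?e x * \<theta> x))"
    unfolding fourier_def by (intro Bochner_Integration.integral_cong refl) (simp add: algebra_simps)
  also have "\<dots> = a * fourier \<phi> \<xi> + b * fourier \<theta> \<xi>"
    unfolding fourier_def
    by (simp only: Bochner_Integration.integral_add[OF integrable_mult_right[OF i[OF assms(1)]]
        integrable_mult_right[OF i[OF assms(2)]]] integral_mult_right_zero)
  finally show "fourier (\<lambda>x. a * \<phi> x + b * \<theta> x) \<xi> = a * fourier \<phi> \<xi> + b * fourier \<theta> \<xi>" .
qed

lemma inv_fourier_lin:
  fixes \<phi> \<theta> :: "'a::euclidean_space \<Rightarrow> complex"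
  assumes "integrable lborel \<phi>" "integrable lborel \<theta>"
  shows "inv_fourier (\<lambda>x. a * \<phi> x + b * \<theta> x) = (\<lambda>\<xi>. a * inv_fourier \<phi> \<xi> + b * inv_fourier \<theta> \<xi>)"
  by (rule ext) (simp add: inv_fourier_eq fourier_lin[OF assms] algebra_simps add_divide_distrib)

lemma rapid_schwartz: "\<phi> \<in> schwartz \<Longrightarrow> rapid N \<phi> (schwartz_norm N \<phi>)"
  unfolding rapid_def using schwartz_norm_bound[of \<phi> "[]" N N] schwartz_measurable[of \<phi>] by simp

text \<open>The inverse transform is the reflected transform times a factor of modulus at most 1, so
  one constant A serves both.\<close>

lemma rapid_fourier_uniform:
  "\<exists>A\<ge>0. \<forall>\<phi>\<in>schwartz. rapid N (fourier \<phi>) (A * schwartz_norm (N + 2 * DIM('a)) \<phi>)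
      \<and> rapid N (inv_fourier \<phi>) (A * schwartz_norm (N + 2 * DIM('a::euclidean_space)) (\<phi> :: 'a \<Rightarrow> complex))"
proof -
  obtain A where A: "A \<ge> 0" "\<And>\<phi> \<xi>. \<phi> \<in> schwartz \<Longrightarrow>
     (1 + norm \<xi>) ^ N * norm (fourier \<phi> (\<xi>::'a)) \<le> A * schwartz_norm (N + 2 * DIM('a)) \<phi>"
    using fourier_decay[of N, where 'a='a] by blast
  have "rapid N (fourier \<phi>) (A * schwartz_norm (N + 2 * DIM('a)) \<phi>)
      \<and> rapid N (inv_fourier \<phi>) (A * schwartz_norm (N + 2 * DIM('a)) \<phi>)" if \<phi>: "\<phi> \<in> schwartz" for \<phi> :: "'a \<Rightarrow> complex"
  proof
    have [measurable]: "fourier \<phi> \<in> borel_measurable borel" by (rule fourier_measurable[OF schwartz_integrable'[OF \<phi>]])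
    then show "rapid N (fourier \<phi>) (A * schwartz_norm (N + 2 * DIM('a)) \<phi>)"
      using A(2)[OF \<phi>] by (simp add: rapid_def)
    have "(1 + norm \<xi>) ^ N * norm (inv_fourier \<phi> \<xi>) \<le> A * schwartz_norm (N + 2 * DIM('a)) \<phi>" for \<xi>
    proof -
      have "norm (inv_fourier \<phi> \<xi>) \<le> norm (fourier \<phi> (- \<xi>))"
        unfolding inv_fourier_eq norm_mult by (intro mult_left_le_one_le norm_inv_fourier_factor_le norm_ge_zero)
      then have "(1 + norm \<xi>) ^ N * norm (inv_fourier \<phi> \<xi>) \<le> (1 + norm (- \<xi>)) ^ N * norm (fourier \<phi> (- \<xi>))"
        by (auto intro!: mult_left_mono)
      then show ?thesis using A(2)[OF \<phi>, of "- \<xi>"] by linarith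
    qed
    moreover have "inv_fourier \<phi> \<in> borel_measurable borel"
      unfolding inv_fourier_eq[abs_def] by measurable
    ultimately show "rapid N (inv_fourier \<phi>) (A * schwartz_norm (N + 2 * DIM('a)) \<phi>)"
      by (simp add: rapid_def)
  qed
  then show ?thesis using A(1) by blast
qed

lemma rapid_fourier:
  fixes \<phi> :: "'a::euclidean_space \<Rightarrow> complex"
  assumes "\<phi> \<in> schwartz"
  shows "\<exists>A. rapid N (fourier \<phi>) A" "\<exists>A. rapid N (inv_fourier \<phi>) A"
  using rapid_fourier_uniform[where 'a='a, of N] assms by blast+

lemma rapid_integrable:
  assumes "rapid (2 * DIM('a)) u A"
  shows "integrable lborel (u :: 'a::euclidean_space \<Rightarrow> complex)"
  by (rule integrable_of_decay(1)) (use assms in \<open>auto simp: rapid_def\<close>)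

lemma inv_fourier_fourier:
  assumes \<phi>: "\<phi> \<in> schwartz"
  shows "inv_fourier (fourier \<phi>) = (\<phi> :: 'a::euclidean_space \<Rightarrow> complex)"
proof
  fix x
  obtain A where "rapid (2 * DIM('a)) (fourier \<phi>) A" using rapid_fourier(1)[OF \<phi>] by blast
  then have "integrable lborel (fourier \<phi>)" by (rule rapid_integrable)
  moreover have "poly_bounded \<phi>"
    unfolding poly_bounded_def using schwartz_norm_bound[OF \<phi>, of "[]" 0 0]
    by (intro exI[of _ "schwartz_norm 0 \<phi>"] exI[of _ 0]) simp
  ultimately show "inv_fourier (fourier \<phi>) x = \<phi> x"
    using schwartz_integrable'[OF \<phi>] schwartz_isCont[OF \<phi>] by (intro fourier_inversion)
qed

text \<open>Transforming a test function costs \<open>2 * DIM('a)\<close> orders in the seminorm.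
  Since M sees the transform only through its weighted sup norm, the result is again bounded by a
  Schwartz seminorm.\<close>

lemma slowly_growing_tempered:
  fixes M :: "'a::euclidean_space dist"
  assumes M: "slowly_growing M"
  shows "tempered M" "tempered (fourier_dist M)" "tempered (inv_fourier_dist M)"
proof -
  obtain N K where K: "0 \<le> K" and lin: "\<And>u v A B a b. rapid N u A \<Longrightarrow> rapid N v B \<Longrightarrow> M (\<lambda>x. a * u x + b * v x) = a * M u + b * M v"
    and bnd: "\<And>u A. rapid N u A \<Longrightarrow> norm (M u) \<le> K * A"
    using M unfolding slowly_growing_def by blast
  obtain A where A: "A \<ge> 0" "\<And>\<phi> :: 'a \<Rightarrow> complex. \<phi> \<in> schwartz \<Longrightarrow> rapid N (fourier \<phi>) (A * schwartz_norm (N + 2 * DIM('a)) \<phi>)"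
    "\<And>\<phi> :: 'a \<Rightarrow> complex. \<phi> \<in> schwartz \<Longrightarrow> rapid N (inv_fourier \<phi>) (A * schwartz_norm (N + 2 * DIM('a)) \<phi>)"
    using rapid_fourier_uniform[where 'a='a, of N] by blast
  show "tempered M"
    by (rule temperedI[where C=K and N=N]) (auto intro!: lin bnd rapid_schwartz)
  show "tempered (fourier_dist M)"
  proof (rule temperedI[where C="K * A" and N="N + 2 * DIM('a)"])
    fix \<phi> \<theta> :: "'a \<Rightarrow> complex" and a b assume *: "\<phi> \<in> schwartz" "\<theta> \<in> schwartz"
    show "fourier_dist M (\<lambda>x. a * \<phi> x + b * \<theta> x) = a * fourier_dist M \<phi> + b * fourier_dist M \<theta>"
      unfolding fourier_dist_def by (subst fourier_lin) (auto intro!: lin A(2) schwartz_integrable' *)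
  next
    fix \<phi> :: "'a \<Rightarrow> complex" assume "\<phi> \<in> schwartz"
    from bnd[OF A(2)[OF this]] show "norm (fourier_dist M \<phi>) \<le> K * A * schwartz_norm (N + 2 * DIM('a)) \<phi>"
      by (simp add: fourier_dist_def mult.assoc)
  qed
  show "tempered (inv_fourier_dist M)"
  proof (rule temperedI[where C="K * A" and N="N + 2 * DIM('a)"])
    fix \<phi> \<theta> :: "'a \<Rightarrow> complex" and a b assume *: "\<phi> \<in> schwartz" "\<theta> \<in> schwartz"
    show "inv_fourier_dist M (\<lambda>x. a * \<phi> x + b * \<theta> x) = a * inv_fourier_dist M \<phi> + b * inv_fourier_dist M \<theta>"
      unfolding inv_fourier_dist_def by (subst inv_fourier_lin) (auto intro!: lin A(3) schwartz_integrable' *)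
  next
    fix \<phi> :: "'a \<Rightarrow> complex" assume "\<phi> \<in> schwartz"
    from bnd[OF A(3)[OF this]] show "norm (inv_fourier_dist M \<phi>) \<le> K * A * schwartz_norm (N + 2 * DIM('a)) \<phi>"
      by (simp add: inv_fourier_dist_def mult.assoc)
  qed
qed

text \<open>By duality the test function is transformed first and inverted afterwards, which is the
  order in which inversion is available for Schwartz functions.\<close>

lemma fourier_dist_inv_fourier_dist:
  fixes M :: "'a::euclidean_space dist"
  assumes M: "slowly_growing M"
  shows "fourier_dist (inv_fourier_dist M) =\<^sub>S M"
proof -
  have T: "tempered M" by (rule slowly_growing_tempered(1)[OF M])
  have eq: "fourier_dist (inv_fourier_dist M) \<phi> = M \<phi>" if "\<phi> \<in> schwartz" for \<phi>
    unfolding fourier_dist_def inv_fourier_dist_def inv_fourier_fourier[OF that] ..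
  moreover have "tempered (fourier_dist (inv_fourier_dist M))"
  proof (rule tempered_cong[OF T eq])
    fix \<phi> \<theta> :: "'a \<Rightarrow> complex" and a b assume *: "\<phi> \<in> schwartz" "\<theta> \<in> schwartz"
    have i: "integrable lborel (fourier \<phi>)" if \<phi>: "\<phi> \<in> schwartz" for \<phi> :: "'a \<Rightarrow> complex"
    proof -
      obtain A where "rapid (2 * DIM('a)) (fourier \<phi>) A" using rapid_fourier(1)[OF \<phi>] by blast
      then show ?thesis by (rule rapid_integrable)
    qed
    \<comment> \<open>Linearity is checked by carrying the combination itself through both
      transforms, which are linear on integrable functions.\<close>
    have "inv_fourier (fourier (\<lambda>x. a * \<phi> x + b * \<theta> x)) = (\<lambda>x. a * \<phi> x + b * \<theta> x)"
      using * by (simp add: fourier_lin schwartz_integrable' inv_fourier_lin i inv_fourier_fourier)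
    then show "fourier_dist (inv_fourier_dist M) (\<lambda>x. a * \<phi> x + b * \<theta> x)
        = a * fourier_dist (inv_fourier_dist M) \<phi> + b * fourier_dist (inv_fourier_dist M) \<theta>"
      using * by (simp add: eq) (simp add: fourier_dist_def inv_fourier_dist_def tempered_lin[OF T])
  qed
  ultimately show ?thesis using T by (simp add: tempered_eq_def)
qed

lemma poly_bounded_times_rapid:
  assumes g: "\<And>x. norm (g x) \<le> C * (1 + norm x) ^ N" and C: "0 \<le> C" and u: "rapid (N + M) u A"
  shows "(1 + norm x) ^ M * norm (g x * u x) \<le> C * A"
proof -
  have "(1 + norm x) ^ M * norm (g x * u x) \<le> (1 + norm x) ^ M * (C * (1 + norm x) ^ N * norm (u x))"
    unfolding norm_mult by (intro mult_left_mono mult_right_mono g) auto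
  also have "\<dots> = C * ((1 + norm x) ^ (N + M) * norm (u x))"
    by (simp add: power_add mult_ac)
  also have "\<dots> \<le> C * A"
    using u C by (intro mult_left_mono) (auto simp: rapid_def)
  finally show ?thesis .
qed

lemma poly_boundedE:
  assumes "poly_bounded g"
  obtains C N where "C \<ge> 0" "\<And>x. norm (g x) \<le> C * (1 + norm x) ^ N"
proof -
  obtain C N where C: "\<And>x. norm (g x) \<le> C * (1 + norm x) ^ N"
    using assms unfolding poly_bounded_def by blast
  moreover have "0 \<le> C" using order_trans[OF norm_ge_zero C[of 0]] by simp
  ultimately show ?thesis using that by blast
qed

section \<open>Functions and line measures as functionals\<close>

lemma slowly_growing_fun_dist:
  fixes g :: "'a::euclidean_space \<Rightarrow> complex"
  assumes [measurable]: "g \<in> borel_measurable borel" and g: "poly_bounded g"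
  shows "slowly_growing (fun_dist g)"
proof -
  obtain C N where C: "C \<ge> 0" "\<And>x. norm (g x) \<le> C * (1 + norm x) ^ N" using poly_boundedE[OF g] by blast
  let ?N = "N + 2 * DIM('a)"
  have b: "(1 + norm x) ^ (2 * DIM('a)) * norm (g x * u x) \<le> C * A" if "rapid ?N u A" for u A x
    by (rule poly_bounded_times_rapid[OF C(2,1) that])
  have m: "(\<lambda>x. g x * u x) \<in> borel_measurable borel" if "rapid ?N u A" for u A
  proof -
    have [measurable]: "u \<in> borel_measurable borel" using that by (simp add: rapid_def)
    show ?thesis by measurable
  qed
  have i: "integrable lborel (\<lambda>x. g x * u x)" if "rapid ?N u A" for u A
    by (rule integrable_of_decay(1)[OF m[OF that] b[OF that]])
  show ?thesis
    unfolding slowly_growing_def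
  proof (intro exI conjI allI impI)
    show "0 \<le> C * decay_const TYPE('a)" using C(1) decay_const_nonneg by (intro mult_nonneg_nonneg)
    fix u v :: "'a \<Rightarrow> complex" and A B a b assume *: "rapid ?N u A" "rapid ?N v B"
    have "fun_dist g (\<lambda>x. a * u x + b * v x) = (LINT x|lborel. a * (g x * u x) + b * (g x * v x))"
      unfolding fun_dist_def by (simp add: algebra_simps)
    also have "\<dots> = a * fun_dist g u + b * fun_dist g v"
      unfolding fun_dist_def using i[OF *(1)] i[OF *(2)]
      by (subst Bochner_Integration.integral_add) auto
    finally show "fun_dist g (\<lambda>x. a * u x + b * v x) = a * fun_dist g u + b * fun_dist g v" .
  next
    fix u :: "'a \<Rightarrow> complex" and A assume u: "rapid ?N u A"
    have "norm (fun_dist g u) \<le> (LINT x|lborel. norm (g x * u x))"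
      unfolding fun_dist_def by (rule integral_norm_bound)
    also have "\<dots> \<le> C * A * decay_const TYPE('a)"
      unfolding decay_const_def by (rule integrable_of_decay(2)[OF m[OF u] b[OF u]])
    finally show "norm (fun_dist g u) \<le> C * decay_const TYPE('a) * A" by (simp add: mult_ac)
  qed
qed

text \<open>The growth of g costs N powers of decay and integrability along the line two more. A
  line is a null set of the plane, so it is the pointwise nature of \<open>rapid\<close> that
  controls the restriction.\<close>

lemma slowly_growing_line:
  fixes g :: "real ^ 2 \<Rightarrow> complex"
  assumes [measurable]: "g \<in> borel_measurable borel" and g: "poly_bounded g" and \<omega>: "norm \<omega> = 1"
  shows "slowly_growing (dist_mult g (line_delta \<omega>))"
proof -
  obtain C N where C: "C \<ge> 0" "\<And>x. norm (g x) \<le> C * (1 + norm x) ^ N" using poly_boundedE[OF g] by blast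
  let ?N = "N + (0 + 2)"
  have b: "(1 + norm x) ^ (0 + 2) * norm (g x * u x) \<le> C * A" if "rapid ?N u A" for u A x
    by (rule poly_bounded_times_rapid[OF C(2,1) that])
  have m: "(\<lambda>x. g x * u x) \<in> borel_measurable borel" if "rapid ?N u A" for u A
  proof -
    have [measurable]: "u \<in> borel_measurable borel" using that by (simp add: rapid_def)
    show ?thesis by measurable
  qed
  have i: "integrable lborel (\<lambda>t. g (t *\<^sub>R \<omega>) * u (t *\<^sub>R \<omega>))" if "rapid ?N u A" for u A
    using line_integrable(1)[OF m[OF that] \<omega> b[OF that]] by simp
  show ?thesis
    unfolding slowly_growing_def
  proof (intro exI conjI allI impI)
    show "0 \<le> C * decay_const TYPE(real)" using C(1) decay_const_nonneg by (intro mult_nonneg_nonneg)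
    fix u v :: "real ^ 2 \<Rightarrow> complex" and A B a b assume *: "rapid ?N u A" "rapid ?N v B"
    have "dist_mult g (line_delta \<omega>) (\<lambda>x. a * u x + b * v x)
        = (LINT t|lborel. a * (g (t *\<^sub>R \<omega>) * u (t *\<^sub>R \<omega>)) + b * (g (t *\<^sub>R \<omega>) * v (t *\<^sub>R \<omega>)))"
      unfolding dist_mult_def line_delta_def by (simp add: algebra_simps)
    also have "\<dots> = a * dist_mult g (line_delta \<omega>) u + b * dist_mult g (line_delta \<omega>) v"
      unfolding dist_mult_def line_delta_def using i[OF *(1)] i[OF *(2)]
      by (subst Bochner_Integration.integral_add) auto
    finally show "dist_mult g (line_delta \<omega>) (\<lambda>x. a * u x + b * v x)
      = a * dist_mult g (line_delta \<omega>) u + b * dist_mult g (line_delta \<omega>) v" .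
  next
    fix u :: "real ^ 2 \<Rightarrow> complex" and A assume u: "rapid ?N u A"
    show "norm (dist_mult g (line_delta \<omega>) u) \<le> C * decay_const TYPE(real) * A"
      using line_integrable(2)[OF m[OF u] \<omega> b[OF u]] by (simp add: dist_mult_def line_delta_def mult_ac)
  qed
qed

lemma rapid_mono: "rapid N u A \<Longrightarrow> M \<le> N \<Longrightarrow> rapid M u A"
proof -
  assume u: "rapid N u A" and MN: "M \<le> N"
  have "(1 + norm x) ^ M * norm (u x) \<le> (1 + norm x) ^ N * norm (u x)" for x
    using MN by (intro mult_right_mono power_increasing) auto
  then show "rapid M u A" using u order_trans unfolding rapid_def by blast
qed

lemma slowly_growing_add:
  fixes S T :: "'a::euclidean_space dist"
  assumes S: "slowly_growing S" and T: "slowly_growing T"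
  shows "slowly_growing (dist_add S T)"
proof -
  obtain N1 K1 where 1: "0 \<le> K1" "\<And>u v A B a b. rapid N1 u A \<Longrightarrow> rapid N1 v B \<Longrightarrow> S (\<lambda>x. a * u x + b * v x) = a * S u + b * S v"
    "\<And>u A. rapid N1 u A \<Longrightarrow> norm (S u) \<le> K1 * A" using S unfolding slowly_growing_def by blast
  obtain N2 K2 where 2: "0 \<le> K2" "\<And>u v A B a b. rapid N2 u A \<Longrightarrow> rapid N2 v B \<Longrightarrow> T (\<lambda>x. a * u x + b * v x) = a * T u + b * T v"
    "\<And>u A. rapid N2 u A \<Longrightarrow> norm (T u) \<le> K2 * A" using T unfolding slowly_growing_def by blast
  let ?N = "max N1 N2"
  have r: "rapid N1 u A" "rapid N2 u A" if "rapid ?N u A" for u A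
    using that by (auto elim: rapid_mono)
  show ?thesis
    unfolding slowly_growing_def
  proof (intro exI[of _ ?N] exI[of _ "K1 + K2"] conjI allI impI)
    fix u v :: "'a \<Rightarrow> complex" and A B a b assume u: "rapid ?N u A" and v: "rapid ?N v B"
    show "dist_add S T (\<lambda>x. a * u x + b * v x) = a * dist_add S T u + b * dist_add S T v"
      unfolding dist_add_def 1(2)[OF r(1)[OF u] r(1)[OF v]] 2(2)[OF r(2)[OF u] r(2)[OF v]]
      by (simp add: algebra_simps)
  next
    fix u :: "'a \<Rightarrow> complex" and A assume u: "rapid ?N u A"
    have "norm (S u) \<le> K1 * A" "norm (T u) \<le> K2 * A" by (rule 1(3)[OF r(1)[OF u]], rule 2(3)[OF r(2)[OF u]])
    then show "norm (dist_add S T u) \<le> (K1 + K2) * A"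
      unfolding dist_add_def using norm_triangle_ineq[of "S u" "T u"] by (simp add: algebra_simps)
  qed (use 1 2 in auto)
qed

lemma slowly_growing_scale:
  fixes S :: "'a::euclidean_space dist"
  assumes S: "slowly_growing S"
  shows "slowly_growing (dist_scale c S)"
proof -
  obtain N K where 1: "0 \<le> K" "\<And>u v A B a b. rapid N u A \<Longrightarrow> rapid N v B \<Longrightarrow> S (\<lambda>x. a * u x + b * v x) = a * S u + b * S v"
    "\<And>u A. rapid N u A \<Longrightarrow> norm (S u) \<le> K * A" using S unfolding slowly_growing_def by blast
  show ?thesis
    unfolding slowly_growing_def
  proof (intro exI[of _ N] exI[of _ "norm c * K"] conjI allI impI)
    fix u v :: "'a \<Rightarrow> complex" and A B a b assume u: "rapid N u A" and v: "rapid N v B"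
    show "dist_scale c S (\<lambda>x. a * u x + b * v x) = a * dist_scale c S u + b * dist_scale c S v"
      unfolding dist_scale_def 1(2)[OF u v] by (simp add: algebra_simps)
  next
    fix u :: "'a \<Rightarrow> complex" and A assume "rapid N u A"
    then show "norm (dist_scale c S u) \<le> norm c * K * A"
      unfolding dist_scale_def norm_mult mult.assoc using 1(3) by (intro mult_left_mono) auto
  qed (use 1 in auto)
qed

lemma slowly_growing_sum:
  assumes "finite I" and "\<And>i. i \<in> I \<Longrightarrow> slowly_growing (T i)"
  shows "slowly_growing (dist_sum T I)"
  using assms
proof (induction I)
  case empty
  have "slowly_growing (\<lambda>\<phi>. 0)"
    unfolding slowly_growing_def by (intro exI[of _ 0] exI[of _ 0]) auto
  then show ?case by (simp add: dist_sum_def)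
next
  case (insert i I)
  have "dist_sum T (insert i I) = dist_add (T i) (dist_sum T I)"
    using insert.hyps by (simp add: dist_sum_def dist_add_def fun_eq_iff)
  then show ?case using insert by (simp add: slowly_growing_add)
qed

section \<open>The Fourier transform as a well-defined function\<close>

lemma is_fourier_fun_measurable: "is_fourier_fun u g \<Longrightarrow> g \<in> borel_measurable borel"
  unfolding is_fourier_fun_def by (intro borel_measurable_continuous_countable_exceptions[of "{0}"]) auto

text \<open>Away from the origin both functions are continuous and are recovered by testing against
  Gaussians; at the origin the normalisation decides. This justifies the definite description in
  \<open>fourier_fun\<close>.\<close>

lemma is_fourier_fun_unique:
  fixes u :: "'a::euclidean_space dist"
  assumes g: "is_fourier_fun u g" and h: "is_fourier_fun u h"
  shows "g = h"
proof
  fix y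
  show "g y = h y"
  proof (cases "y = 0")
    case False
    have "open (- {0 :: 'a})" by auto
    from continuous_on_eq_continuous_at[OF this] have c: "isCont g y" "isCont h y"
      using g h False by (auto simp: is_fourier_fun_def)
    have eq: "fun_dist g \<phi> = fun_dist h \<phi>" if "\<phi> \<in> schwartz" for \<phi>
      using g h that by (simp add: is_fourier_fun_def tempered_eq_def)
    show ?thesis
      by (rule fun_dist_unique[OF is_fourier_fun_measurable[OF g] _ c(1) is_fourier_fun_measurable[OF h] _ c(2) eq])
        (use g h in \<open>simp_all add: is_fourier_fun_def\<close>)
  qed (use g h in \<open>auto simp: is_fourier_fun_def\<close>)
qed

lemma fourier_fun_eq: "is_fourier_fun u g \<Longrightarrow> fourier_fun u = g"
  unfolding fourier_fun_def by (rule the_equality) (auto intro: is_fourier_fun_unique)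

lemma poly_bounded_combination:
  fixes g h :: "'a::real_normed_vector \<Rightarrow> complex"
  assumes "poly_bounded g" "poly_bounded h"
  shows "poly_bounded (\<lambda>x. a * g x + b * h x)"
proof -
  obtain C N where C: "C \<ge> 0" "\<And>x. norm (g x) \<le> C * (1 + norm x) ^ N" using poly_boundedE[OF assms(1)] by blast
  obtain D M where D: "D \<ge> 0" "\<And>x. norm (h x) \<le> D * (1 + norm x) ^ M" using poly_boundedE[OF assms(2)] by blast
  have "norm (a * g x + b * h x) \<le> (norm a * C + norm b * D) * (1 + norm x) ^ (N + M)" for x
  proof -
    have "C * (1 + norm x) ^ N \<le> C * (1 + norm x) ^ (N + M)" "D * (1 + norm x) ^ M \<le> D * (1 + norm x) ^ (N + M)"
      using C(1) D(1) by (auto intro!: mult_left_mono power_increasing)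
    then have "norm (g x) \<le> C * (1 + norm x) ^ (N + M)" "norm (h x) \<le> D * (1 + norm x) ^ (N + M)"
      using C(2)[of x] D(2)[of x] by linarith+
    then have "norm a * norm (g x) + norm b * norm (h x)
        \<le> norm a * (C * (1 + norm x) ^ (N + M)) + norm b * (D * (1 + norm x) ^ (N + M))"
      by (intro add_mono mult_left_mono) auto
    moreover have "norm (a * g x + b * h x) \<le> norm a * norm (g x) + norm b * norm (h x)"
      using norm_triangle_ineq[of "a * g x" "b * h x"] by (simp only: norm_mult)
    ultimately show ?thesis by (simp add: algebra_simps)
  qed
  then show ?thesis unfolding poly_bounded_def by blast
qed

lemma poly_bounded_norm_mult:
  fixes g :: "'a::real_normed_vector \<Rightarrow> complex"
  assumes "poly_bounded g"
  shows "poly_bounded (\<lambda>x. complex_of_real (norm x) * g x)"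
proof -
  obtain C N where C: "C \<ge> 0" "\<And>x. norm (g x) \<le> C * (1 + norm x) ^ N" using poly_boundedE[OF assms] by blast
  have "norm (complex_of_real (norm x) * g x) \<le> C * (1 + norm x) ^ Suc N" for x
  proof -
    have "norm x * norm (g x) \<le> (1 + norm x) * (C * (1 + norm x) ^ N)"
      using C by (intro mult_mono) auto
    then show ?thesis by (simp add: norm_mult mult_ac)
  qed
  then show ?thesis unfolding poly_bounded_def by blast
qed

lemma fun_dist_combination:
  fixes g h :: "'a::euclidean_space \<Rightarrow> complex"
  assumes "g \<in> borel_measurable borel" "poly_bounded g" "h \<in> borel_measurable borel" "poly_bounded h" and \<phi>: "\<phi> \<in> schwartz"
  shows "fun_dist (\<lambda>x. a * g x + b * h x) \<phi> = a * fun_dist g \<phi> + b * fun_dist h \<phi>"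
proof -
  have i: "integrable lborel (\<lambda>x. g x * \<phi> x)" if [measurable]: "g \<in> borel_measurable borel" and g: "poly_bounded g" for g :: "'a \<Rightarrow> complex"
  proof -
    obtain C N where C: "C \<ge> 0" "\<And>x. norm (g x) \<le> C * (1 + norm x) ^ N" using poly_boundedE[OF g] by blast
    show ?thesis
    proof (rule integrable_of_decay(1))
      show "(\<lambda>x. g x * \<phi> x) \<in> borel_measurable borel" using schwartz_measurable[OF \<phi>] by measurable
      show "(1 + norm x) ^ (2 * DIM('a)) * norm (g x * \<phi> x) \<le> C * schwartz_norm (N + 2 * DIM('a)) \<phi>" for x
        by (rule poly_bounded_times_rapid[OF C(2,1) rapid_schwartz[OF \<phi>]])
    qed
  qed
  have "fun_dist (\<lambda>x. a * g x + b * h x) \<phi> = (LINT x|lborel. a * (g x * \<phi> x) + b * (h x * \<phi> x))"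
    unfolding fun_dist_def by (simp add: algebra_simps)
  also have "\<dots> = a * fun_dist g \<phi> + b * fun_dist h \<phi>"
    unfolding fun_dist_def using i[OF assms(1,2)] i[OF assms(3,4)]
    by (subst Bochner_Integration.integral_add) auto
  finally show ?thesis .
qed

lemma is_fourier_fun_combination:
  assumes u: "is_fourier_fun u g" and v: "is_fourier_fun v h"
  shows "is_fourier_fun (dist_add (dist_scale a u) (dist_scale b v)) (\<lambda>x. a * g x + b * h x)"
proof -
  let ?w = "dist_add (dist_scale a u) (dist_scale b v)"
  have F: "fourier_dist ?w = dist_add (dist_scale a (fourier_dist u)) (dist_scale b (fourier_dist v))"
    by (simp add: fun_eq_iff fourier_dist_def dist_add_def dist_scale_def)
  note defs = u[unfolded is_fourier_fun_def tempered_eq_def] v[unfolded is_fourier_fun_def tempered_eq_def]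
  have pb: "poly_bounded (\<lambda>x. a * g x + b * h x)" using defs by (intro poly_bounded_combination) auto
  have [measurable]: "g \<in> borel_measurable borel" "h \<in> borel_measurable borel"
    using is_fourier_fun_measurable u v by auto
  have "tempered (fourier_dist ?w)"
    unfolding F using defs by (intro tempered_combination) auto
  moreover have "tempered (fun_dist (\<lambda>x. a * g x + b * h x))"
    by (intro slowly_growing_tempered(1) slowly_growing_fun_dist pb) measurable
  moreover have "fourier_dist ?w \<phi> = fun_dist (\<lambda>x. a * g x + b * h x) \<phi>" if "\<phi> \<in> schwartz" for \<phi>
  proof -
    have "fourier_dist ?w \<phi> = a * fourier_dist u \<phi> + b * fourier_dist v \<phi>"
      by (simp add: fourier_dist_def dist_add_def dist_scale_def)
    then show ?thesis using defs that fun_dist_combination[of g h \<phi> a b] by simp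
  qed
  moreover have "continuous_on (- {0}) (\<lambda>x. a * g x + b * h x)"
    using defs by (intro continuous_intros) auto
  ultimately show ?thesis using pb defs by (simp add: is_fourier_fun_def tempered_eq_def)
qed

section \<open>The multiplier supported on the m lines\<close>

lemma line_symbol_mult:
  "dist_mult g (line_symbol m) = dist_scale (complex_of_real (pi / real m))
     (dist_sum (\<lambda>j. dist_mult (\<lambda>x. complex_of_real (norm x) * g x) (line_delta (dir m j))) {1..m})"
  by (simp add: fun_eq_iff line_symbol_def dist_mult_def dist_scale_def dist_sum_def mult.assoc)

lemma norm_dir [simp]: "norm (dir m j) = 1"
  by (simp add: dir_def norm_eq_sqrt_inner inner_real2 circle_point_def power2_eq_square[symmetric])

lemma slowly_growing_line_symbol:
  assumes [measurable]: "g \<in> borel_measurable borel" and g: "poly_bounded g"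
  shows "slowly_growing (dist_mult g (line_symbol m))"
  unfolding line_symbol_mult
  by (intro slowly_growing_scale slowly_growing_sum slowly_growing_line poly_bounded_norm_mult g) auto

text \<open>Linearity in the factor g rather than in the test function, as needed for an operator
  acting on distributions through their transforms. The argument u will be an inverse transform and
  is therefore described by its decay to every order.\<close>

lemma line_symbol_combination:
  assumes "g \<in> borel_measurable borel" "poly_bounded g" "h \<in> borel_measurable borel" "poly_bounded h"
    and u: "\<And>N. \<exists>A. rapid N u A"
  shows "dist_mult (\<lambda>x. a * g x + b * h x) (line_symbol m) u
    = a * dist_mult g (line_symbol m) u + b * dist_mult h (line_symbol m) u"
proof -
  have i: "integrable lborel (\<lambda>t. complex_of_real (norm (t *\<^sub>R dir m j)) * (g (t *\<^sub>R dir m j) * u (t *\<^sub>R dir m j)))"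
    if [measurable]: "g \<in> borel_measurable borel" and g: "poly_bounded g" for g :: "real ^ 2 \<Rightarrow> complex" and j
  proof -
    obtain C N where C: "C \<ge> 0" "\<And>x. norm (g x) \<le> C * (1 + norm x) ^ N" using poly_boundedE[OF g] by blast
    obtain A where A: "rapid (N + (1 + 2)) u A" using u by blast
    have [measurable]: "u \<in> borel_measurable borel" using A by (simp add: rapid_def)
    have m: "(\<lambda>x. g x * u x) \<in> borel_measurable borel" by measurable
    show ?thesis
      using line_integrable(1)[OF m norm_dir poly_bounded_times_rapid[OF C(2,1) A], of m j] by simp
  qed
  have "(LINT t|lborel. complex_of_real (norm (t *\<^sub>R dir m j)) * ((a * g (t *\<^sub>R dir m j) + b * h (t *\<^sub>R dir m j)) * u (t *\<^sub>R dir m j)))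
    = a * (LINT t|lborel. complex_of_real (norm (t *\<^sub>R dir m j)) * (g (t *\<^sub>R dir m j) * u (t *\<^sub>R dir m j)))
    + b * (LINT t|lborel. complex_of_real (norm (t *\<^sub>R dir m j)) * (h (t *\<^sub>R dir m j) * u (t *\<^sub>R dir m j)))" for j
  proof -
    let ?I = "\<lambda>g t. complex_of_real (norm (t *\<^sub>R dir m j)) * (g (t *\<^sub>R dir m j) * u (t *\<^sub>R dir m j))"
    have "(LINT t|lborel. complex_of_real (norm (t *\<^sub>R dir m j)) * ((a * g (t *\<^sub>R dir m j) + b * h (t *\<^sub>R dir m j)) * u (t *\<^sub>R dir m j)))
      = (LINT t|lborel. a * ?I g t + b * ?I h t)"
      by (intro Bochner_Integration.integral_cong refl) (simp add: algebra_simps del: norm_scaleR)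
    also have "\<dots> = a * (LINT t|lborel. ?I g t) + b * (LINT t|lborel. ?I h t)"
      by (simp only: Bochner_Integration.integral_add[OF integrable_mult_right[OF i[OF assms(1,2)]]
          integrable_mult_right[OF i[OF assms(3,4)]]] integral_mult_right_zero)
    finally show ?thesis .
  qed
  then show ?thesis
    by (simp add: line_symbol_def dist_mult_def dist_scale_def dist_sum_def line_delta_def sum.distrib sum_distrib_left add_divide_distrib algebra_simps del: norm_scaleR)
qed

text \<open>Uniqueness identifies \<open>fourier_fun u\<close> with the given g, and inversion on
  test functions then cancels the two transforms.\<close>

theorem line_multiplier_symbol: "has_symbol (fourier_multiplier (line_symbol m)) (line_symbol m)"
  unfolding has_symbol_def
proof (intro ballI allI impI)
  fix u :: "(real ^ 2) dist" and g assume g: "is_fourier_fun u g"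
  then have "slowly_growing (dist_mult g (line_symbol m))"
    by (intro slowly_growing_line_symbol is_fourier_fun_measurable) (auto simp: is_fourier_fun_def)
  then show "fourier_dist (fourier_multiplier (line_symbol m) u) =\<^sub>S dist_mult g (line_symbol m)"
    unfolding fourier_multiplier_def fourier_fun_eq[OF g] by (rule fourier_dist_inv_fourier_dist)
qed

theorem line_multiplier_linear: "linear_operator (fourier_multiplier (line_symbol m))"
  unfolding linear_operator_def
proof (intro ballI allI)
  fix u v :: "(real ^ 2) dist" and a b assume u: "u \<in> multiplier_domain" and v: "v \<in> multiplier_domain"
  let ?w = "dist_add (dist_scale a u) (dist_scale b v)"
  let ?A = "fourier_multiplier (line_symbol m)"
  obtain g where g: "is_fourier_fun u g" using u by (auto simp: multiplier_domain_def)
  obtain h where h: "is_fourier_fun v h" using v by (auto simp: multiplier_domain_def)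
  have w: "is_fourier_fun ?w (\<lambda>x. a * g x + b * h x)" by (rule is_fourier_fun_combination[OF g h])
  have T: "tempered (?A u)" if "is_fourier_fun u g" for u g
    unfolding fourier_multiplier_def fourier_fun_eq[OF that]
    using that by (intro slowly_growing_tempered(3) slowly_growing_line_symbol is_fourier_fun_measurable)
      (auto simp: is_fourier_fun_def)
  have "tempered ?w" using u v by (intro tempered_combination) (auto simp: multiplier_domain_def)
  then have "?w \<in> multiplier_domain" using w by (auto simp: multiplier_domain_def)
  moreover have "?A ?w \<phi> = dist_add (dist_scale a (?A u)) (dist_scale b (?A v)) \<phi>" if "\<phi> \<in> schwartz" for \<phi>
  proof -
    have A: "?A u \<phi> = dist_mult g (line_symbol m) (inv_fourier \<phi>)" if "is_fourier_fun u g" for u g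
      by (simp only: fourier_multiplier_def fourier_fun_eq[OF that] inv_fourier_dist_def)
    have "?A ?w \<phi> = a * ?A u \<phi> + b * ?A v \<phi>"
      unfolding A[OF w] A[OF g] A[OF h]
      using g h by (intro line_symbol_combination rapid_fourier(2) that is_fourier_fun_measurable) (auto simp: is_fourier_fun_def)
    also have "\<dots> = dist_add (dist_scale a (?A u)) (dist_scale b (?A v)) \<phi>"
      by (simp add: dist_add_def dist_scale_def)
    finally show ?thesis .
  qed
  ultimately show "?w \<in> multiplier_domain \<and> ?A ?w =\<^sub>S dist_add (dist_scale a (?A u)) (dist_scale b (?A v))"
    using T[OF w] tempered_combination[OF T[OF g] T[OF h]] by (simp add: tempered_eq_def)
qed

section \<open>The filtered backprojection from finitely many directions\<close>

lemma line_ramp_integrable: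
  fixes f :: "real ^ 2 \<Rightarrow> complex"
  assumes f: "f \<in> schwartz" and \<omega>: "norm \<omega> = 1"
  shows "integrable lborel (\<lambda>\<sigma>. complex_of_real \<bar>\<sigma>\<bar> * fourier f (\<sigma> *\<^sub>R \<omega>))"
proof -
  obtain A where "rapid (1 + 2) (fourier f) A" using rapid_fourier(1)[OF f] by blast
  then have "fourier f \<in> borel_measurable borel" "\<And>x. (1 + norm x) ^ (1 + 2) * norm (fourier f x) \<le> A"
    unfolding rapid_def by blast+
  from line_integrable(1)[OF this(1) \<omega> this(2)] show ?thesis by simp
qed

text \<open>A filtered projection stripped of its constants. It is itself a one-dimensional Fourier
  transform of an integrable function, which gives measurability and boundedness.\<close>

definition line_wave :: "(real ^ 2 \<Rightarrow> complex) \<Rightarrow> real ^ 2 \<Rightarrow> real \<Rightarrow> complex" where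
  "line_wave f \<omega> p = (LINT \<sigma>|lborel. iexp (\<sigma> * p) * (complex_of_real \<bar>\<sigma>\<bar> * fourier f (\<sigma> *\<^sub>R \<omega>)))"

lemma line_wave_eq: "line_wave f \<omega> p = fourier (\<lambda>\<sigma>. complex_of_real \<bar>\<sigma>\<bar> * fourier f (\<sigma> *\<^sub>R \<omega>)) (- p)"
  unfolding line_wave_def fourier_def[of "\<lambda>\<sigma>. complex_of_real \<bar>\<sigma>\<bar> * fourier f (\<sigma> *\<^sub>R \<omega>)"] by simp

lemma line_wave_measurable:
  assumes "f \<in> schwartz" "norm \<omega> = 1"
  shows "line_wave f \<omega> \<in> borel_measurable borel"
proof -
  have [measurable]: "fourier (\<lambda>\<sigma>. complex_of_real \<bar>\<sigma>\<bar> * fourier f (\<sigma> *\<^sub>R \<omega>)) \<in> borel_measurable borel"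
    by (rule fourier_measurable[OF line_ramp_integrable[OF assms]])
  show ?thesis unfolding line_wave_eq[abs_def] by measurable
qed

lemma f_psi_delta_eq:
  assumes f: "f \<in> schwartz"
  shows "f_psi_delta m \<psi> f x = (\<Sum>j=1..m. complex_of_real (1 / (4 * pi * real m)) * \<psi> (dir m j) * line_wave f (dir m j) (x \<bullet> dir m j))"
proof -
  have "complex_of_real (2 * pi / real m) * complex_of_real (1 / (8 * pi\<^sup>2)) = complex_of_real (1 / (4 * pi * real m))"
    unfolding of_real_mult[symmetric] of_real_eq_iff by (simp add: power2_eq_square field_simps)
  then have c: "complex_of_real (2 * pi / real m) * (\<psi> (dir m j) * (complex_of_real (1 / (8 * pi\<^sup>2)) * w))
      = complex_of_real (1 / (4 * pi * real m)) * \<psi> (dir m j) * w" for j w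
    by (simp only: mult_ac flip: mult.assoc)
  show ?thesis
    unfolding f_psi_delta_def ramp_filter_radon[OF f norm_dir] line_wave_def[symmetric] sum_distrib_left
    by (simp only: c)
qed

lemma f_psi_delta_measurable:
  assumes f: "f \<in> schwartz"
  shows "f_psi_delta m \<psi> f \<in> borel_measurable borel"
  unfolding f_psi_delta_eq[OF f, abs_def]
  by (intro borel_measurable_sum borel_measurable_times borel_measurable_const
      measurable_compose[OF _ line_wave_measurable[OF f norm_dir]]) measurable

lemma f_psi_delta_bounded:
  assumes f: "f \<in> schwartz"
  shows "poly_bounded (f_psi_delta m \<psi> f)"
proof -
  let ?B = "\<Sum>j=1..m. norm (complex_of_real (1 / (4 * pi * real m)) * \<psi> (dir m j)) *
     (LINT \<sigma>|lborel. norm (complex_of_real \<bar>\<sigma>\<bar> * fourier f (\<sigma> *\<^sub>R dir m j)))"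
  have "norm (f_psi_delta m \<psi> f x) \<le> ?B" for x
    unfolding f_psi_delta_eq[OF f] line_wave_eq
    by (intro order_trans[OF norm_sum] sum_mono) (simp only: norm_mult[of "_ * \<psi> _"], intro mult_left_mono norm_fourier_le norm_ge_zero)
  then show ?thesis unfolding poly_bounded_def by (intro exI[of _ ?B] exI[of _ 0]) simp
qed

text \<open>Exchanging the integrals leaves the inner integral of u against a plane wave. This is
  the inverse transform at \<sigma> \<omega> without its normalisation, whence 4 \<pi>^2.\<close>

lemma integral_line_wave:
  fixes u :: "real ^ 2 \<Rightarrow> complex"
  assumes f: "f \<in> schwartz" and \<omega>: "norm \<omega> = 1" and u: "integrable lborel u"
  shows "integrable lborel (\<lambda>x. line_wave f \<omega> (x \<bullet> \<omega>) * u x)"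
    and "(LINT x|lborel. line_wave f \<omega> (x \<bullet> \<omega>) * u x)
      = complex_of_real (4 * pi\<^sup>2) * (LINT \<sigma>|lborel. complex_of_real \<bar>\<sigma>\<bar> * (fourier f (\<sigma> *\<^sub>R \<omega>) * inv_fourier u (\<sigma> *\<^sub>R \<omega>)))"
proof -
  let ?W = "\<lambda>\<sigma>. complex_of_real \<bar>\<sigma>\<bar> * fourier f (\<sigma> *\<^sub>R \<omega>)"
  have W: "integrable lborel ?W" by (rule line_ramp_integrable[OF f \<omega>])
  have [measurable]: "u \<in> borel_measurable borel" "line_wave f \<omega> \<in> borel_measurable borel"
    using borel_measurable_integrable[OF u] line_wave_measurable[OF f \<omega>] by auto
  let ?B = "LINT \<sigma>|lborel. norm (?W \<sigma>)"
  show "integrable lborel (\<lambda>x. line_wave f \<omega> (x \<bullet> \<omega>) * u x)"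
  proof (rule Bochner_Integration.integrable_bound)
    show "integrable lborel (\<lambda>x. ?B * norm (u x))"
      using u by (intro integrable_mult_right integrable_norm)
    have "norm (line_wave f \<omega> (x \<bullet> \<omega>)) * norm (u x) \<le> ?B * norm (u x)" for x
      unfolding line_wave_eq by (intro mult_right_mono norm_fourier_le norm_ge_zero)
    then show "AE x in lborel. norm (line_wave f \<omega> (x \<bullet> \<omega>) * u x) \<le> norm (?B * norm (u x))"
      unfolding norm_mult by (intro AE_I2) (simp add: abs_mult)
  qed measurable
  have "(LINT x|lborel. line_wave f \<omega> (x \<bullet> \<omega>) * u x)
      = (LINT x|lborel. LINT \<sigma>|lborel. iexp (\<sigma> * (x \<bullet> \<omega>)) * u x * ?W \<sigma>)"
  proof (rule Bochner_Integration.integral_cong[OF refl])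
    fix x
    have "line_wave f \<omega> (x \<bullet> \<omega>) * u x = (LINT \<sigma>|lborel. (iexp (\<sigma> * (x \<bullet> \<omega>)) * ?W \<sigma>) * u x)"
      by (simp only: line_wave_def integral_mult_left_zero)
    also have "\<dots> = (LINT \<sigma>|lborel. iexp (\<sigma> * (x \<bullet> \<omega>)) * u x * ?W \<sigma>)"
      by (intro Bochner_Integration.integral_cong refl) (simp only: mult_ac)
    finally show "line_wave f \<omega> (x \<bullet> \<omega>) * u x = (LINT \<sigma>|lborel. iexp (\<sigma> * (x \<bullet> \<omega>)) * u x * ?W \<sigma>)" .
  qed
  also have "\<dots> = (LINT \<sigma>|lborel. LINT x|lborel. iexp (\<sigma> * (x \<bullet> \<omega>)) * u x * ?W \<sigma>)"
  proof (rule lborel_Fubini_bounded[where B=1, OF u W])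
    show "(\<lambda>(x, \<sigma>). iexp (\<sigma> * (x \<bullet> \<omega>))) \<in> borel_measurable (borel \<Otimes>\<^sub>M borel)" by measurable
  qed simp
  also have "\<dots> = (LINT \<sigma>|lborel. complex_of_real (4 * pi\<^sup>2) * (complex_of_real \<bar>\<sigma>\<bar> * (fourier f (\<sigma> *\<^sub>R \<omega>) * inv_fourier u (\<sigma> *\<^sub>R \<omega>))))"
  proof (rule Bochner_Integration.integral_cong[OF refl])
    fix \<sigma>
    have "inv_fourier u (\<sigma> *\<^sub>R \<omega>) = complex_of_real (1 / (2 * pi) ^ 2) * (LINT x|lborel. iexp (\<sigma> * (x \<bullet> \<omega>)) * u x)"
      by (simp add: inv_fourier_def inner_commute)
    then have 1: "(LINT x|lborel. iexp (\<sigma> * (x \<bullet> \<omega>)) * u x) = complex_of_real (4 * pi\<^sup>2) * inv_fourier u (\<sigma> *\<^sub>R \<omega>)"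
      by (simp add: power2_eq_square)
    show "(LINT x|lborel. iexp (\<sigma> * (x \<bullet> \<omega>)) * u x * ?W \<sigma>)
      = complex_of_real (4 * pi\<^sup>2) * (complex_of_real \<bar>\<sigma>\<bar> * (fourier f (\<sigma> *\<^sub>R \<omega>) * inv_fourier u (\<sigma> *\<^sub>R \<omega>)))"
      unfolding integral_mult_left_zero 1 by (simp only: mult_ac)
  qed
  also have "\<dots> = complex_of_real (4 * pi\<^sup>2) * (LINT \<sigma>|lborel. complex_of_real \<bar>\<sigma>\<bar> * (fourier f (\<sigma> *\<^sub>R \<omega>) * inv_fourier u (\<sigma> *\<^sub>R \<omega>)))"
    by (rule integral_mult_right_zero)
  finally show "(LINT x|lborel. line_wave f \<omega> (x \<bullet> \<omega>) * u x)
      = complex_of_real (4 * pi\<^sup>2) * (LINT \<sigma>|lborel. complex_of_real \<bar>\<sigma>\<bar> * (fourier f (\<sigma> *\<^sub>R \<omega>) * inv_fourier u (\<sigma> *\<^sub>R \<omega>)))" .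
qed

text \<open>Allowing every integrable u makes one formula serve twice: u = \<phi> describes the
  distribution and u = \<open>fourier \<phi>\<close> describes its transform. The weight is 1 / (4
  \<pi> m) * 4 \<pi>^2 = \<pi> / m.\<close>

theorem f_psi_delta_pairing:
  assumes f: "f \<in> schwartz" and u: "integrable lborel u"
  shows "fun_dist (f_psi_delta m \<psi> f) u = complex_of_real (pi / real m) *
    (\<Sum>j=1..m. \<psi> (dir m j) * (LINT \<sigma>|lborel. complex_of_real \<bar>\<sigma>\<bar> * (fourier f (\<sigma> *\<^sub>R dir m j) * inv_fourier u (\<sigma> *\<^sub>R dir m j))))"
proof -
  let ?c = "\<lambda>j. complex_of_real (1 / (4 * pi * real m)) * \<psi> (dir m j)"
  have "fun_dist (f_psi_delta m \<psi> f) u = (LINT x|lborel. (\<Sum>j=1..m. ?c j * (line_wave f (dir m j) (x \<bullet> dir m j) * u x)))"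
    unfolding fun_dist_def f_psi_delta_eq[OF f] by (simp add: sum_distrib_right mult.assoc)
  also have "\<dots> = (\<Sum>j=1..m. ?c j * (LINT x|lborel. line_wave f (dir m j) (x \<bullet> dir m j) * u x))"
    by (simp only: Bochner_Integration.integral_sum[OF integrable_mult_right[OF integral_line_wave(1)[OF f norm_dir u]]] integral_mult_right_zero)
  also have "\<dots> = (\<Sum>j=1..m. complex_of_real (pi / real m) * (\<psi> (dir m j) *
      (LINT \<sigma>|lborel. complex_of_real \<bar>\<sigma>\<bar> * (fourier f (\<sigma> *\<^sub>R dir m j) * inv_fourier u (\<sigma> *\<^sub>R dir m j)))))"
  proof (rule sum.cong[OF refl])
    fix j
    have c: "complex_of_real (1 / (4 * pi * real m)) * complex_of_real (4 * pi\<^sup>2) = complex_of_real (pi / real m)"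
      unfolding of_real_mult[symmetric] of_real_eq_iff by (simp add: power2_eq_square)
    show "?c j * (LINT x|lborel. line_wave f (dir m j) (x \<bullet> dir m j) * u x) = complex_of_real (pi / real m) * (\<psi> (dir m j) *
      (LINT \<sigma>|lborel. complex_of_real \<bar>\<sigma>\<bar> * (fourier f (\<sigma> *\<^sub>R dir m j) * inv_fourier u (\<sigma> *\<^sub>R dir m j))))"
      unfolding integral_line_wave(2)[OF f norm_dir u] c[symmetric] by (simp only: mult_ac)
  qed
  finally show ?thesis by (simp only: sum_distrib_left)
qed

section \<open>Line moments as Lipschitz functions of the angle\<close>

lemma schwartz_fourier_Lipschitz:
  fixes \<phi> :: "'a::euclidean_space \<Rightarrow> complex"
  assumes \<phi>: "\<phi> \<in> schwartz"
  obtains L where "\<And>\<xi> \<eta>. norm (fourier \<phi> \<xi> - fourier \<phi> \<eta>) \<le> L * norm (\<xi> - \<eta>)"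
    "\<And>\<xi> \<eta>. norm (inv_fourier \<phi> \<xi> - inv_fourier \<phi> \<eta>) \<le> L * norm (\<xi> - \<eta>)" "L \<ge> 0"
proof -
  have m[measurable]: "\<phi> \<in> borel_measurable borel" by (rule schwartz_measurable[OF \<phi>])
  have "integrable lborel (\<lambda>x. (1 + norm x) ^ 1 * norm (iter_partial [] \<phi> x))"
    by (rule schwartz_integrable_weight[OF \<phi>]) simp
  then have i: "integrable lborel (\<lambda>x. norm x * norm (\<phi> x))"
    by (rule Bochner_Integration.integrable_bound) (auto intro!: AE_I2 mult_right_mono simp: abs_mult)
  let ?L = "LINT x|lborel. norm x * norm (\<phi> x)"
  let ?c = "complex_of_real (1 / (2 * pi) ^ DIM('a))"
  have L: "norm (fourier \<phi> \<xi> - fourier \<phi> \<eta>) \<le> ?L * norm (\<xi> - \<eta>)" for \<xi> \<eta>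
    by (rule fourier_Lipschitz[OF m schwartz_integrable'[OF \<phi>] i])
  have L0: "0 \<le> ?L" by (intro Bochner_Integration.integral_nonneg) auto
  have "norm (inv_fourier \<phi> \<xi> - inv_fourier \<phi> \<eta>) \<le> ?L * norm (\<xi> - \<eta>)" for \<xi> \<eta>
  proof -
    have "inv_fourier \<phi> \<xi> - inv_fourier \<phi> \<eta> = ?c * (fourier \<phi> (- \<xi>) - fourier \<phi> (- \<eta>))"
      by (simp only: inv_fourier_eq right_diff_distrib)
    then have "norm (inv_fourier \<phi> \<xi> - inv_fourier \<phi> \<eta>) \<le> norm (fourier \<phi> (- \<xi>) - fourier \<phi> (- \<eta>))"
      unfolding norm_mult by (simp only: norm_mult) (intro mult_left_le_one_le norm_inv_fourier_factor_le norm_ge_zero)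
    also have "\<dots> \<le> ?L * norm (- \<xi> - - \<eta>)" by (rule L)
    also have "norm (- \<xi> - - \<eta>) = norm (\<xi> - \<eta>)" by (simp add: norm_minus_commute)
    finally show ?thesis .
  qed
  then show ?thesis using that[OF L _ L0] by blast
qed

text \<open>Turning the line by x - y moves the point with parameter s by at most |s| |x - y|. This
  factor, the weight |s| and two powers for integrability consume the four powers of decay requested
  from the factor of H that is not being differenced.\<close>

lemma line_moment_Lipschitz:
  fixes f \<phi> :: "real ^ 2 \<Rightarrow> complex"
  assumes f: "f \<in> schwartz" and \<phi>: "\<phi> \<in> schwartz"
  defines "H \<equiv> \<lambda>\<xi>. fourier f \<xi> * inv_fourier \<phi> \<xi>"
  obtains B C where "\<And>x. norm (line_moment H x) \<le> B" "\<And>x y. norm (line_moment H x - line_moment H y) \<le> C * \<bar>x - y\<bar>"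
proof -
  obtain A1 where A1: "rapid 4 (fourier f) A1" using rapid_fourier(1)[OF f] by blast
  obtain A2 where A2: "rapid 4 (inv_fourier \<phi>) A2" using rapid_fourier(2)[OF \<phi>] by blast
  obtain L1 where L1: "\<And>\<xi> \<eta>. norm (fourier f \<xi> - fourier f \<eta>) \<le> L1 * norm (\<xi> - \<eta>)"
    "\<And>\<xi> \<eta>. norm (inv_fourier f \<xi> - inv_fourier f \<eta>) \<le> L1 * norm (\<xi> - \<eta>)" "L1 \<ge> 0"
    by (rule schwartz_fourier_Lipschitz[OF f]) (rule that)
  obtain L2 where L2': "\<And>\<xi> \<eta>. norm (fourier \<phi> \<xi> - fourier \<phi> \<eta>) \<le> L2 * norm (\<xi> - \<eta>)"
    and L2: "\<And>\<xi> \<eta>. norm (inv_fourier \<phi> \<xi> - inv_fourier \<phi> \<eta>) \<le> L2 * norm (\<xi> - \<eta>)" "L2 \<ge> 0"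
    by (rule schwartz_fourier_Lipschitz[OF \<phi>]) (rule that)
  obtain A0 where A0: "rapid 0 (inv_fourier \<phi>) A0" using rapid_fourier(2)[OF \<phi>] by blast
  have [measurable]: "fourier f \<in> borel_measurable borel" "inv_fourier \<phi> \<in> borel_measurable borel"
    using A1 A2 by (auto simp: rapid_def)
  have Hm[measurable]: "H \<in> borel_measurable borel" unfolding H_def by measurable
  have A0': "0 \<le> A0" "norm (inv_fourier \<phi> \<xi>) \<le> A0" for \<xi>
    using A0 order_trans[OF norm_ge_zero, of "inv_fourier \<phi> 0" A0] by (auto simp: rapid_def)
  have HB: "(1 + norm \<xi>) ^ (1 + 2) * norm (H \<xi>) \<le> A1 * A0" for \<xi>
  proof -
    have r: "rapid (1 + 2) (fourier f) A1" by (rule rapid_mono[OF A1]) simp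
    have "(1 + norm \<xi>) ^ (1 + 2) * norm (H \<xi>) = ((1 + norm \<xi>) ^ (1 + 2) * norm (fourier f \<xi>)) * norm (inv_fourier \<phi> \<xi>)"
      by (simp only: H_def norm_mult mult.assoc)
    also have "\<dots> \<le> A1 * A0"
      using r A0' order_trans[OF _ r[unfolded rapid_def, THEN conjunct2, rule_format, of \<xi>], of 0]
      by (intro mult_mono) (auto simp: rapid_def)
    finally show ?thesis .
  qed
  have eq: "line_moment H x = (LINT s|lborel. complex_of_real (\<bar>s\<bar> ^ 1) * H (s *\<^sub>R circle_point x))" for x
    by (simp add: line_moment_def)
  have int: "integrable lborel (\<lambda>s. complex_of_real (\<bar>s\<bar> ^ 1) * H (s *\<^sub>R circle_point x))" for x
    by (rule line_integrable(1)[OF Hm norm_circle_point HB])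
  have B: "norm (line_moment H x) \<le> A1 * A0 * decay_const TYPE(real)" for x
    unfolding eq by (rule line_integrable(2)[OF Hm norm_circle_point HB])
  \<comment> \<open>The two summands belong to the two terms of the product rule for differences:
    decay of one factor times the Lipschitz constant of the other.\<close>
  let ?K = "A1 * L2 + A2 * L1"
  have C: "norm (line_moment H x - line_moment H y) \<le> ?K * decay_const TYPE(real) * \<bar>x - y\<bar>" for x y
  proof -
    let ?\<Delta> = "\<lambda>s. complex_of_real (\<bar>s\<bar> ^ 1) * H (s *\<^sub>R circle_point x) - complex_of_real (\<bar>s\<bar> ^ 1) * H (s *\<^sub>R circle_point y)"
    have "norm (line_moment H x - line_moment H y) = norm (LINT s|lborel. ?\<Delta> s)"
      unfolding eq by (subst Bochner_Integration.integral_diff[OF int int]) simp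
    also have "\<dots> \<le> (LINT s|lborel. norm (?\<Delta> s))" by (rule integral_norm_bound)
    also have "\<dots> \<le> ?K * \<bar>x - y\<bar> * decay_const TYPE(real)"
      unfolding decay_const_def
    proof (rule integrable_of_decay(2))
      show "?\<Delta> \<in> borel_measurable borel" by measurable
      fix s :: real
      let ?\<xi> = "s *\<^sub>R circle_point x" and ?\<eta> = "s *\<^sub>R circle_point y" and ?t = "1 + \<bar>s\<bar>"
      have n: "norm ?\<xi> = \<bar>s\<bar>" "norm ?\<eta> = \<bar>s\<bar>" by simp_all
      have d: "norm (?\<xi> - ?\<eta>) \<le> ?t * \<bar>x - y\<bar>"
      proof -
        have "norm (?\<xi> - ?\<eta>) = \<bar>s\<bar> * norm (circle_point x - circle_point y)"
          by (simp flip: scaleR_diff_right)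
        also have "\<dots> \<le> ?t * \<bar>x - y\<bar>"
          using norm_circle_point_diff by (intro mult_mono) auto
        finally show ?thesis .
      qed
      have a1: "?t ^ 4 * norm (fourier f ?\<xi>) \<le> A1"
        using A1[unfolded rapid_def, THEN conjunct2, rule_format, of ?\<xi>] unfolding n .
      have a2: "?t ^ 4 * norm (inv_fourier \<phi> ?\<eta>) \<le> A2"
        using A2[unfolded rapid_def, THEN conjunct2, rule_format, of ?\<eta>] unfolding n .
      have dH: "H ?\<xi> - H ?\<eta> = fourier f ?\<xi> * (inv_fourier \<phi> ?\<xi> - inv_fourier \<phi> ?\<eta>) + inv_fourier \<phi> ?\<eta> * (fourier f ?\<xi> - fourier f ?\<eta>)"
        by (simp add: H_def algebra_simps)
      have "norm (H ?\<xi> - H ?\<eta>) \<le> norm (fourier f ?\<xi>) * norm (inv_fourier \<phi> ?\<xi> - inv_fourier \<phi> ?\<eta>)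
          + norm (inv_fourier \<phi> ?\<eta>) * norm (fourier f ?\<xi> - fourier f ?\<eta>)"
        unfolding dH norm_mult[symmetric] by (rule norm_triangle_ineq)
      also have "\<dots> \<le> norm (fourier f ?\<xi>) * (L2 * (?t * \<bar>x - y\<bar>)) + norm (inv_fourier \<phi> ?\<eta>) * (L1 * (?t * \<bar>x - y\<bar>))"
        using L1 L2 d by (intro add_mono mult_left_mono order_trans[OF L1(1)] order_trans[OF L2(1)]) auto
      finally have H: "norm (H ?\<xi> - H ?\<eta>) \<le> norm (fourier f ?\<xi>) * (L2 * (?t * \<bar>x - y\<bar>)) + norm (inv_fourier \<phi> ?\<eta>) * (L1 * (?t * \<bar>x - y\<bar>))" .
      have "norm (?\<Delta> s) = \<bar>s\<bar> * norm (H ?\<xi> - H ?\<eta>)"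
        by (simp only: right_diff_distrib[symmetric] norm_mult) simp
      then have "(1 + norm s) ^ (2 * DIM(real)) * norm (?\<Delta> s) = ?t ^ 2 * (\<bar>s\<bar> * norm (H ?\<xi> - H ?\<eta>))" by simp
      also have "\<dots> \<le> ?t ^ 2 * (?t * (norm (fourier f ?\<xi>) * (L2 * (?t * \<bar>x - y\<bar>)) + norm (inv_fourier \<phi> ?\<eta>) * (L1 * (?t * \<bar>x - y\<bar>))))"
        by (intro mult_left_mono mult_mono H) auto
      also have "\<dots> = (?t ^ 4 * norm (fourier f ?\<xi>)) * (L2 * \<bar>x - y\<bar>) + (?t ^ 4 * norm (inv_fourier \<phi> ?\<eta>)) * (L1 * \<bar>x - y\<bar>)"
        by algebra
      also have "\<dots> \<le> A1 * (L2 * \<bar>x - y\<bar>) + A2 * (L1 * \<bar>x - y\<bar>)"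
        using L1(3) L2(2) by (intro add_mono mult_right_mono a1 a2) auto
      also have "\<dots> = ?K * \<bar>x - y\<bar>" by algebra
      finally show "(1 + norm s) ^ (2 * DIM(real)) * norm (?\<Delta> s) \<le> ?K * \<bar>x - y\<bar>" .
    qed
    finally show ?thesis by (simp only: mult_ac)
  qed
  show ?thesis by (rule that[OF B C])
qed

lemma even_on_circle_line:
  assumes e: "even_on_circle \<psi>" and \<omega>: "norm \<omega> = 1" and s: "s \<noteq> 0"
  shows "\<psi> (sgn (s *\<^sub>R \<omega>)) = \<psi> \<omega>"
proof -
  have "sgn (s *\<^sub>R \<omega>) = sgn s *\<^sub>R \<omega>" using \<omega> by (simp add: sgn_scaleR) (simp add: sgn_div_norm)
  moreover have "sgn s = 1 \<or> sgn s = -1" using s by (auto simp: sgn_if)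
  ultimately show ?thesis using e \<omega> by (auto simp: even_on_circle_def)
qed

text \<open>The value at the origin is the normalisation in \<open>is_fourier_fun\<close>.\<close>

definition psi_symbol :: "(real ^ 2 \<Rightarrow> complex) \<Rightarrow> (real ^ 2 \<Rightarrow> complex) \<Rightarrow> real ^ 2 \<Rightarrow> complex" where
  "psi_symbol \<psi> f \<xi> = (if \<xi> = 0 then 0 else \<psi> (sgn \<xi>) * fourier f \<xi>)"

text \<open>Off the origin evenness gives the same value \<psi> \<omega> on both rays, and at s = 0
  both sides vanish through the weight.\<close>

lemma psi_symbol_line:
  assumes e: "even_on_circle \<psi>" and \<omega>: "norm \<omega> = 1"
  shows "complex_of_real \<bar>s\<bar> * psi_symbol \<psi> f (s *\<^sub>R \<omega>) = \<psi> \<omega> * (complex_of_real \<bar>s\<bar> * fourier f (s *\<^sub>R \<omega>))"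
proof (cases "s = 0")
  case False
  then have "s *\<^sub>R \<omega> \<noteq> 0" using \<omega> by auto
  then show ?thesis by (simp add: psi_symbol_def even_on_circle_line[OF e \<omega> False])
qed simp

lemma
  fixes f \<psi> :: "real ^ 2 \<Rightarrow> complex"
  assumes f: "f \<in> schwartz" and s: "smooth_on_circle \<psi>" and e: "even_on_circle \<psi>"
  shows psi_symbol_continuous: "continuous_on (- {0}) (psi_symbol \<psi> f)"
    and psi_symbol_measurable: "psi_symbol \<psi> f \<in> borel_measurable borel"
    and psi_symbol_rapid: "\<exists>A. rapid N (psi_symbol \<psi> f) A"
    and psi_symbol_poly_bounded: "poly_bounded (psi_symbol \<psi> f)"
    and psi_fourier_measurable: "(\<lambda>\<xi>. \<psi> (sgn \<xi>) * fourier f \<xi>) \<in> borel_measurable borel"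
    and psi_fourier_poly_bounded: "poly_bounded (\<lambda>\<xi>. \<psi> (sgn \<xi>) * fourier f \<xi>)"
proof -
  obtain B K where B: "\<And>\<theta>. norm (\<psi> (circle_point \<theta>)) \<le> B"
    and "\<And>x y. norm (\<psi> (circle_point x) - \<psi> (circle_point y)) \<le> K * \<bar>x - y\<bar>"
    and c: "continuous_on UNIV (\<lambda>\<theta>. \<psi> (circle_point \<theta>))"
    by (rule smooth_on_circle_Lipschitz[OF s e]) (rule that)
  have B0: "0 \<le> B" using order_trans[OF norm_ge_zero B] .
  have fc: "continuous_on UNIV (fourier f)" by (rule fourier_continuous[OF schwartz_integrable'[OF f]])
  have c0: "continuous_on (- {0}) (\<lambda>\<xi>. \<psi> (sgn \<xi>) * fourier f \<xi>)"
    by (intro continuous_intros continuous_on_sgn_comp[OF c] continuous_on_subset[OF fc]) auto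
  show c1: "continuous_on (- {0}) (psi_symbol \<psi> f)"
    by (rule iffD1[OF continuous_on_cong c0]) (auto simp: psi_symbol_def)
  show m1: "psi_symbol \<psi> f \<in> borel_measurable borel"
    by (rule borel_measurable_continuous_countable_exceptions[of "{0}"]) (use c1 in auto)
  show "(\<lambda>\<xi>. \<psi> (sgn \<xi>) * fourier f \<xi>) \<in> borel_measurable borel"
    by (rule borel_measurable_continuous_countable_exceptions[of "{0}"]) (use c0 in auto)
  have b: "norm (psi_symbol \<psi> f \<xi>) \<le> B * norm (fourier f \<xi>)" for \<xi>
    using B[of "polar_angle \<xi>"] B0 by (auto simp: psi_symbol_def norm_mult sgn_polar intro!: mult_right_mono)
  show r: "\<exists>A. rapid N (psi_symbol \<psi> f) A" for N
  proof -
    obtain A where A: "rapid N (fourier f) A" using rapid_fourier(1)[OF f] by blast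
    have "(1 + norm \<xi>) ^ N * norm (psi_symbol \<psi> f \<xi>) \<le> B * A" for \<xi>
    proof -
      have "(1 + norm \<xi>) ^ N * norm (psi_symbol \<psi> f \<xi>) \<le> (1 + norm \<xi>) ^ N * (B * norm (fourier f \<xi>))"
        by (intro mult_left_mono b) auto
      also have "\<dots> = B * ((1 + norm \<xi>) ^ N * norm (fourier f \<xi>))" by (simp only: mult_ac)
      also have "\<dots> \<le> B * A" using A B0 by (intro mult_left_mono) (auto simp: rapid_def)
      finally show ?thesis .
    qed
    then show ?thesis using m1 by (auto simp: rapid_def)
  qed
  obtain A where "rapid 0 (psi_symbol \<psi> f) A" using r by blast
  then have A: "norm (psi_symbol \<psi> f \<xi>) \<le> A" for \<xi> by (simp add: rapid_def)
  then show "poly_bounded (psi_symbol \<psi> f)"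
    unfolding poly_bounded_def by (intro exI[of _ A] exI[of _ 0]) simp
  \<comment> \<open>At the origin \<open>sgn \<xi>\<close> is 0, a point off the circle about which
    the assumptions on \<psi> say nothing; the maximum takes in this one value.\<close>
  have "norm (\<psi> (sgn \<xi>) * fourier f \<xi>) \<le> max A (norm (\<psi> 0 * fourier f 0))" for \<xi>
    using A[of \<xi>] by (cases "\<xi> = 0") (auto simp: psi_symbol_def)
  then show "poly_bounded (\<lambda>\<xi>. \<psi> (sgn \<xi>) * fourier f \<xi>)"
    unfolding poly_bounded_def by (intro exI[of _ "max A (norm (\<psi> 0 * fourier f 0))"] exI[of _ 0]) simp
qed

lemma fun_dist_psi_symbol:
  fixes f \<psi> u :: "real ^ 2 \<Rightarrow> complex"
  assumes f: "f \<in> schwartz" and s: "smooth_on_circle \<psi>" and e: "even_on_circle \<psi>" and u[measurable]: "u \<in> borel_measurable borel"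
  shows "fun_dist (\<lambda>\<xi>. \<psi> (sgn \<xi>) * fourier f \<xi>) u = fun_dist (psi_symbol \<psi> f) u"
  unfolding fun_dist_def
proof (rule integral_cong_AE)
  have [measurable]: "psi_symbol \<psi> f \<in> borel_measurable borel" "(\<lambda>\<xi>. \<psi> (sgn \<xi>) * fourier f \<xi>) \<in> borel_measurable borel"
    by (rule psi_symbol_measurable[OF f s e], rule psi_fourier_measurable[OF f s e])
  show "(\<lambda>x. \<psi> (sgn x) * fourier f x * u x) \<in> borel_measurable lborel" by measurable
  show "(\<lambda>x. psi_symbol \<psi> f x * u x) \<in> borel_measurable lborel" by measurable
  show "AE \<xi> in lborel. \<psi> (sgn \<xi>) * fourier f \<xi> * u \<xi> = psi_symbol \<psi> f \<xi> * u \<xi>"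
    using AE_lborel_singleton[of 0] by eventually_elim (simp add: psi_symbol_def)
qed

lemma f_psi_fourier_fun:
  assumes f: "f \<in> schwartz" and s: "smooth_on_circle \<psi>" and e: "even_on_circle \<psi>"
  shows "is_fourier_fun (f_psi \<psi> f) (psi_symbol \<psi> f)" and "tempered (f_psi \<psi> f)"
proof -
  note m = psi_symbol_measurable[OF f s e] psi_symbol_poly_bounded[OF f s e]
    psi_fourier_measurable[OF f s e] psi_fourier_poly_bounded[OF f s e]
  have sg: "slowly_growing (fun_dist (\<lambda>\<xi>. \<psi> (sgn \<xi>) * fourier f \<xi>))"
    by (rule slowly_growing_fun_dist[OF m(3,4)])
  show "tempered (f_psi \<psi> f)" unfolding f_psi_def by (rule slowly_growing_tempered(3)[OF sg])
  have "fourier_dist (f_psi \<psi> f) =\<^sub>S fun_dist (psi_symbol \<psi> f)"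
    using fourier_dist_inv_fourier_dist[OF sg] slowly_growing_tempered(1)[OF slowly_growing_fun_dist[OF m(1,2)]]
      fun_dist_psi_symbol[OF f s e schwartz_measurable]
    by (simp add: tempered_eq_def f_psi_def)
  then show "is_fourier_fun (f_psi \<psi> f) (psi_symbol \<psi> f)"
    using psi_symbol_continuous[OF f s e] m by (simp add: is_fourier_fun_def psi_symbol_def)
qed

section \<open>Summation of the angular series\<close>

lemma abs_dirichlet_le: "\<bar>dirichlet K x\<bar> \<le> 1 + 2 * real K"
proof -
  have "\<bar>\<Sum>k<K. cos (real (Suc k) * x)\<bar> \<le> (\<Sum>k<K. 1)"
    by (rule order_trans[OF sum_abs]) (intro sum_mono abs_cos_le_one)
  then show ?thesis unfolding dirichlet_def by simp
qed

text \<open>A partial sum together with the integral of h is the integral of h against the Dirichlet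
  kernel in 2 m times the polar angle. Only even multiples of the angle occur, so the kernel is
  constant on each line without the origin and factors out of the line moment; the plane integral
  reduces to the angular one treated before.\<close>

lemma dirichlet_polar_sums:
  fixes h :: "real ^ 2 \<Rightarrow> complex"
  assumes h: "integrable lborel h" and m: "m \<ge> 1"
    and B: "\<And>x. norm (line_moment h x) \<le> B" and C: "\<And>x y. norm (line_moment h x - line_moment h y) \<le> C * \<bar>x - y\<bar>"
  shows "(\<lambda>k. LINT \<xi>|lborel. complex_of_real (2 * cos (2 * real m * real (Suc k) * polar_angle \<xi>)) * h \<xi>)
    sums (complex_of_real (pi / real m) * (\<Sum>j=1..m. line_moment h (pi * real j / real m)) - (LINT \<xi>|lborel. h \<xi>))"
proof -
  let ?c = "\<lambda>k \<xi>. complex_of_real (2 * cos (2 * real m * real (Suc k) * polar_angle \<xi>))"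
  let ?D = "\<lambda>K \<xi>. complex_of_real (dirichlet K (2 * real m * polar_angle \<xi>))"
  have [measurable]: "h \<in> borel_measurable borel" using borel_measurable_integrable[OF h] by simp
  have cm: "?c k \<in> borel_measurable borel" for k
  proof -
    have "(\<lambda>\<xi>. cos (2 * real (m * Suc k) * polar_angle \<xi>)) \<in> borel_measurable borel" by (rule cos_polar_angle_measurable)
    then have "(\<lambda>\<xi>. complex_of_real (2 * cos (2 * real (m * Suc k) * polar_angle \<xi>))) \<in> borel_measurable borel" by measurable
    then show ?thesis by (simp only: of_nat_mult mult.assoc)
  qed
  have ci: "integrable lborel (\<lambda>\<xi>. ?c k \<xi> * h \<xi>)" for k
  proof (rule Bochner_Integration.integrable_bound)
    show "integrable lborel (\<lambda>\<xi>. 2 * norm (h \<xi>))" using h by (intro integrable_mult_right integrable_norm)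
    show "(\<lambda>\<xi>. ?c k \<xi> * h \<xi>) \<in> borel_measurable lborel" using cm[of k] by measurable
    have "norm (?c k \<xi>) * norm (h \<xi>) \<le> 2 * norm (h \<xi>)" for \<xi>
      using abs_cos_le_one by (intro mult_right_mono) (auto simp: abs_mult)
    then show "AE \<xi> in lborel. norm (?c k \<xi> * h \<xi>) \<le> norm (2 * norm (h \<xi>))"
      by (intro AE_I2) (simp only: norm_mult, simp)
  qed
  have D: "?D K \<xi> * h \<xi> = h \<xi> + (\<Sum>k<K. ?c k \<xi> * h \<xi>)" for K \<xi>
    by (simp add: dirichlet_def algebra_simps sum_distrib_left sum_distrib_right)
  have Di: "integrable lborel (\<lambda>\<xi>. ?D K \<xi> * h \<xi>)" for K
    unfolding D by (intro Bochner_Integration.integrable_add Bochner_Integration.integrable_sum h ci)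
  have S: "(LINT \<xi>|lborel. ?D K \<xi> * h \<xi>) = (LINT \<xi>|lborel. h \<xi>) + (\<Sum>k<K. LINT \<xi>|lborel. ?c k \<xi> * h \<xi>)" for K
    unfolding D
    by (subst Bochner_Integration.integral_add[OF h Bochner_Integration.integrable_sum[OF ci]])
      (simp only: Bochner_Integration.integral_sum[OF ci])
  have lm: "line_moment (\<lambda>\<xi>. ?D K \<xi> * h \<xi>) x = complex_of_real (dirichlet K (2 * real m * x)) * line_moment h x" for K x
  proof -
    have "complex_of_real \<bar>s\<bar> * (?D K (s *\<^sub>R circle_point x) * h (s *\<^sub>R circle_point x))
        = complex_of_real (dirichlet K (2 * real m * x)) * (complex_of_real \<bar>s\<bar> * h (s *\<^sub>R circle_point x))" for s
    proof (cases "s = 0")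
      case False
      have "cos (real (Suc k) * (2 * real m * polar_angle (s *\<^sub>R circle_point x))) = cos (real (Suc k) * (2 * real m * x))" for k
        using cos_polar_angle[OF False, of "Suc k * m" x] by (simp only: of_nat_mult mult_ac)
      then have "dirichlet K (2 * real m * polar_angle (s *\<^sub>R circle_point x)) = dirichlet K (2 * real m * x)"
        by (simp only: dirichlet_def)
      then show ?thesis by (simp only: mult_ac)
    qed simp
    then show ?thesis unfolding line_moment_def by (simp only: integral_mult_right_zero)
  qed
  have C0: "0 \<le> C" using order_trans[OF norm_ge_zero C[of 1 0]] by simp
  have lc: "continuous_on UNIV (line_moment h)"
  proof (rule lipschitz_on_continuous_on)
    show "C-lipschitz_on UNIV (line_moment h)" by (rule lipschitz_onI) (auto simp: dist_norm C C0)
  qed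
  have "(LINT \<xi>|lborel. ?D K \<xi> * h \<xi>)
      = (LINT x|lborel. indicator {-pi/2..pi/2} x *\<^sub>R (complex_of_real (dirichlet K (2 * real m * x)) * line_moment h x))" for K
  proof -
    have c: "continuous_on UNIV (line_moment (\<lambda>\<xi>. ?D K \<xi> * h \<xi>))"
      unfolding lm by (intro continuous_intros lc continuous_on_compose2[OF dirichlet_continuous]) auto
    have b: "norm (line_moment (\<lambda>\<xi>. ?D K \<xi> * h \<xi>) x) \<le> (1 + 2 * real K) * B" for x
      unfolding lm norm_mult using abs_dirichlet_le B by (intro mult_mono) auto
    from integral_lines[OF Di c b] show ?thesis by (simp only: lm)
  qed
  then have "(\<lambda>K. LINT \<xi>|lborel. ?D K \<xi> * h \<xi>) \<longlonglongrightarrow> complex_of_real (pi / real m) * (\<Sum>j=1..m. line_moment h (pi * real j / real m))"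
    using dirichlet_periodic_tendsto[OF C line_moment_add_pi m] by presburger
  then have "(\<lambda>K. (LINT \<xi>|lborel. ?D K \<xi> * h \<xi>) - (LINT \<xi>|lborel. h \<xi>))
      \<longlonglongrightarrow> complex_of_real (pi / real m) * (\<Sum>j=1..m. line_moment h (pi * real j / real m)) - (LINT \<xi>|lborel. h \<xi>)"
    by (intro tendsto_diff tendsto_const)
  then show ?thesis unfolding sums_def S by simp
qed

lemma line_symbol_psi_symbol:
  assumes f: "f \<in> schwartz" and e: "even_on_circle \<psi>" and u: "integrable lborel u"
  shows "dist_mult (psi_symbol \<psi> f) (line_symbol m) (inv_fourier u) = fun_dist (f_psi_delta m \<psi> f) u"
proof -
  have eq: "complex_of_real \<bar>s\<bar> * (psi_symbol \<psi> f (s *\<^sub>R dir m j) * inv_fourier u (s *\<^sub>R dir m j))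
      = \<psi> (dir m j) * (complex_of_real \<bar>s\<bar> * (fourier f (s *\<^sub>R dir m j) * inv_fourier u (s *\<^sub>R dir m j)))" for s j
    using psi_symbol_line[OF e norm_dir, of s f m j] by (simp only: mult.assoc[symmetric])
  show ?thesis
    unfolding f_psi_delta_pairing[OF f u] line_symbol_mult
    unfolding dist_mult_def dist_scale_def dist_sum_def line_delta_def mult.assoc norm_scaleR norm_dir mult_1_right
    by (simp only: eq integral_mult_right_zero)
qed

text \<open>Continuity of the sum is inherited from its known value S on test functions; linearity
  passes through the series term by term.\<close>

lemma tempered_suminf:
  fixes T :: "nat \<Rightarrow> 'a::euclidean_space dist"
  assumes T: "tempered_summable T" and S: "tempered S" and eq: "\<And>\<phi>. \<phi> \<in> schwartz \<Longrightarrow> tempered_suminf T \<phi> = S \<phi>"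
  shows "tempered (tempered_suminf T)"
proof (rule tempered_cong[OF S eq])
  fix \<phi> \<theta> :: "'a \<Rightarrow> complex" and a b assume *: "\<phi> \<in> schwartz" "\<theta> \<in> schwartz"
  have s: "summable (\<lambda>k. T k \<phi>)" "summable (\<lambda>k. T k \<theta>)" and t: "\<And>k. tempered (T k)"
    using T * by (auto simp: tempered_summable_def)
  have "(\<Sum>k. T k (\<lambda>x. a * \<phi> x + b * \<theta> x)) = (\<Sum>k. a * T k \<phi> + b * T k \<theta>)"
    by (simp only: tempered_lin[OF t *])
  also have "\<dots> = a * (\<Sum>k. T k \<phi>) + b * (\<Sum>k. T k \<theta>)"
    using s by (simp add: suminf_add[symmetric] summable_mult suminf_mult)
  finally show "tempered_suminf T (\<lambda>x. a * \<phi> x + b * \<theta> x) = a * tempered_suminf T \<phi> + b * tempered_suminf T \<theta>"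
    unfolding tempered_suminf_def .
qed

lemma G_f_psi:
  assumes f: "f \<in> schwartz" and s: "smooth_on_circle \<psi>" and e: "even_on_circle \<psi>"
  shows "G m k (f_psi \<psi> f) = inv_fourier_dist (fun_dist (\<lambda>\<xi>. complex_of_real (2 * cos (2 * real m * real k * polar_angle \<xi>)) * psi_symbol \<psi> f \<xi>))"
    and "tempered (G m k (f_psi \<psi> f))"
proof -
  let ?c = "\<lambda>\<xi>. complex_of_real (2 * cos (2 * real m * real k * polar_angle \<xi>))"
  show eq: "G m k (f_psi \<psi> f) = inv_fourier_dist (fun_dist (\<lambda>\<xi>. ?c \<xi> * psi_symbol \<psi> f \<xi>))"
    by (simp add: G_def fourier_multiplier_def fourier_fun_eq[OF f_psi_fourier_fun(1)[OF f s e]]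
        inv_fourier_dist_def dist_mult_def fun_dist_def fun_eq_iff mult.assoc)
  have "(\<lambda>\<xi>. cos (2 * real (m * k) * polar_angle \<xi>)) \<in> borel_measurable borel" by (rule cos_polar_angle_measurable)
  then have "(\<lambda>\<xi>. complex_of_real (2 * cos (2 * real (m * k) * polar_angle \<xi>)) * psi_symbol \<psi> f \<xi>) \<in> borel_measurable borel"
    using psi_symbol_measurable[OF f s e] by measurable
  then have m: "(\<lambda>\<xi>. ?c \<xi> * psi_symbol \<psi> f \<xi>) \<in> borel_measurable borel"
    by (simp only: of_nat_mult mult.assoc)
  obtain A where "rapid 0 (psi_symbol \<psi> f) A" using psi_symbol_rapid[OF f s e] by blast
  then have A: "norm (psi_symbol \<psi> f \<xi>) \<le> A" for \<xi> by (simp add: rapid_def)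
  have "norm (?c \<xi> * psi_symbol \<psi> f \<xi>) \<le> 2 * A" for \<xi>
  proof -
    have "norm (?c \<xi>) \<le> 2" using abs_cos_le_one by (auto simp: abs_mult)
    then show ?thesis unfolding norm_mult[of "?c \<xi>"] using A by (intro mult_mono) auto
  qed
  then have "poly_bounded (\<lambda>\<xi>. ?c \<xi> * psi_symbol \<psi> f \<xi>)"
    unfolding poly_bounded_def by (intro exI[of _ "2 * A"] exI[of _ 0]) simp
  then show "tempered (G m k (f_psi \<psi> f))"
    unfolding eq by (intro slowly_growing_tempered(3) slowly_growing_fun_dist m)
qed

text \<open>For the product h of the symbol with the inverse transform of \<phi>, evenness splits
  the line moment into \<psi> on the circle times a moment that does not involve \<psi>, both
  bounded and Lipschitz. The nodes in the limit are the angles of the directions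
  \<open>dir m j\<close>, so the limit is the pairing with \<open>f_psi_delta\<close>.\<close>

lemma G_sums:
  fixes m :: nat
  assumes m: "m \<ge> 1" and f: "f \<in> schwartz" and s: "smooth_on_circle \<psi>" and e: "even_on_circle \<psi>" and \<phi>: "\<phi> \<in> schwartz"
  shows "(\<lambda>k. G m (Suc k) (f_psi \<psi> f) \<phi>) sums (fun_dist (f_psi_delta m \<psi> f) \<phi> - f_psi \<psi> f \<phi>)"
proof -
  let ?H = "\<lambda>\<xi>. fourier f \<xi> * inv_fourier \<phi> \<xi>"
  define h where "h \<xi> = psi_symbol \<psi> f \<xi> * inv_fourier \<phi> \<xi>" for \<xi>
  obtain B1 K1 where \<psi>: "\<And>\<theta>. norm (\<psi> (circle_point \<theta>)) \<le> B1"
    "\<And>x y. norm (\<psi> (circle_point x) - \<psi> (circle_point y)) \<le> K1 * \<bar>x - y\<bar>"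
    "continuous_on UNIV (\<lambda>\<theta>. \<psi> (circle_point \<theta>))"
    by (rule smooth_on_circle_Lipschitz[OF s e]) (rule that)
  obtain B2 K2 where H: "\<And>x. norm (line_moment ?H x) \<le> B2" "\<And>x y. norm (line_moment ?H x - line_moment ?H y) \<le> K2 * \<bar>x - y\<bar>"
    using line_moment_Lipschitz[OF f \<phi>] by blast
  have lm: "line_moment h x = \<psi> (circle_point x) * line_moment ?H x" for x
  proof -
    have "complex_of_real \<bar>s\<bar> * h (s *\<^sub>R circle_point x) = \<psi> (circle_point x) * (complex_of_real \<bar>s\<bar> * ?H (s *\<^sub>R circle_point x))" for s
      unfolding h_def using psi_symbol_line[OF e norm_circle_point, of s f x] by (simp only: mult.assoc[symmetric])
    then show ?thesis unfolding line_moment_def by (simp only: integral_mult_right_zero)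
  qed
  have B10: "0 \<le> B1" using order_trans[OF norm_ge_zero \<psi>(1)] .
  have B: "norm (line_moment h x) \<le> B1 * B2" for x
    unfolding lm norm_mult using \<psi>(1) H(1) B10 by (intro mult_mono) auto
  have C: "norm (line_moment h x - line_moment h y) \<le> (K1 * B2 + B1 * K2) * \<bar>x - y\<bar>" for x y
  proof -
    have d: "line_moment h x - line_moment h y = (\<psi> (circle_point x) - \<psi> (circle_point y)) * line_moment ?H x
        + \<psi> (circle_point y) * (line_moment ?H x - line_moment ?H y)"
      by (simp add: lm algebra_simps)
    have "norm (line_moment h x - line_moment h y) \<le> norm (\<psi> (circle_point x) - \<psi> (circle_point y)) * norm (line_moment ?H x)
        + norm (\<psi> (circle_point y)) * norm (line_moment ?H x - line_moment ?H y)"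
      unfolding d norm_mult[symmetric] by (rule norm_triangle_ineq)
    also have "\<dots> \<le> (K1 * \<bar>x - y\<bar>) * B2 + B1 * (K2 * \<bar>x - y\<bar>)"
      using \<psi> H B10 order_trans[OF norm_ge_zero \<psi>(2)[of x y]] by (intro add_mono mult_mono) auto
    finally show ?thesis by (simp add: algebra_simps)
  qed
  obtain A1 where A1: "rapid (0 + 2 * DIM(real ^ 2)) (inv_fourier \<phi>) A1" using rapid_fourier(2)[OF \<phi>] by blast
  obtain A0 where A0: "rapid 0 (psi_symbol \<psi> f) A0" using psi_symbol_rapid[OF f s e] by blast
  have A0': "norm (psi_symbol \<psi> f \<xi>) \<le> A0 * (1 + norm \<xi>) ^ 0" for \<xi> using A0 by (simp add: rapid_def)
  have "0 \<le> A0" using order_trans[OF norm_ge_zero A0'[of 0]] by simp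
  note bd = poly_bounded_times_rapid[OF A0' this A1]
  have im[measurable]: "inv_fourier \<phi> \<in> borel_measurable borel" using A1 by (simp add: rapid_def)
  have hm: "h \<in> borel_measurable borel"
    unfolding h_def using psi_symbol_measurable[OF f s e] by measurable
  have hi: "integrable lborel h"
    by (rule integrable_of_decay(1)[OF hm]) (use bd in \<open>simp add: h_def\<close>)
  have "(\<lambda>k. LINT \<xi>|lborel. complex_of_real (2 * cos (2 * real m * real (Suc k) * polar_angle \<xi>)) * h \<xi>)
    sums (complex_of_real (pi / real m) * (\<Sum>j=1..m. line_moment h (pi * real j / real m)) - (LINT \<xi>|lborel. h \<xi>))"
    by (rule dirichlet_polar_sums[OF hi m B C])
  moreover have "G m (Suc k) (f_psi \<psi> f) \<phi> = (LINT \<xi>|lborel. complex_of_real (2 * cos (2 * real m * real (Suc k) * polar_angle \<xi>)) * h \<xi>)" for k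
    unfolding G_f_psi(1)[OF f s e] inv_fourier_dist_def fun_dist_def h_def by (simp only: mult.assoc)
  moreover have "f_psi \<psi> f \<phi> = (LINT \<xi>|lborel. h \<xi>)"
    unfolding f_psi_def inv_fourier_dist_def fun_dist_psi_symbol[OF f s e im] unfolding fun_dist_def h_def ..
  moreover have "fun_dist (f_psi_delta m \<psi> f) \<phi> = complex_of_real (pi / real m) * (\<Sum>j=1..m. line_moment h (pi * real j / real m))"
    unfolding f_psi_delta_pairing[OF f schwartz_integrable'[OF \<phi>]] lm unfolding line_moment_def dir_def ..
  ultimately show ?thesis by simp
qed

theorem theorem3p2:
  fixes m :: nat and f \<psi> :: "real ^ 2 \<Rightarrow> complex"
  assumes "m \<ge> 1" and "f \<in> schwartz" and "smooth_on_circle \<psi>" and "even_on_circle \<psi>"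
  shows
    "(f_psi_delta m \<psi> f \<in> borel_measurable borel \<and> poly_bounded (f_psi_delta m \<psi> f)) \<and>
     (fourier_dist (fun_dist (f_psi_delta m \<psi> f)) =\<^sub>S
       dist_scale (complex_of_real (pi / real m))
         (dist_sum (\<lambda>j. dist_scale (\<psi> (dir m j))
            (dist_mult (\<lambda>\<xi>. complex_of_real (norm \<xi>) * fourier f \<xi>) (line_delta (dir m j))))
          {1..m})) \<and>
     (fourier_dist (fun_dist (f_psi_delta m \<psi> f)) =\<^sub>S
       dist_scale (complex_of_real (pi / real m))
         (dist_sum (\<lambda>j. dist_mult
            (\<lambda>\<xi>. complex_of_real (norm \<xi>) * (\<psi> (sgn \<xi>) * fourier f \<xi>)) (line_delta (dir m j)))
          {1..m})) \<and>
     (f_psi \<psi> f \<in> multiplier_domain) \<and>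
     (linear_operator (fourier_multiplier (line_symbol m))) \<and>
     (has_symbol (fourier_multiplier (line_symbol m)) (line_symbol m)) \<and>
     (fun_dist (f_psi_delta m \<psi> f) =\<^sub>S fourier_multiplier (line_symbol m) (f_psi \<psi> f)) \<and>
     (tempered_summable (\<lambda>k. G m (Suc k) (f_psi \<psi> f))) \<and>
     (fun_dist (f_psi_delta m \<psi> f) =\<^sub>S
       dist_add (f_psi \<psi> f) (tempered_suminf (\<lambda>k. G m (Suc k) (f_psi \<psi> f))))"
proof (intro conjI)
  note m = assms(1) and f = assms(2) and s = assms(3) and e = assms(4)
  let ?F = "f_psi_delta m \<psi> f" and ?u = "f_psi \<psi> f"
  let ?S1 = "dist_scale (complex_of_real (pi / real m))
         (dist_sum (\<lambda>j. dist_scale (\<psi> (dir m j))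
            (dist_mult (\<lambda>\<xi>. complex_of_real (norm \<xi>) * fourier f \<xi>) (line_delta (dir m j)))) {1..m})"
  let ?S2 = "dist_scale (complex_of_real (pi / real m))
         (dist_sum (\<lambda>j. dist_mult
            (\<lambda>\<xi>. complex_of_real (norm \<xi>) * (\<psi> (sgn \<xi>) * fourier f \<xi>)) (line_delta (dir m j))) {1..m})"
  show Fm: "?F \<in> borel_measurable borel" by (rule f_psi_delta_measurable[OF f])
  show Fb: "poly_bounded ?F" by (rule f_psi_delta_bounded[OF f])
  have Fs: "slowly_growing (fun_dist ?F)" by (rule slowly_growing_fun_dist[OF Fm Fb])
  have fb: "poly_bounded (fourier f)" "fourier f \<in> borel_measurable borel"
  proof -
    obtain A where "rapid 0 (fourier f) A" using rapid_fourier(1)[OF f] by blast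
    then have A: "norm (fourier f \<xi>) \<le> A" and "fourier f \<in> borel_measurable borel" for \<xi>
      by (simp_all add: rapid_def)
    then show "fourier f \<in> borel_measurable borel" by simp
    show "poly_bounded (fourier f)"
      unfolding poly_bounded_def using A by (intro exI[of _ A] exI[of _ 0]) simp
  qed
  have fi: "integrable lborel (fourier \<phi>)" if \<phi>: "\<phi> \<in> schwartz" for \<phi> :: "real ^ 2 \<Rightarrow> complex"
  proof -
    obtain A where "rapid (2 * DIM(real ^ 2)) (fourier \<phi>) A" using rapid_fourier(1)[OF \<phi>] by blast
    then show ?thesis by (rule rapid_integrable)
  qed
  \<comment> \<open>The pairing formula is used with u = \<open>fourier \<phi>\<close>, whose
    inverse transform is \<phi> again.\<close>
  have pair: "fourier_dist (fun_dist ?F) \<phi> = ?S1 \<phi>" if \<phi>: "\<phi> \<in> schwartz" for \<phi>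
    unfolding fourier_dist_def f_psi_delta_pairing[OF f fi[OF \<phi>]] inv_fourier_fourier[OF \<phi>]
    by (simp add: dist_scale_def dist_sum_def dist_mult_def line_delta_def mult.assoc)
  have "slowly_growing ?S1"
    using fb by (intro slowly_growing_scale slowly_growing_sum slowly_growing_line poly_bounded_norm_mult norm_dir) auto
  then have S1: "tempered ?S1" by (rule slowly_growing_tempered(1))
  show 1: "fourier_dist (fun_dist ?F) =\<^sub>S ?S1"
    using pair S1 slowly_growing_tempered(2)[OF Fs] by (simp add: tempered_eq_def)
  \<comment> \<open>An equality of functionals on all arguments: the integrands agree at every point
    of the lines, by evenness for t \<noteq> 0 and by the factor norm \<xi> at t = 0.\<close>
  have "?S1 = ?S2"
  proof -
    have "complex_of_real (norm (t *\<^sub>R dir m j)) * (\<psi> (sgn (t *\<^sub>R dir m j)) * fourier f (t *\<^sub>R dir m j))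
        = \<psi> (dir m j) * (complex_of_real (norm (t *\<^sub>R dir m j)) * fourier f (t *\<^sub>R dir m j))" for t j
    proof (cases "t = 0")
      case False
      then show ?thesis by (simp only: even_on_circle_line[OF e norm_dir False] mult_ac)
    qed simp
    then show ?thesis
      by (simp only: fun_eq_iff dist_scale_def dist_sum_def dist_mult_def line_delta_def mult.assoc integral_mult_right_zero simp_thms)
  qed
  then show "fourier_dist (fun_dist ?F) =\<^sub>S ?S2" using 1 by simp
  show "?u \<in> multiplier_domain"
    using f_psi_fourier_fun[OF f s e] by (auto simp: multiplier_domain_def)
  show "linear_operator (fourier_multiplier (line_symbol m))" by (rule line_multiplier_linear)
  show "has_symbol (fourier_multiplier (line_symbol m)) (line_symbol m)" by (rule line_multiplier_symbol)
  have A: "fourier_multiplier (line_symbol m) ?u = inv_fourier_dist (dist_mult (psi_symbol \<psi> f) (line_symbol m))"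
    by (simp only: fourier_multiplier_def fourier_fun_eq[OF f_psi_fourier_fun(1)[OF f s e]])
  have "tempered (fourier_multiplier (line_symbol m) ?u)"
    unfolding A by (intro slowly_growing_tempered(3) slowly_growing_line_symbol psi_symbol_measurable psi_symbol_poly_bounded f s e)
  \<comment> \<open>Here the pairing formula enters with u = \<phi> itself, the inverse transform
    being supplied by the definition of the multiplier.\<close>
  moreover have "fun_dist ?F \<phi> = fourier_multiplier (line_symbol m) ?u \<phi>" if "\<phi> \<in> schwartz" for \<phi>
    unfolding A inv_fourier_dist_def line_symbol_psi_symbol[OF f e schwartz_integrable'[OF that]] ..
  ultimately show "fun_dist ?F =\<^sub>S fourier_multiplier (line_symbol m) ?u"
    using slowly_growing_tempered(1)[OF Fs] by (simp add: tempered_eq_def)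
  let ?T = "\<lambda>k. G m (Suc k) ?u"
  have sums: "(\<lambda>k. ?T k \<phi>) sums (fun_dist ?F \<phi> - ?u \<phi>)" if "\<phi> \<in> schwartz" for \<phi>
    by (rule G_sums[OF m f s e that])
  show Ts: "tempered_summable ?T"
    unfolding tempered_summable_def using G_f_psi(2)[OF f s e] sums_summable[OF sums] by blast
  have Tsum: "tempered_suminf ?T \<phi> = fun_dist ?F \<phi> - ?u \<phi>" if "\<phi> \<in> schwartz" for \<phi>
    unfolding tempered_suminf_def using sums_unique[OF sums[OF that]] by simp
  have t: "tempered (fun_dist ?F)" "tempered ?u"
    using slowly_growing_tempered(1)[OF Fs] f_psi_fourier_fun(2)[OF f s e] by auto
  \<comment> \<open>On test functions the sum is the difference of two functionals already known to
    be tempered, so no bound uniform in the partial sums is called for.\<close>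
  have "tempered (tempered_suminf ?T)"
  proof (rule tempered_suminf[OF Ts tempered_combination[OF t, of 1 "-1"]])
    fix \<phi> :: "real ^ 2 \<Rightarrow> complex" assume "\<phi> \<in> schwartz"
    then show "tempered_suminf ?T \<phi> = dist_add (dist_scale 1 (fun_dist ?F)) (dist_scale (-1) ?u) \<phi>"
      by (simp add: Tsum dist_add_def dist_scale_def)
  qed
  from tempered_combination[OF t(2) this, of 1 1]
  have "tempered (dist_add ?u (tempered_suminf ?T))" by (simp add: dist_scale_def)
  then show "fun_dist ?F =\<^sub>S dist_add ?u (tempered_suminf ?T)"
    using t(1) Tsum by (simp add: tempered_eq_def dist_add_def)
qed

end
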